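(* There exists an algorithm $\textsc{FindRegularContaminated}(\varepsilon,d,H,\mathbf v_{\mathrm{head}},\tau,D)$ with the following guarantee. It takes as inputs $\varepsilon\in(0,1)$, a positive integer $d$, a set $H\subset[d]$, a vector $\mathbf v_{\mathrm{head}}\in\mathbb{R}^d$ supported on $H$, a value $\tau\in\mathbb{R}$, and sample access to a distribution $D$ supported on $\{\pm1\}^d\times\{\pm1\}$ such that $\mathrm{dist}_{\mathrm{TV}}(D,D_{\mathrm{clean}})\leq\eta$, where for $(\mathbf x,y)\sim D_{\mathrm{clean}}$: (i) $\mathbf x$ is uniform on $\{\pm1\}^d$, and (ii) $y=\mathrm{sign}(\mathbf v_{\mathrm{head}}\cdot\mathbf x+\mathbf v^*_{\mathrm{tail}}\cdot\mathbf x+\tau)$ for some $\mathbf v^*_{\mathrm{tail}}\in\mathbb{R}^d$ with $\|\mathbf v^*_{\mathrm{tail}}\|_2=1$, $(\mathbf v^*_{\mathrm{tail}})_i=0$ for all $i\in H$, and $\|\mathbf v^*_{\mathrm{tail}}\|_4^2\leq\varepsilon$. The algorithm runs in time $\mathrm{poly}(d/\varepsilon)$ and outputs, with probability at least $0.995$, a vector $\widehat{\mathbf v}\in\mathbb{R}^d$ such that \[ \Pr_{(\mathbf x,y)\sim D}\big[\mathrm{sign}(\widehat{\mathbf v}\cdot\mathbf x+\tau)\neq y\big]\leq O\Big(\frac{\eta}{\varepsilon^3}+\varepsilon\Big). \]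
   Context: $\mathrm{dist}_{\mathrm{TV}}$ is total variation distance; $\mathrm{sign}:\mathbb{R}\to\{\pm1\}$ is the sign function; "supported on $H$" means all coordinates outside $H$ are zero. *)

theory Defs
  imports "HOL-Probability.Probability" "HOL-Computational_Algebra.Polynomial"
begin

section \<open>Vectors, the cube, labelled distributions\<close>

text \<open>
  The dimension \<open>d\<close> is an input of the algorithm, so it cannot be a type. The index set
  \<open>[d]\<close> is \<open>{..<d}\<close>, and a vector of dimension \<open>d\<close> is a function on \<open>nat\<close> of which only the
  values below \<open>d\<close> are ever used.
\<close>

definition dotp :: "nat \<Rightarrow> (nat \<Rightarrow> real) \<Rightarrow> (nat \<Rightarrow> real) \<Rightarrow> real" where
  "dotp d u v = (\<Sum>i<d. u i * v i)"

definition pnorm :: "nat \<Rightarrow> nat \<Rightarrow> (nat \<Rightarrow> real) \<Rightarrow> real" where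
  "pnorm p d v = root p (\<Sum>i<d. \<bar>v i\<bar> ^ p)"

text \<open>Two-valued, unlike the library's \<open>sgn\<close>: the value at \<open>0\<close> is \<open>1\<close>.\<close>

definition sign_pm :: "real \<Rightarrow> real" where
  "sign_pm t = (if t \<ge> 0 then 1 else -1)"

definition cube :: "nat \<Rightarrow> (nat \<Rightarrow> real) set" where
  "cube d = PiE {..<d} (\<lambda>_. {-1, 1})"

type_synonym labelled = "(nat \<Rightarrow> real) \<times> real"

definition dist_TV :: "'a pmf \<Rightarrow> 'a pmf \<Rightarrow> real" where
  "dist_TV P Q = (SUP A. \<bar>measure_pmf.prob P A - measure_pmf.prob Q A\<bar>)"

definition error :: "nat \<Rightarrow> labelled pmf \<Rightarrow> (nat \<Rightarrow> real) \<Rightarrow> real \<Rightarrow> real" where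
  "error d D v \<tau> = measure_pmf.prob D {(x, y). sign_pm (dotp d v x + \<tau>) \<noteq> y}"


section \<open>Randomized real-RAM programs with sample access\<close>

text \<open>
  The model of computation is a While language over finitely many natural-number variables and
  finitely many named two-dimensional arrays holding exact real numbers. Real arithmetic consists
  of the field operations and comparison only. There is no rounding and no conversion from reals
  to naturals, and the only constants in a program text are naturals, so that a real constant
  cannot serve as nonuniform advice. Naturals are not multiplied in one step.
\<close>

type_synonym vname = string

datatype nexp = NConst nat | NVar vname | NAdd nexp nexp | NSub nexp nexp

datatype rexp = OfNat nexp | Cell vname nexp nexp
  | RAdd rexp rexp | RSub rexp rexp | RMul rexp rexp | RDiv rexp rexp

datatype bexp = NLess nexp nexp | RLess rexp rexp | BNot bexp | BAnd bexp bexp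

datatype com =
    Skip
  | NAssign vname nexp
  | RAssign vname nexp nexp rexp
  | Sample vname nexp
  | Coin vname
  | Seq com com
  | Cond bexp com com
  | While bexp com

record state =
  nvar :: "vname \<Rightarrow> nat"
  cell :: "vname \<Rightarrow> nat \<Rightarrow> nat \<Rightarrow> real"

primrec nval :: "nexp \<Rightarrow> state \<Rightarrow> nat" where
  "nval (NConst n) s = n"
| "nval (NVar x) s = nvar s x"
| "nval (NAdd e f) s = nval e s + nval f s"
| "nval (NSub e f) s = nval e s - nval f s"

primrec rval :: "rexp \<Rightarrow> state \<Rightarrow> real" where
  "rval (OfNat e) s = real (nval e s)"
| "rval (Cell a i j) s = cell s a (nval i s) (nval j s)"
| "rval (RAdd e f) s = rval e s + rval f s"
| "rval (RSub e f) s = rval e s - rval f s"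
| "rval (RMul e f) s = rval e s * rval f s"
| "rval (RDiv e f) s = rval e s / rval f s"

primrec bval :: "bexp \<Rightarrow> state \<Rightarrow> bool" where
  "bval (NLess e f) s = (nval e s < nval f s)"
| "bval (RLess e f) s = (rval e s < rval f s)"
| "bval (BNot b) s = (\<not> bval b s)"
| "bval (BAnd b c) s = (bval b s \<and> bval c s)"

definition set_nvar :: "vname \<Rightarrow> nat \<Rightarrow> state \<Rightarrow> state" where
  "set_nvar x n s = s\<lparr>nvar := (nvar s)(x := n)\<rparr>"

definition set_row :: "vname \<Rightarrow> nat \<Rightarrow> (nat \<Rightarrow> real) \<Rightarrow> state \<Rightarrow> state" where
  "set_row a i r s = s\<lparr>cell := (cell s)(a := (cell s a)(i := r))\<rparr>"

definition set_cell :: "vname \<Rightarrow> nat \<Rightarrow> nat \<Rightarrow> real \<Rightarrow> state \<Rightarrow> state" where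
  "set_cell a i j r s = set_row a i ((cell s a i)(j := r)) s"

text \<open>
  A draw \<open>(x, y)\<close> is delivered as a row: \<open>x\<close> in columns \<open>0, \<dots>, d - 1\<close>, \<open>y\<close> in column \<open>d\<close>, and \<open>0\<close>
  elsewhere.
\<close>

definition sample_row :: "nat \<Rightarrow> labelled \<Rightarrow> nat \<Rightarrow> real" where
  "sample_row d z j = (if j < d then fst z j else if j = d then snd z else 0)"

text \<open>
  One step of execution, when \<open>Sample\<close> draws from \<open>D\<close>; the draws of distinct steps are independent.
  A step evaluates a bounded number of expressions of the fixed program text, so the number of
  steps measures running time up to a constant factor (up to a factor \<open>d + 1\<close> if the entries of a
  sample are counted individually). The configuration with program \<open>Skip\<close> is the halted one, and
  it is absorbing.
\<close>

primrec step :: "nat \<Rightarrow> labelled pmf \<Rightarrow> com \<Rightarrow> state \<Rightarrow> (com \<times> state) pmf" where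
  "step d D Skip s = return_pmf (Skip, s)"
| "step d D (NAssign x e) s = return_pmf (Skip, set_nvar x (nval e s) s)"
| "step d D (RAssign a i j e) s =
     return_pmf (Skip, set_cell a (nval i s) (nval j s) (rval e s) s)"
| "step d D (Sample a i) s = map_pmf (\<lambda>z. (Skip, set_row a (nval i s) (sample_row d z) s)) D"
| "step d D (Coin x) s =
     map_pmf (\<lambda>b. (Skip, set_nvar x (if b then 1 else 0) s)) (bernoulli_pmf (1/2))"
| "step d D (Seq c1 c2) s =
     (if c1 = Skip then return_pmf (c2, s)
      else map_pmf (\<lambda>(c, s'). (Seq c c2, s')) (step d D c1 s))"
| "step d D (Cond b c1 c2) s = return_pmf (if bval b s then c1 else c2, s)"
| "step d D (While b c) s = return_pmf (if bval b s then Seq c (While b c) else Skip, s)"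

primrec run :: "nat \<Rightarrow> labelled pmf \<Rightarrow> nat \<Rightarrow> com \<times> state \<Rightarrow> (com \<times> state) pmf" where
  "run d D 0 cfg = return_pmf cfg"
| "run d D (Suc t) cfg = bind_pmf (step d D (fst cfg) (snd cfg)) (run d D t)"

text \<open>
  The inputs are stored in the variable \<open>d\<close> and the arrays \<open>eps\<close>, \<open>tau\<close>, \<open>vhead\<close> and \<open>H\<close> (as an
  indicator vector). The rest of the memory is \<open>0\<close>. The output vector is row \<open>0\<close> of the array \<open>out\<close>.
\<close>

definition init_state :: "real \<Rightarrow> nat \<Rightarrow> nat set \<Rightarrow> (nat \<Rightarrow> real) \<Rightarrow> real \<Rightarrow> state" where
  "init_state \<epsilon> d H v\<^sub>h \<tau> =
     \<lparr>nvar = (\<lambda>_. 0)(''d'' := d),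
      cell = (\<lambda>a i j.
        if a = ''eps'' \<and> i = 0 \<and> j = 0 then \<epsilon>
        else if a = ''tau'' \<and> i = 0 \<and> j = 0 then \<tau>
        else if a = ''vhead'' \<and> i = 0 \<and> j < d then v\<^sub>h j
        else if a = ''H'' \<and> i = 0 \<and> j < d \<and> j \<in> H then 1
        else 0)\<rparr>"

definition output_vec :: "state \<Rightarrow> nat \<Rightarrow> real" where
  "output_vec s i = cell s ''out'' 0 i"

end

(* The learner runs stochastic subgradient descent, without projection, on the hinge loss of width
   epsilon restricted to |vh.x + tau| <= 1/epsilon, starting from vh and averaging the iterates.
   The regular part v is a good comparator: its clean loss is at most epsilon times the probability of
   |vh.x + v.x + tau| <= epsilon, which is O(epsilon) by Esseen's inequality and the third moment
   bound sum |v_i|^3 <= ||v||_4^2.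

   If eta > epsilon^3 the claim is trivial, so the corrupted mass is at most epsilon^3. Corrupted
   points can still have |v.x| of order sqrt d, and v is unknown. They are filtered online: a second
   learner accumulates the matrix A of the products x_i x_j (j < i) of all accepted points, and a point
   is accepted iff <A, x x^T> <= 1/epsilon. Under the uniform distribution <A, x x^T> has mean 0 and
   variance |A|^2, so only corrupted points let |A| grow, and by at most 1/epsilon per step in the
   inner product. As |<A, v v^T>| <= |A| up to a constant, the accepted corrupted points have a small
   second moment in direction v, whatever v is. The drift of |w - v|^2 - <A, V> / epsilon with
   V_ij = 2 v_i v_j combines both facts, and Markov's inequality gives the success probability. *)

theory Submission
  imports Defs
begin

section \<open>Moments on the cube\<close>

text \<open>How the scales fit. Write k for \<open>filter_rate\<close> and r for
  \<open>learn_rate\<close>. Corrupted mass at most \<open>\<epsilon> ^ 3\<close>, entering <A, x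
  x^T> with at most \<open>1 / \<epsilon>\<close> per point, lets |A|^2 grow by O(k eps^2) per step
  beyond a factor 1 + k. Over a horizon of order 1/k this keeps E |A|^2 at O(eps^2) and E <A, V> at
  O(eps). The obstacle is that no single step bounds the second moment of the accepted corrupted
  points along v. It is bounded only by the expected growth of <A, V> in that step, divided by k, up
  to O(eps) terms. The comparator pays about eps times this quantity, and the learner pays r times
  that. The choice r = k / eps^2 gives r eps = k / eps, so the payments telescope to <A, V> / eps,
  which is O(1) on average. The learner thus has a total budget O(1): the accepted losses of all
  iterates sum to O(1/r), their average over about 1/k steps is O(eps^2), and division by the hinge
  width turns this into an error O(eps). Each one-step estimate holds at an arbitrary state, so the
  dependence of filter and learner on a common past does no harm.\<close>

lemma finite_cube [simp]: "finite (cube d)"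
  unfolding cube_def by (intro finite_PiE) auto

lemma card_cube: "card (cube d) = 2 ^ d"
  unfolding cube_def by (subst card_PiE) (auto simp: numeral_eq_Suc)

lemma cube_nth: "x \<in> cube d \<Longrightarrow> i < d \<Longrightarrow> x i = -1 \<or> x i = 1"
  unfolding cube_def by (auto dest!: PiE_mem[where x = i])

lemma cube_nonempty [simp]: "cube d \<noteq> {}"
  unfolding cube_def by (simp add: PiE_eq_empty_iff)

lemma flip_cube: "x \<in> cube d \<Longrightarrow> m < d \<Longrightarrow> x(m := - x m) \<in> cube d"
  unfolding cube_def PiE_iff extensional_def by auto

lemma sum_cube_flip:
  assumes "m < d"
  shows "(\<Sum>x\<in>cube d. f (x(m := - x m))) = (\<Sum>x\<in>cube d. f x)"
  by (rule sum.reindex_bij_witness[where i = "\<lambda>x. x(m := - x m)" and j = "\<lambda>x. x(m := - x m)"])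
     (use assms flip_cube in auto)

text \<open>Flipping coordinate \<open>m\<close> permutes the cube, so the sum equals its own
  negative. The vanishing moments below come from a coordinate that occurs exactly once.\<close>

lemma sum_cube_odd:
  fixes f :: "(nat \<Rightarrow> real) \<Rightarrow> real"
  assumes "m < d" "\<And>x. x \<in> cube d \<Longrightarrow> f (x(m := - x m)) = - f x"
  shows "(\<Sum>x\<in>cube d. f x) = 0"
proof -
  have "(\<Sum>x\<in>cube d. f x) = (\<Sum>x\<in>cube d. f (x(m := - x m)))"
    using sum_cube_flip[OF assms(1)] by metis
  also have "\<dots> = - (\<Sum>x\<in>cube d. f x)"
    by (simp add: assms(2) sum_negf)
  finally show ?thesis by simp
qed

text \<open>Only pairs \<open>j < i\<close> occur: on the cube a diagonal would add a constant, and
  without it the monomials x_i x_j are orthonormal under the uniform law. Hence mean 0 and variance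
  \<open>inner2 d A A\<close>.\<close>

definition quad :: "nat \<Rightarrow> (nat \<Rightarrow> nat \<Rightarrow> real) \<Rightarrow> (nat \<Rightarrow> real) \<Rightarrow> real" where
  "quad d A x = (\<Sum>i<d. \<Sum>j<i. A i j * x i * x j)"

definition inner2 :: "nat \<Rightarrow> (nat \<Rightarrow> nat \<Rightarrow> real) \<Rightarrow> (nat \<Rightarrow> nat \<Rightarrow> real) \<Rightarrow> real" where
  "inner2 d A B = (\<Sum>i<d. \<Sum>j<i. A i j * B i j)"

lemma sum_triangle: "(\<Sum>i<d. \<Sum>j<i. f i j) = (\<Sum>(i, j)\<in>(SIGMA i:{..<d}. {..<i}). f i j)"
  for f :: "nat \<Rightarrow> nat \<Rightarrow> real"
  by (simp add: sum.Sigma)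

lemma sum_cube_quad: "(\<Sum>x\<in>cube d. quad d A x) = 0"
proof -
  have "(\<Sum>x\<in>cube d. quad d A x) = (\<Sum>i<d. \<Sum>j<i. \<Sum>x\<in>cube d. A i j * x i * x j)"
    unfolding quad_def by (subst sum.swap, rule sum.cong, simp, subst sum.swap, simp)
  also have "\<dots> = 0"
  proof -
    have "(\<Sum>x\<in>cube d. A i j * x i * x j) = 0" if "i < d" "j < i" for i j
      using that by (intro sum_cube_odd[of i]) auto
    thus ?thesis by simp
  qed
  finally show ?thesis .
qed

lemma sum_cube_four:
  assumes "j < i" "i < d" "l < k" "k < d"
  shows "(\<Sum>x\<in>cube d. x i * x j * (x k * x l)) = (if i = k \<and> j = l then 2 ^ d else 0)"
proof (cases "i = k \<and> j = l")
  case True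
  have "x i * x j * (x i * x j) = 1" if "x \<in> cube d" for x
    using cube_nth[OF that, of i] cube_nth[OF that, of j] assms by auto
  thus ?thesis using True by (simp add: card_cube)
next
  case False
  \<comment> \<open>The coordinate that occurs exactly once is \<open>i\<close> in the first case,
    \<open>j\<close> in the second and \<open>k\<close> in the third, where j < i = l < k.\<close>
  consider "i \<noteq> k" "i \<noteq> l" | "i = k" "j \<noteq> l" | "i = l" using False by blast
  hence "(\<Sum>x\<in>cube d. x i * x j * (x k * x l)) = 0"
  proof cases
    case 1
    thus ?thesis using assms by (intro sum_cube_odd[of i]) auto
  next
    case 2
    thus ?thesis using assms by (intro sum_cube_odd[of j]) auto
  next
    case 3
    thus ?thesis using assms by (intro sum_cube_odd[of k]) auto
  qed
  thus ?thesis using False by simp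
qed

text \<open>Parseval's identity in degree two. It identifies |A|^2 with the variance of the filter
  statistic on clean points.\<close>

lemma sum_cube_quad_sq: "(\<Sum>x\<in>cube d. (quad d A x)\<^sup>2) = 2 ^ d * inner2 d A A"
proof -
  let ?I = "SIGMA i:{..<d}. {..<i}"
  have fin: "finite ?I" by auto
  have q: "quad d A x = (\<Sum>a\<in>?I. A (fst a) (snd a) * (x (fst a) * x (snd a)))" for x
    unfolding quad_def by (subst sum_triangle) (auto intro!: sum.cong)
  have "(\<Sum>x\<in>cube d. (quad d A x)\<^sup>2) =
      (\<Sum>x\<in>cube d. \<Sum>a\<in>?I. \<Sum>b\<in>?I. A (fst a) (snd a) * A (fst b) (snd b) *
         (x (fst a) * x (snd a) * (x (fst b) * x (snd b))))"
    unfolding q power2_eq_square sum_product by (simp add: mult_ac)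
  also have "\<dots> = (\<Sum>a\<in>?I. \<Sum>b\<in>?I. A (fst a) (snd a) * A (fst b) (snd b) *
         (\<Sum>x\<in>cube d. x (fst a) * x (snd a) * (x (fst b) * x (snd b))))"
    unfolding sum_distrib_left
    by (subst sum.swap, rule sum.cong, simp, subst sum.swap, simp)
  also have "\<dots> = (\<Sum>a\<in>?I. \<Sum>b\<in>?I. if a = b then A (fst a) (snd a) * A (fst a) (snd a) * 2 ^ d else 0)"
    by (intro sum.cong refl, subst sum_cube_four) (auto simp: prod_eq_iff)
  also have "\<dots> = (\<Sum>a\<in>?I. A (fst a) (snd a) * A (fst a) (snd a) * 2 ^ d)"
    using fin by (intro sum.cong refl) (simp add: sum.delta')
  also have "\<dots> = 2 ^ d * inner2 d A A"
    unfolding inner2_def sum_triangle sum_distrib_left by (auto intro!: sum.cong)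
  finally show ?thesis .
qed

lemma sum_sq_triangle:
  fixes a :: "nat \<Rightarrow> real"
  shows "(\<Sum>i<d. a i)\<^sup>2 = (\<Sum>i<d. (a i)\<^sup>2) + (\<Sum>i<d. \<Sum>j<i. 2 * a i * a j)"
  by (induction d) (auto simp: power2_eq_square algebra_simps sum_distrib_left sum_distrib_right)

text \<open>The factor 2 makes up for counting each pair once: \<open>quad d (outer w) x\<close> is
  (w.x)^2 minus its mean |w|^2.\<close>

definition outer :: "(nat \<Rightarrow> real) \<Rightarrow> nat \<Rightarrow> nat \<Rightarrow> real" where
  "outer w i j = 2 * w i * w j"

lemma dotp_sq:
  assumes "x \<in> cube d"
  shows "(dotp d w x)\<^sup>2 = dotp d w w + quad d (outer w) x"
proof -
  have "(w i * x i)\<^sup>2 = w i * w i" if "i < d" for i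
    using cube_nth[OF assms that] by (auto simp: power2_eq_square)
  thus ?thesis
    unfolding dotp_def sum_sq_triangle quad_def outer_def by (simp add: mult_ac)
qed

text \<open>Expanding the square of the sum of the w_i^2 gives half of the left side plus the
  nonnegative diagonal sum of the w_i^4.\<close>

lemma inner2_outer: "inner2 d (outer w) (outer w) \<le> 2 * (dotp d w w)\<^sup>2"
proof -
  have "(dotp d w w)\<^sup>2 = (\<Sum>i<d. (w i * w i)\<^sup>2) + (\<Sum>i<d. \<Sum>j<i. 2 * (w i * w i) * (w j * w j))"
    unfolding dotp_def by (rule sum_sq_triangle)
  moreover have "2 * (\<Sum>i<d. \<Sum>j<i. 2 * (w i * w i) * (w j * w j)) = inner2 d (outer w) (outer w)"
    unfolding inner2_def outer_def sum_distrib_left by (intro sum.cong refl) (simp add: mult_ac)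
  moreover have "(\<Sum>i<d. (w i * w i)\<^sup>2) \<ge> 0" by (intro sum_nonneg) auto
  ultimately show ?thesis by linarith
qed

lemma dotp_self_nonneg: "dotp d w w \<ge> 0"
  unfolding dotp_def by (intro sum_nonneg) auto

lemma inner2_self_nonneg: "inner2 d A A \<ge> 0"
  unfolding inner2_def by (intro sum_nonneg) auto

section \<open>Small ball probability\<close>

text \<open>The characteristic function of a Rademacher sum. Pairing each point with its flip at
  \<open>k\<close> turns cos (Y + s) + cos (Y - s) into 2 cos Y cos s; the phase
  \<open>\<theta>\<close> later absorbs the shift \<open>\<tau>\<close>.\<close>

lemma sum_cube_cos:
  assumes "k \<le> d"
  shows "(\<Sum>x\<in>cube d. cos (\<theta> + (\<Sum>i<k. s i * x i))) = 2 ^ d * cos \<theta> * (\<Prod>i<k. cos (s i))"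
  using assms
proof (induction k)
  case 0
  show ?case by (simp add: card_cube)
next
  case (Suc k)
  let ?Y = "\<lambda>x. \<theta> + (\<Sum>i<k. s i * x i)"
  have Y: "?Y (x(k := - x k)) = ?Y x" for x
    by (intro arg_cong[where f = "(+) \<theta>"] sum.cong) auto
  have S: "\<theta> + (\<Sum>i<Suc k. s i * x i) = ?Y x + s k * x k" for x
    by simp
  have "2 * (\<Sum>x\<in>cube d. cos (?Y x + s k * x k)) =
      (\<Sum>x\<in>cube d. cos (?Y x + s k * x k)) +
      (\<Sum>x\<in>cube d. cos (?Y (x(k := - x k)) + s k * (x(k := - x k)) k))"
    using Suc.prems by (subst sum_cube_flip[where f = "\<lambda>x. cos (?Y x + s k * x k)"]) auto
  also have "\<dots> = (\<Sum>x\<in>cube d. cos (?Y x + s k * x k) + cos (?Y x - s k * x k))"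
    unfolding Y by (simp add: sum.distrib)
  also have "\<dots> = (\<Sum>x\<in>cube d. 2 * (cos (?Y x) * cos (s k)))"
  proof (rule sum.cong)
    fix x assume "x \<in> cube d"
    hence "x k = -1 \<or> x k = 1" using Suc.prems cube_nth by auto
    thus "cos (?Y x + s k * x k) + cos (?Y x - s k * x k) = 2 * (cos (?Y x) * cos (s k))"
      by (auto simp: cos_add cos_diff)
  qed simp
  also have "\<dots> = 2 * (cos (s k) * (\<Sum>x\<in>cube d. cos (?Y x)))"
    by (simp flip: sum_distrib_left sum_distrib_right)
  finally show ?case unfolding S using Suc by simp
qed

text \<open>1 - cos x <= x for x >= 0, integrated twice: once to sin u >= u - u^2/2, once more to
  the claim. The base inequality is 1 - cos x = 2 sin^2 (x/2) <= 2 |sin (x/2)|.\<close>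

lemma cos_le_cubic: "cos t \<le> 1 - t\<^sup>2 / 2 + \<bar>t\<bar> ^ 3 / 6" for t :: real
proof -
  have *: "cos t \<le> 1 - t\<^sup>2 / 2 + t ^ 3 / 6" if t: "t \<ge> 0" for t :: real
  proof -
    have s: "sin u \<ge> u - u\<^sup>2 / 2" if u: "u \<ge> 0" for u :: real
    proof -
      let ?f = "\<lambda>u::real. sin u - u + u\<^sup>2 / 2"
      have "?f 0 \<le> ?f u"
      proof (rule DERIV_nonneg_imp_nondecreasing[OF u])
        fix x :: real assume x: "0 \<le> x" "x \<le> u"
        have "(?f has_real_derivative (cos x - 1 + x)) (at x)"
          by (auto intro!: derivative_eq_intros)
        moreover have "cos x - 1 + x \<ge> 0"
        proof -
          have c: "1 - cos x = 2 * (sin (x/2))\<^sup>2" using cos_double_sin[of "x/2"] by simp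
          have a: "\<bar>sin (x/2)\<bar> \<le> x/2" using abs_sin_x_le_abs_x[of "x/2"] x by simp
          have "(sin (x/2))\<^sup>2 = \<bar>sin (x/2)\<bar> * \<bar>sin (x/2)\<bar>" by (simp add: power2_eq_square)
          also have "\<dots> \<le> \<bar>sin (x/2)\<bar> * 1" by (intro mult_left_mono) auto
          finally show ?thesis using c a by linarith
        qed
        ultimately show "\<exists>y. DERIV ?f x :> y \<and> 0 \<le> y" by blast
      qed
      thus ?thesis by simp
    qed
    let ?g = "\<lambda>t::real. 1 - t\<^sup>2 / 2 + t ^ 3 / 6 - cos t"
    have "?g 0 \<le> ?g t"
    proof (rule DERIV_nonneg_imp_nondecreasing[OF t])
      fix x :: real assume x: "0 \<le> x" "x \<le> t"
      have "(?g has_real_derivative (- x + x\<^sup>2 / 2 + sin x)) (at x)"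
        by (auto intro!: derivative_eq_intros)
      moreover have "- x + x\<^sup>2 / 2 + sin x \<ge> 0" using s[OF x(1)] by simp
      ultimately show "\<exists>y. DERIV ?g x :> y \<and> 0 \<le> y" by blast
    qed
    thus ?thesis by simp
  qed
  show ?thesis using *[of "\<bar>t\<bar>"] by simp
qed

text \<open>Squaring removes the sign of the cosine, and the double angle formula makes the square
  affine in cos (2 t), so the cubic bound applies to every real t.\<close>

lemma cos_sq_le_exp: "(cos t)\<^sup>2 \<le> exp (- t\<^sup>2 + \<bar>t\<bar> ^ 3)" for t :: real
proof -
  have "(cos t)\<^sup>2 = (1 + cos (2 * t)) / 2" by (simp add: cos_double_cos)
  also have "\<dots> \<le> 1 + (- t\<^sup>2 + \<bar>t\<bar> ^ 3)"
  proof -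
    define c where "c = \<bar>t\<bar> ^ 3"
    have "cos (2 * t) \<le> 1 - 2 * t\<^sup>2 + 4 / 3 * c"
      using cos_le_cubic[of "2 * t"] by (simp add: abs_mult power_mult_distrib c_def)
    moreover have "0 \<le> c" by (simp add: c_def)
    ultimately show ?thesis unfolding c_def[symmetric] by (simp add: field_simps)
  qed
  also have "\<dots> \<le> exp (- t\<^sup>2 + \<bar>t\<bar> ^ 3)" by (rule exp_ge_add_one_self)
  finally show ?thesis .
qed

text \<open>The cosine transform of the triangle weight is the Fejer kernel, found by parts;
  \<open>R / 2\<close> is its limit at 0. What matters is that it is nonnegative.\<close>

lemma fejer_integral:
  fixes R z :: real
  assumes "R > 0"
  shows "((\<lambda>t. (1 - t / R) * cos (t * z)) has_integral
           (if z = 0 then R / 2 else (1 - cos (R * z)) / (R * z\<^sup>2))) {0..R}"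
proof (cases "z = 0")
  case True
  have "((\<lambda>t::real. 1 - t / R) has_integral ((R - R\<^sup>2 / (2 * R)) - (0 - 0\<^sup>2 / (2 * R)))) {0..R}"
    using assms
    by (intro fundamental_theorem_of_calculus)
       (auto intro!: derivative_eq_intros simp flip: has_real_derivative_iff_has_vector_derivative
         simp: field_simps)
  thus ?thesis using True assms by (simp add: power2_eq_square field_simps)
next
  case False
  let ?G = "\<lambda>t. (1 - t / R) * sin (t * z) / z - cos (t * z) / (R * z\<^sup>2)"
  have "(?G has_real_derivative
      (0 - 1 / R) * sin (t * z) / z + (1 - t / R) * (cos (t * z) * z) / z + sin (t * z) * z / (R * z\<^sup>2)) (at t within {0..R})" for t
    using assms False
    by (auto intro!: derivative_eq_intros simp: add_divide_distrib diff_divide_distrib)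
  moreover have "(0 - 1 / R) * sin (t * z) / z + (1 - t / R) * (cos (t * z) * z) / z + sin (t * z) * z / (R * z\<^sup>2)
      = (1 - t / R) * cos (t * z)" for t
    using assms False by (simp add: power2_eq_square)
  ultimately have "((\<lambda>t. (1 - t / R) * cos (t * z)) has_integral (?G R - ?G 0)) {0..R}"
    using assms by (intro fundamental_theorem_of_calculus)
      (auto simp flip: has_real_derivative_iff_has_vector_derivative)
  thus ?thesis using False assms by (simp add: diff_divide_distrib)
qed

text \<open>By the cubic bound (1 - cos t) / t^2 is at least 1/2 - |t|/6, which is at least 5/12 for
  |t| <= 1/2.\<close>

lemma fejer_lower:
  fixes R z :: real
  assumes "R > 0"
  shows "of_bool (\<bar>R * z\<bar> \<le> 1 / 2) * (R * 5 / 12) \<le> (if z = 0 then R / 2 else (1 - cos (R * z)) / (R * z\<^sup>2))"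
proof -
  have c: "1 - cos t \<ge> 5 / 12 * t\<^sup>2" if "\<bar>t\<bar> \<le> 1 / 2" for t :: real
  proof -
    have "cos t \<le> 1 - t\<^sup>2 / 2 + \<bar>t\<bar> ^ 3 / 6" by (rule cos_le_cubic)
    moreover have "\<bar>t\<bar> ^ 3 = \<bar>t\<bar> * t\<^sup>2" by (simp add: power3_eq_cube power2_eq_square)
    moreover have "\<bar>t\<bar> * t\<^sup>2 \<le> 1 / 2 * t\<^sup>2" using that by (intro mult_right_mono) auto
    ultimately show ?thesis by simp
  qed
  show ?thesis
  proof (cases "\<bar>R * z\<bar> \<le> 1 / 2 \<and> z \<noteq> 0")
    case True
    have "R * 5 / 12 = (5 / 12 * (R * z)\<^sup>2) / (R * z\<^sup>2)"
      using assms True by (simp add: field_simps power2_eq_square)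
    also have "\<dots> \<le> (1 - cos (R * z)) / (R * z\<^sup>2)"
      using assms True by (intro divide_right_mono c) auto
    finally show ?thesis using True by simp
  next
    case False
    thus ?thesis using assms by auto
  qed
qed

lemma prod_cos_le:
  fixes a v :: "nat \<Rightarrow> real"
  assumes t: "0 \<le> t" "t * \<epsilon> \<le> 1 / 2"
    and av: "\<And>i. i < d \<Longrightarrow> a i = v i \<or> v i = 0"
    and v2: "(\<Sum>i<d. (v i)\<^sup>2) = 1" and v3: "(\<Sum>i<d. \<bar>v i\<bar> ^ 3) \<le> \<epsilon>"
  shows "\<bar>\<Prod>i<d. cos (t * a i)\<bar> \<le> exp (1 - t)"
proof -
  have "(\<Prod>i<d. cos (t * a i))\<^sup>2 = (\<Prod>i<d. (cos (t * a i))\<^sup>2)"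
    by (simp add: prod_power_distrib)
  also have "\<dots> \<le> (\<Prod>i<d. exp (- (t * v i)\<^sup>2 + \<bar>t * v i\<bar> ^ 3))"
  proof (intro prod_mono conjI)
    fix i assume "i \<in> {..<d}"
    hence "a i = v i \<or> v i = 0" using av by auto
    moreover have "(cos (t * a i))\<^sup>2 \<le> 1" by (simp add: abs_square_le_1)
    ultimately show "(cos (t * a i))\<^sup>2 \<le> exp (- (t * v i)\<^sup>2 + \<bar>t * v i\<bar> ^ 3)"
      using cos_sq_le_exp[of "t * v i"] by auto
  qed auto
  also have "\<dots> = exp (\<Sum>i<d. - (t * v i)\<^sup>2 + \<bar>t * v i\<bar> ^ 3)"
    by (simp add: exp_sum)
  also have "(\<Sum>i<d. - (t * v i)\<^sup>2 + \<bar>t * v i\<bar> ^ 3) = - t\<^sup>2 * (\<Sum>i<d. (v i)\<^sup>2) + t ^ 3 * (\<Sum>i<d. \<bar>v i\<bar> ^ 3)"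
    using t by (simp add: sum.distrib sum_subtractf sum_negf sum_distrib_left power_mult_distrib abs_mult)
  also have "\<dots> \<le> - t\<^sup>2 + t ^ 3 * \<epsilon>"
    using v2 v3 t by (auto intro!: mult_left_mono)
  also have "t ^ 3 * \<epsilon> = t\<^sup>2 * (t * \<epsilon>)" by (simp add: power3_eq_cube power2_eq_square)
  \<comment> \<open>The hypothesis on t lets the cubic term absorb at most half of the Gaussian
    exponent.\<close>
  also have "- t\<^sup>2 + t\<^sup>2 * (t * \<epsilon>) \<le> - t\<^sup>2 + t\<^sup>2 * (1 / 2)"
    using t by (intro add_left_mono mult_left_mono) auto
  \<comment> \<open>This is (t - 2)^2 >= 0. The linear exponent has an elementary integral, and
    removing the square halves it to 1 - t.\<close>
  also have "- t\<^sup>2 + t\<^sup>2 * (1 / 2) \<le> 2 * (1 - t)"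
    using zero_le_power2[of "t - 2"] by (simp add: power2_eq_square algebra_simps)
  also have "exp (2 * (1 - t)) = (exp (1 - t))\<^sup>2"
    by (rule exp_double)
  finally have "(\<Prod>i<d. cos (t * a i))\<^sup>2 \<le> (exp (1 - t))\<^sup>2" by simp
  hence "\<bar>\<Prod>i<d. cos (t * a i)\<bar> \<le> \<bar>exp (1 - t)\<bar>" by (simp only: abs_le_square_iff)
  thus ?thesis by simp
qed

text \<open>Esseen's inequality: testing against the Fejer kernel only involves the characteristic
  function on \<open>\<bar>t\<bar> \<le> 1 / (2 * \<epsilon>)\<close>, where the third moment bound still gives Gaussian decay. Coordinates
  with \<open>v i = 0\<close> contribute factors of modulus at most 1, so no independence argument is needed
  for the part of \<open>a\<close> outside the support of \<open>v\<close>.\<close>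

lemma small_ball:
  fixes a v :: "nat \<Rightarrow> real"
  assumes e: "0 < \<epsilon>"
    and av: "\<And>i. i < d \<Longrightarrow> a i = v i \<or> v i = 0"
    and v2: "(\<Sum>i<d. (v i)\<^sup>2) = 1" and v3: "(\<Sum>i<d. \<bar>v i\<bar> ^ 3) \<le> \<epsilon>"
  shows "(\<Sum>x\<in>cube d. of_bool (\<bar>dotp d a x + \<tau>\<bar> \<le> \<epsilon>)) / 2 ^ d \<le> 15 * \<epsilon>"
proof -
  \<comment> \<open>With this R, |Z| <= eps means |R Z| <= 1/2, as in \<open>fejer_lower\<close>,
    and t <= R means t eps <= 1/2, as in \<open>prod_cos_le\<close>.\<close>
  define R where "R = 1 / (2 * \<epsilon>)"
  have R: "R > 0" using e by (simp add: R_def)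
  let ?Z = "\<lambda>x. dotp d a x + \<tau>"
  let ?K = "\<lambda>z. if z = 0 then R / 2 else (1 - cos (R * z)) / (R * z\<^sup>2)"
  let ?h = "\<lambda>t. (1 - t / R) * (2 ^ d * cos (t * \<tau>) * (\<Prod>i<d. cos (t * a i)))"
  have "((\<lambda>t. \<Sum>x\<in>cube d. (1 - t / R) * cos (t * ?Z x)) has_integral (\<Sum>x\<in>cube d. ?K (?Z x))) {0..R}"
    by (intro has_integral_sum fejer_integral R) simp
  moreover have "(\<Sum>x\<in>cube d. (1 - t / R) * cos (t * ?Z x)) = ?h t" for t
  proof -
    have "t * ?Z x = t * \<tau> + (\<Sum>i<d. (t * a i) * x i)" for x
      by (simp add: dotp_def algebra_simps sum_distrib_left)
    thus ?thesis using sum_cube_cos[of d d "t * \<tau>" "\<lambda>i. t * a i"] by (simp flip: sum_distrib_left)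
  qed
  ultimately have h: "(?h has_integral (\<Sum>x\<in>cube d. ?K (?Z x))) {0..R}" by simp
  have "((\<lambda>t. 2 ^ d * exp (1 - t)) has_integral (- (2 ^ d * exp (1 - R)) - (- (2 ^ d * exp (1 - 0))))) {0..R}"
    using R
    by (intro fundamental_theorem_of_calculus)
       (auto intro!: derivative_eq_intros simp flip: has_real_derivative_iff_has_vector_derivative)
  note h' = this
  have "(\<Sum>x\<in>cube d. ?K (?Z x)) \<le> - (2 ^ d * exp (1 - R)) - (- (2 ^ d * exp (1 - 0)))"
  proof -
    have "?h t \<le> 2 ^ d * exp (1 - t)" if "t \<in> {0..R}" for t
    proof -
      have t: "0 \<le> t" "t * \<epsilon> \<le> 1 / 2" "\<bar>1 - t / R\<bar> \<le> 1"
        using that e by (auto simp: R_def field_simps)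
      have "?h t \<le> \<bar>?h t\<bar>" by (rule abs_ge_self)
      also have "\<dots> = 2 ^ d * (\<bar>1 - t / R\<bar> * \<bar>cos (t * \<tau>)\<bar> * \<bar>\<Prod>i<d. cos (t * a i)\<bar>)"
        by (simp add: abs_mult)
      also have "\<dots> \<le> 2 ^ d * (1 * 1 * exp (1 - t))"
        using t prod_cos_le[OF t(1,2) av v2 v3]
        by (intro mult_left_mono mult_mono) auto
      finally show ?thesis by simp
    qed
    thus ?thesis using has_integral_le[OF h h'] by blast
  qed
  also have "\<dots> \<le> 2 ^ d * exp 1" by simp
  also have "\<dots> \<le> 2 ^ d * 3" using exp_le by simp
  finally have up: "(\<Sum>x\<in>cube d. ?K (?Z x)) \<le> 2 ^ d * 3" .
  have "(\<Sum>x\<in>cube d. of_bool (\<bar>?Z x\<bar> \<le> \<epsilon>)) * (R * 5 / 12) =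
      (\<Sum>x\<in>cube d. of_bool (\<bar>R * ?Z x\<bar> \<le> 1 / 2) * (R * 5 / 12))"
    unfolding sum_distrib_right
    using e by (intro sum.cong refl) (auto simp: R_def abs_mult field_simps)
  also have "\<dots> \<le> (\<Sum>x\<in>cube d. ?K (?Z x))"
    by (intro sum_mono fejer_lower R)
  finally have "(\<Sum>x\<in>cube d. of_bool (\<bar>?Z x\<bar> \<le> \<epsilon>)) * (R * 5 / 12) \<le> 2 ^ d * 3"
    using up by linarith
  \<comment> \<open>Here R * 5/12 = 5 / (24 eps), so the probability is at most 3 * 24/5 * eps =
    14.4 eps.\<close>
  thus ?thesis using e by (simp add: R_def field_simps)
qed

section \<open>From the norm hypotheses to power sums\<close>

lemma cauchy_schwarz_cubes:
  fixes v :: "nat \<Rightarrow> real"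
  shows "(\<Sum>i<d. \<bar>v i\<bar> ^ 3)\<^sup>2 \<le> (\<Sum>i<d. (v i)\<^sup>2) * (\<Sum>i<d. (v i) ^ 4)"
proof -
  have 1: "\<bar>t\<bar> ^ 3 = \<bar>t\<bar> * t\<^sup>2" "\<bar>t\<bar>\<^sup>2 = t\<^sup>2" "(t\<^sup>2)\<^sup>2 = t ^ 4" for t :: real
    by (simp_all add: power3_eq_cube power2_eq_square power4_eq_xxxx)
  have "(\<Sum>i<d. \<bar>v i\<bar> * (v i)\<^sup>2)\<^sup>2 \<le> (\<Sum>i<d. \<bar>v i\<bar>\<^sup>2) * (\<Sum>i<d. ((v i)\<^sup>2)\<^sup>2)"
    by (rule Cauchy_Schwarz_ineq_sum)
  thus ?thesis unfolding 1 .
qed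

lemma pnorm_conditions:
  assumes "pnorm 2 d v = 1" "(pnorm 4 d v)\<^sup>2 \<le> \<epsilon>"
  shows "(\<Sum>i<d. (v i)\<^sup>2) = 1" "(\<Sum>i<d. \<bar>v i\<bar> ^ 3) \<le> \<epsilon>"
proof -
  have pow: "(pnorm p d v) ^ p = (\<Sum>i<d. \<bar>v i\<bar> ^ p)" if "p > 0" for p
    unfolding pnorm_def using that by (intro real_root_pow_pos2 sum_nonneg) auto
  have "(\<Sum>i<d. \<bar>v i\<bar> ^ 2) = 1"
    using pow[of 2] unfolding assms(1) by simp
  thus 1: "(\<Sum>i<d. (v i)\<^sup>2) = 1" by simp
  have e: "\<epsilon> \<ge> 0" using assms(2) zero_le_power2 order_trans by blast
  have "(\<Sum>i<d. (v i) ^ 4) = ((pnorm 4 d v)\<^sup>2)\<^sup>2"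
    using pow[of 4] by simp
  also have "\<dots> \<le> \<epsilon>\<^sup>2" using assms(2) by (rule power_mono) simp
  finally have "(\<Sum>i<d. \<bar>v i\<bar> ^ 3)\<^sup>2 \<le> \<epsilon>\<^sup>2"
    using cauchy_schwarz_cubes[of v d] unfolding 1 by linarith
  thus "(\<Sum>i<d. \<bar>v i\<bar> ^ 3) \<le> \<epsilon>" using e by (rule power2_le_imp_le)
qed

section \<open>One step of the learner\<close>

definition base :: "nat \<Rightarrow> real \<Rightarrow> (nat \<Rightarrow> real) \<Rightarrow> (nat \<Rightarrow> real) \<Rightarrow> real" where
  "base d \<tau> vh x = \<tau> + dotp d vh x"

definition accept :: "nat \<Rightarrow> real \<Rightarrow> (nat \<Rightarrow> nat \<Rightarrow> real) \<Rightarrow> (nat \<Rightarrow> real) \<Rightarrow> bool" where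
  "accept d \<epsilon> A x \<longleftrightarrow> quad d A x \<le> 1 / \<epsilon>"

text \<open>Where this holds, \<open>hinge\<close> with \<open>c = 1\<close> is positive with
  subgradient -y x in w; elsewhere it is 0 and w stays put.\<close>

definition active :: "nat \<Rightarrow> real \<Rightarrow> real \<Rightarrow> (nat \<Rightarrow> real) \<Rightarrow> (nat \<Rightarrow> real) \<Rightarrow> labelled \<Rightarrow> bool" where
  "active d \<epsilon> \<tau> vh w z \<longleftrightarrow> \<bar>base d \<tau> vh (fst z)\<bar> \<le> 1 / \<epsilon> \<and>
     snd z * (base d \<tau> vh (fst z) + dotp d w (fst z)) < \<epsilon>"

text \<open>The factor \<open>c\<close> homogenizes the loss, so that \<open>hinge\<close> at \<open>(n, w\<^sub>1 + \<dots> + w\<^sub>n)\<close> is \<open>n\<close> times the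
  loss of the average.\<close>

definition hinge :: "nat \<Rightarrow> real \<Rightarrow> real \<Rightarrow> (nat \<Rightarrow> real) \<Rightarrow> real \<Rightarrow> (nat \<Rightarrow> real) \<Rightarrow> labelled \<Rightarrow> real" where
  "hinge d \<epsilon> \<tau> vh c w z = (if \<bar>base d \<tau> vh (fst z)\<bar> \<le> 1 / \<epsilon>
     then max 0 (c * \<epsilon> - snd z * (c * base d \<tau> vh (fst z) + dotp d w (fst z))) else 0)"

text \<open>A change of A by k x x^T costs k^2 times the number of pairs, at most k^2 d^2. With k
  d^2 = eps^4 this is at most k eps^2, the size of the first-order error.\<close>

definition filter_rate :: "nat \<Rightarrow> real \<Rightarrow> real" where
  "filter_rate d \<epsilon> = \<epsilon> ^ 4 / (real d)\<^sup>2"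

text \<open>The square of d keeps the ratio to \<open>filter_rate\<close> at exactly eps^2, on which
  the telescoping in \<open>potential\<close> depends.\<close>

definition learn_rate :: "nat \<Rightarrow> real \<Rightarrow> real" where
  "learn_rate d \<epsilon> = \<epsilon>\<^sup>2 / (real d)\<^sup>2"

text \<open>Entries off the triangle are kept, as the program does not touch them and its arrays are
  compared with the learner state as whole functions.\<close>

definition next_A :: "nat \<Rightarrow> real \<Rightarrow> (nat \<Rightarrow> nat \<Rightarrow> real) \<Rightarrow> labelled \<Rightarrow> nat \<Rightarrow> nat \<Rightarrow> real" where
  "next_A d \<epsilon> A z i j = (if i < d \<and> j < i
     then A i j + (if accept d \<epsilon> A (fst z) then filter_rate d \<epsilon> else 0) * fst z i * fst z j else A i j)"

definition next_w :: "nat \<Rightarrow> real \<Rightarrow> real \<Rightarrow> (nat \<Rightarrow> real) \<Rightarrow> (nat \<Rightarrow> real) \<Rightarrow> (nat \<Rightarrow> nat \<Rightarrow> real) \<Rightarrow> labelled \<Rightarrow> nat \<Rightarrow> real" where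
  "next_w d \<epsilon> \<tau> vh w A z i = (if i < d
     then w i + (if accept d \<epsilon> A (fst z) \<and> active d \<epsilon> \<tau> vh w z then snd z * learn_rate d \<epsilon> else 0) * fst z i
     else w i)"

section \<open>Effect of one fixed sample on |A|^2 and |w - v|^2\<close>

lemma abs_le_young:
  fixes t l :: real
  assumes "l > 0"
  shows "\<bar>t\<bar> \<le> l / 2 * t\<^sup>2 + 1 / (2 * l)"
proof -
  have "0 \<le> (l * \<bar>t\<bar> - 1)\<^sup>2" by simp
  hence "2 * l * \<bar>t\<bar> \<le> l\<^sup>2 * t\<^sup>2 + 1" by (simp add: power2_eq_square algebra_simps)
  thus ?thesis using assms by (simp add: field_simps power2_eq_square)
qed

lemma sum_pairs: "(\<Sum>i<d. \<Sum>j<i. 1 :: real) \<le> (real d)\<^sup>2"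
proof -
  have "(\<Sum>i<d. \<Sum>j<i. 1 :: real) \<le> (\<Sum>i<d. real d)" by (intro sum_mono) auto
  thus ?thesis by (simp add: power2_eq_square)
qed

lemma inner2_rank_one:
  "inner2 d (\<lambda>i j. if i < d \<and> j < i then A i j + k * x i * x j else A i j) B = inner2 d A B + k * quad d B x"
proof -
  have "inner2 d (\<lambda>i j. if i < d \<and> j < i then A i j + k * x i * x j else A i j) B
      = (\<Sum>i<d. \<Sum>j<i. A i j * B i j + k * (B i j * x i * x j))"
    unfolding inner2_def by (intro sum.cong refl) (auto simp: algebra_simps)
  thus ?thesis by (simp add: inner2_def quad_def sum.distrib sum_distrib_left)
qed

lemma inner2_commute: "inner2 d A B = inner2 d B A"
  unfolding inner2_def by (simp add: mult.commute)

lemma quad_rank_one: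
  assumes "x \<in> cube d"
  shows "quad d (\<lambda>i j. if i < d \<and> j < i then A i j + k * x i * x j else A i j) x
     = quad d A x + k * (\<Sum>i<d. \<Sum>j<i. 1)"
proof -
  have "x i * x j * (x i * x j) = 1" if "i < d" "j < i" for i j
    using cube_nth[OF assms, of i] cube_nth[OF assms, of j] that by auto
  hence "quad d (\<lambda>i j. if i < d \<and> j < i then A i j + k * x i * x j else A i j) x
      = (\<Sum>i<d. \<Sum>j<i. A i j * x i * x j + k * 1)"
    unfolding quad_def by (intro sum.cong refl) (auto simp: algebra_simps)
  thus ?thesis by (simp only: quad_def sum.distrib sum_distrib_left)
qed

lemma inner2_next_A: "inner2 d (next_A d \<epsilon> A z) B =
    inner2 d A B + (if accept d \<epsilon> A (fst z) then filter_rate d \<epsilon> else 0) * quad d B (fst z)"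
  unfolding next_A_def inner2_rank_one ..

text \<open>The rank-one rule is applied in each argument. On the cube, x x^T has squared norm equal
  to the number of pairs \<open>j < i\<close>, which is at most d^2.\<close>

lemma inner2_next_A_self:
  assumes "fst z \<in> cube d"
  shows "inner2 d (next_A d \<epsilon> A z) (next_A d \<epsilon> A z) \<le> inner2 d A A +
    of_bool (accept d \<epsilon> A (fst z)) * (2 * filter_rate d \<epsilon> * quad d A (fst z)) + (filter_rate d \<epsilon>)\<^sup>2 * (real d)\<^sup>2"
proof -
  let ?k = "if accept d \<epsilon> A (fst z) then filter_rate d \<epsilon> else 0"
  have "quad d (next_A d \<epsilon> A z) (fst z) = quad d A (fst z) + ?k * (\<Sum>i<d. \<Sum>j<i. 1)"
    unfolding next_A_def by (rule quad_rank_one[OF assms])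
  hence "inner2 d (next_A d \<epsilon> A z) (next_A d \<epsilon> A z) =
      inner2 d A A + ?k * quad d A (fst z) + ?k * (quad d A (fst z) + ?k * (\<Sum>i<d. \<Sum>j<i. 1))"
    by (simp only: inner2_next_A[of d \<epsilon> A z "next_A d \<epsilon> A z"] inner2_next_A[of d \<epsilon> A z A]
      inner2_commute[of d A "next_A d \<epsilon> A z"])
  also have "\<dots> = inner2 d A A + 2 * ?k * quad d A (fst z) + ?k\<^sup>2 * (\<Sum>i<d. \<Sum>j<i. 1)"
    by (simp add: algebra_simps power2_eq_square)
  also have "\<dots> \<le> inner2 d A A + 2 * ?k * quad d A (fst z) + (filter_rate d \<epsilon>)\<^sup>2 * (real d)\<^sup>2"
    by (intro add_left_mono mult_mono sum_pairs sum_nonneg) auto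
  finally show ?thesis by auto
qed

lemma dotp_add: "dotp d (\<lambda>i. f i + g i) x = dotp d f x + dotp d g x"
  unfolding dotp_def by (simp add: algebra_simps sum.distrib)

lemma dotp_diff: "dotp d (\<lambda>i. f i - g i) x = dotp d f x - dotp d g x"
  unfolding dotp_def by (simp add: algebra_simps sum_subtractf)

lemma dotp_self_add_scaled:
  assumes "x \<in> cube d"
  shows "dotp d (\<lambda>i. f i + k * x i) (\<lambda>i. f i + k * x i) = dotp d f f + 2 * k * dotp d f x + k\<^sup>2 * real d"
proof -
  have "(f i + k * x i) * (f i + k * x i) = f i * f i + 2 * k * (f i * x i) + k\<^sup>2" if "i < d" for i
    using cube_nth[OF assms that] by (auto simp: algebra_simps power2_eq_square)
  hence "dotp d (\<lambda>i. f i + k * x i) (\<lambda>i. f i + k * x i) = (\<Sum>i<d. f i * f i + 2 * k * (f i * x i) + k\<^sup>2)"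
    unfolding dotp_def by (intro sum.cong refl) auto
  thus ?thesis by (simp add: dotp_def sum.distrib sum_distrib_left)
qed

text \<open>The subgradient inequality for an arbitrary comparator v: an active point has y (w -
  v).x <= loss v - loss w by convexity, an inactive one has loss w = 0, and a rejected one changes
  nothing.\<close>

lemma next_w_dist:
  assumes z: "fst z \<in> cube d" "snd z \<in> {-1, 1}"
  shows "dotp d (\<lambda>i. next_w d \<epsilon> \<tau> vh w A z i - v i) (\<lambda>i. next_w d \<epsilon> \<tau> vh w A z i - v i) \<le>
     dotp d (\<lambda>i. w i - v i) (\<lambda>i. w i - v i) + of_bool (accept d \<epsilon> A (fst z)) *
       (2 * learn_rate d \<epsilon> * (hinge d \<epsilon> \<tau> vh 1 v z - hinge d \<epsilon> \<tau> vh 1 w z)) + (learn_rate d \<epsilon>)\<^sup>2 * real d"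
proof -
  let ?x = "fst z"
  let ?f = "\<lambda>i. w i - v i"
  define k where "k = (if accept d \<epsilon> A ?x \<and> active d \<epsilon> \<tau> vh w z then snd z * learn_rate d \<epsilon> else 0)"
  have "dotp d (\<lambda>i. next_w d \<epsilon> \<tau> vh w A z i - v i) (\<lambda>i. next_w d \<epsilon> \<tau> vh w A z i - v i) =
      dotp d (\<lambda>i. ?f i + k * ?x i) (\<lambda>i. ?f i + k * ?x i)"
    unfolding dotp_def next_w_def k_def by (intro sum.cong refl) (simp add: algebra_simps)
  also have "\<dots> = dotp d ?f ?f + 2 * (k * dotp d ?f ?x) + k\<^sup>2 * real d"
    using dotp_self_add_scaled[OF z(1)] by simp
  also have "\<dots> \<le> dotp d ?f ?f + 2 * (of_bool (accept d \<epsilon> A ?x) * (learn_rate d \<epsilon> * (hinge d \<epsilon> \<tau> vh 1 v z - hinge d \<epsilon> \<tau> vh 1 w z)))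
      + (learn_rate d \<epsilon>)\<^sup>2 * real d"
  proof (intro add_mono mult_left_mono mult_right_mono order_refl)
    show "k\<^sup>2 \<le> (learn_rate d \<epsilon>)\<^sup>2" using z by (auto simp: k_def power_mult_distrib)
    have "0 \<le> hinge d \<epsilon> \<tau> vh 1 v z" by (simp add: hinge_def)
    moreover have "hinge d \<epsilon> \<tau> vh 1 w z = 0" if "\<not> active d \<epsilon> \<tau> vh w z"
      using that by (auto simp: hinge_def active_def)
    moreover have "snd z * dotp d ?f ?x \<le> hinge d \<epsilon> \<tau> vh 1 v z - hinge d \<epsilon> \<tau> vh 1 w z" if "active d \<epsilon> \<tau> vh w z"
      using that by (auto simp: hinge_def active_def dotp_diff algebra_simps)
    moreover have "learn_rate d \<epsilon> \<ge> 0" by (simp add: learn_rate_def)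
    ultimately show "k * dotp d ?f ?x \<le> of_bool (accept d \<epsilon> A ?x) *
       (learn_rate d \<epsilon> * (hinge d \<epsilon> \<tau> vh 1 v z - hinge d \<epsilon> \<tau> vh 1 w z))"
      unfolding k_def
      by (auto simp: mult.commute[of "snd z"] mult.assoc intro!: mult_left_mono)
  qed auto
  finally show ?thesis by (simp add: mult_ac)
qed

lemma hinge_nonneg: "0 \<le> hinge d \<epsilon> \<tau> vh c w z"
  by (simp add: hinge_def)

text \<open>The positive part of a form that is linear in (c, w) jointly is subadditive.\<close>

lemma hinge_subadditive:
  "hinge d \<epsilon> \<tau> vh (a + b) (\<lambda>i. f i + g i) z \<le> hinge d \<epsilon> \<tau> vh a f z + hinge d \<epsilon> \<tau> vh b g z"
  unfolding hinge_def dotp_add by (auto simp: max_def algebra_simps)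

lemma hinge_le:
  assumes "0 < \<epsilon>" "\<epsilon> < 1" "snd z \<in> {-1, 1}"
  shows "hinge d \<epsilon> \<tau> vh 1 w z \<le> 2 / \<epsilon> + \<bar>dotp d w (fst z)\<bar>"
proof -
  have "\<epsilon> \<le> 1 / \<epsilon>" using assms by (simp add: field_simps mult_le_one)
  thus ?thesis using assms by (auto simp: hinge_def)
qed

text \<open>Weights on the finite set of labelled points: \<open>p\<close> is observed,
  \<open>q\<close> is clean. The two \<open>excess\<close> bounds are the two sides of total
  variation, and \<open>anti\<close> is the small ball estimate for the true score.\<close>

locale contamination =
  fixes d :: nat and \<epsilon> \<eta> \<tau> :: real and vh v :: "nat \<Rightarrow> real" and p q :: "labelled \<Rightarrow> real"
  assumes d_pos: "0 < d" and eps: "0 < \<epsilon>" "\<epsilon> < 1" and eta: "0 \<le> \<eta>" "\<eta> \<le> \<epsilon> ^ 3"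
    and p_nonneg: "\<And>z. 0 \<le> p z" and q_nonneg: "\<And>z. 0 \<le> q z"
    and sum_p: "(\<Sum>z\<in>cube d \<times> {-1, 1}. p z) = 1"
    and q_fst: "\<And>f. (\<Sum>z\<in>cube d \<times> {-1, 1}. q z * f (fst z)) = (\<Sum>x\<in>cube d. f x) / 2 ^ d"
    and excess: "(\<Sum>z\<in>cube d \<times> {-1, 1}. max 0 (p z - q z)) \<le> \<eta>"
      "(\<Sum>z\<in>cube d \<times> {-1, 1}. max 0 (q z - p z)) \<le> \<eta>"
    and clean: "\<And>z. z \<in> cube d \<times> {-1, 1} \<Longrightarrow> q z \<noteq> 0 \<Longrightarrow>
      snd z = sign_pm (dotp d vh (fst z) + dotp d v (fst z) + \<tau>)"
    and v_unit: "dotp d v v = 1"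
    and anti: "(\<Sum>x\<in>cube d. of_bool (\<bar>dotp d vh x + dotp d v x + \<tau>\<bar> \<le> \<epsilon>)) / 2 ^ d \<le> 15 * \<epsilon>"
begin

abbreviation "\<Omega> \<equiv> cube d \<times> {-1, 1 :: real}"
abbreviation "loss \<equiv> hinge d \<epsilon> \<tau> vh 1"
abbreviation "acc A z \<equiv> accept d \<epsilon> A (fst z)"
abbreviation "V \<equiv> outer v"

text \<open>\<open>bad\<close> is the mass that the adversary adds and \<open>lost\<close> the mass
  that it removes. As \<open>lost\<close> lies below \<open>q\<close>, clean moments control it;
  \<open>bad\<close> may sit anywhere, and only the filter restrains it.\<close>

definition "bad z = max 0 (p z - q z)"
definition "lost z = max 0 (q z - p z)"

lemma p_split: "p z = q z + bad z - lost z"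
  by (simp add: bad_def lost_def)

lemma bad: "0 \<le> bad z" "bad z \<le> p z" and lost: "0 \<le> lost z" "lost z \<le> q z"
  using p_nonneg[of z] q_nonneg[of z] by (auto simp: bad_def lost_def)

lemma sum_bad: "(\<Sum>z\<in>\<Omega>. bad z) \<le> \<eta>" and sum_lost: "(\<Sum>z\<in>\<Omega>. lost z) \<le> \<eta>"
  using excess by (simp_all add: bad_def lost_def)

lemma sum_p_split: "(\<Sum>z\<in>\<Omega>. p z * f z) = (\<Sum>z\<in>\<Omega>. q z * f z) + (\<Sum>z\<in>\<Omega>. bad z * f z) - (\<Sum>z\<in>\<Omega>. lost z * f z)"
proof -
  have "p z * f z = q z * f z + bad z * f z - lost z * f z" for z
    by (subst p_split) (simp add: algebra_simps)
  thus ?thesis by (simp only: sum.distrib sum_subtractf)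
qed

lemma sum_q: "(\<Sum>z\<in>\<Omega>. q z) = 1"
  using q_fst[of "\<lambda>_. 1"] by (simp add: card_cube)

lemma sum_q_quad: "(\<Sum>z\<in>\<Omega>. q z * quad d A (fst z)) = 0"
  using q_fst[of "quad d A"] by (simp add: sum_cube_quad)

lemma sum_q_quad_sq: "(\<Sum>z\<in>\<Omega>. q z * (quad d A (fst z))\<^sup>2) = inner2 d A A"
  using q_fst[of "\<lambda>x. (quad d A x)\<^sup>2"] by (simp add: sum_cube_quad_sq)

lemma sum_q_dotp_sq: "(\<Sum>z\<in>\<Omega>. q z * (dotp d w (fst z))\<^sup>2) = dotp d w w"
proof -
  have "(\<Sum>z\<in>\<Omega>. q z * (dotp d w (fst z))\<^sup>2) = (\<Sum>x\<in>cube d. dotp d w w + quad d (outer w) x) / 2 ^ d"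
    using q_fst[of "\<lambda>x. (dotp d w x)\<^sup>2"] by (simp add: dotp_sq)
  thus ?thesis by (simp add: sum.distrib sum_cube_quad card_cube)
qed

text \<open>Any part \<open>c\<close> of the clean mass sees at most the clean second moment of f.
  The weight \<open>l\<close> balances that moment against the mass of \<open>c\<close>; it is
  applied to lost and to rejected mass.\<close>

lemma sum_sub_young:
  assumes c: "\<And>z. z \<in> \<Omega> \<Longrightarrow> 0 \<le> c z \<and> c z \<le> q z" and l: "l > 0"
  shows "(\<Sum>z\<in>\<Omega>. c z * \<bar>f z\<bar>) \<le> l / 2 * (\<Sum>z\<in>\<Omega>. q z * (f z)\<^sup>2) + (\<Sum>z\<in>\<Omega>. c z) / (2 * l)"
proof -
  have "(\<Sum>z\<in>\<Omega>. c z * \<bar>f z\<bar>) \<le> (\<Sum>z\<in>\<Omega>. l / 2 * (q z * (f z)\<^sup>2) + c z / (2 * l))"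
  proof (rule sum_mono)
    fix z :: labelled assume z: "z \<in> \<Omega>"
    have "c z * \<bar>f z\<bar> \<le> c z * (l / 2 * (f z)\<^sup>2 + 1 / (2 * l))"
      using c[OF z] by (intro mult_left_mono abs_le_young l) auto
    also have "\<dots> = l / 2 * (c z * (f z)\<^sup>2) + c z / (2 * l)" by (simp add: algebra_simps)
    also have "\<dots> \<le> l / 2 * (q z * (f z)\<^sup>2) + c z / (2 * l)"
      using c[OF z] l by (intro add_right_mono mult_left_mono mult_right_mono) auto
    finally show "c z * \<bar>f z\<bar> \<le> l / 2 * (q z * (f z)\<^sup>2) + c z / (2 * l)" .
  qed
  thus ?thesis by (simp add: sum.distrib sum_distrib_left sum_divide_distrib)
qed

definition "rej A z = q z * of_bool (\<not> acc A z)"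

lemma rej: "0 \<le> rej A z \<and> rej A z \<le> q z"
  using q_nonneg[of z] by (auto simp: rej_def)

text \<open>Chebyshev's inequality: rejection means that a variable of clean variance |A|^2 exceeds
  \<open>1 / \<epsilon>\<close>.\<close>

lemma rej_mass: "(\<Sum>z\<in>\<Omega>. rej A z) \<le> \<epsilon>\<^sup>2 * inner2 d A A"
proof -
  have "(\<Sum>z\<in>\<Omega>. rej A z) \<le> (\<Sum>z\<in>\<Omega>. \<epsilon>\<^sup>2 * (q z * (quad d A (fst z))\<^sup>2))"
  proof (rule sum_mono)
    fix z :: labelled
    have "1 \<le> \<epsilon>\<^sup>2 * (quad d A (fst z))\<^sup>2" if "\<not> acc A z"
    proof -
      have "1 \<le> \<epsilon> * quad d A (fst z)" using that eps by (simp add: accept_def field_simps)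
      hence "1\<^sup>2 \<le> (\<epsilon> * quad d A (fst z))\<^sup>2" by (intro power_mono) auto
      thus ?thesis by (simp add: power_mult_distrib)
    qed
    hence "of_bool (\<not> acc A z) \<le> \<epsilon>\<^sup>2 * (quad d A (fst z))\<^sup>2" by auto
    hence "q z * of_bool (\<not> acc A z) \<le> q z * (\<epsilon>\<^sup>2 * (quad d A (fst z))\<^sup>2)"
      by (intro mult_left_mono q_nonneg)
    thus "rej A z \<le> \<epsilon>\<^sup>2 * (q z * (quad d A (fst z))\<^sup>2)" by (simp add: rej_def mult_ac)
  qed
  thus ?thesis by (simp add: sum_q_quad_sq flip: sum_distrib_left)
qed

lemma eta_div: "\<eta> / \<epsilon> \<le> \<epsilon>\<^sup>2" "\<eta> \<le> \<epsilon>\<^sup>2" "\<eta> \<le> \<epsilon>"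
proof -
  show "\<eta> / \<epsilon> \<le> \<epsilon>\<^sup>2" using eta eps by (simp add: field_simps power3_eq_cube power2_eq_square)
  have "\<epsilon> ^ 3 \<le> \<epsilon> ^ 2" "\<epsilon> ^ 3 \<le> \<epsilon> ^ 1" using eps by (intro power_decreasing; simp)+
  thus "\<eta> \<le> \<epsilon>\<^sup>2" "\<eta> \<le> \<epsilon>" using eta by auto
qed

lemma eps_powers: "\<epsilon>\<^sup>2 \<le> \<epsilon>" "\<epsilon> ^ 4 \<le> \<epsilon>\<^sup>2"
  using eps power_decreasing[of 1 2 \<epsilon>] power_decreasing[of 2 4 \<epsilon>] by auto

text \<open>Here the one-sided test pays off: rejected clean points have positive
  \<open>quad\<close>, so restricting the mean 0 to accepted points only lowers it. Accepted bad
  mass gives at most eta / eps <= eps^2, and lost mass is handled by Young with weight 1.\<close>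

lemma filter_drift:
  "(\<Sum>z\<in>\<Omega>. p z * (of_bool (acc A z) * quad d A (fst z))) \<le> inner2 d A A / 2 + 3 / 2 * \<epsilon>\<^sup>2"
proof -
  have q: "(\<Sum>z\<in>\<Omega>. q z * (of_bool (acc A z) * quad d A (fst z))) \<le> 0"
  proof -
    have "(\<Sum>z\<in>\<Omega>. q z * (of_bool (acc A z) * quad d A (fst z))) \<le> (\<Sum>z\<in>\<Omega>. q z * quad d A (fst z))"
    proof (intro sum_mono mult_left_mono q_nonneg)
      fix z :: labelled
      have "0 < 1 / \<epsilon>" using eps by simp
      hence "0 \<le> quad d A (fst z)" if "\<not> acc A z" using that unfolding accept_def by linarith
      thus "of_bool (acc A z) * quad d A (fst z) \<le> quad d A (fst z)" by auto
    qed
    thus ?thesis by (simp add: sum_q_quad)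
  qed
  have b: "(\<Sum>z\<in>\<Omega>. bad z * (of_bool (acc A z) * quad d A (fst z))) \<le> \<epsilon>\<^sup>2"
  proof -
    have "(\<Sum>z\<in>\<Omega>. bad z * (of_bool (acc A z) * quad d A (fst z))) \<le> (\<Sum>z\<in>\<Omega>. bad z * (1 / \<epsilon>))"
      using eps by (intro sum_mono mult_left_mono bad) (auto simp: accept_def)
    also have "\<dots> \<le> \<eta> * (1 / \<epsilon>)"
      unfolding sum_distrib_right[symmetric] using eps by (intro mult_right_mono sum_bad) auto
    finally show ?thesis using eta_div by simp
  qed
  have "- (\<Sum>z\<in>\<Omega>. lost z * (of_bool (acc A z) * quad d A (fst z))) \<le> (\<Sum>z\<in>\<Omega>. lost z * \<bar>quad d A (fst z)\<bar>)"
    unfolding sum_negf[symmetric] mult_minus_right[symmetric]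
    by (intro sum_mono mult_left_mono lost) auto
  also have "\<dots> \<le> 1 / 2 * inner2 d A A + (\<Sum>z\<in>\<Omega>. lost z) / (2 * 1)"
    using sum_sub_young[of lost 1 "\<lambda>z. quad d A (fst z)"] lost by (simp add: sum_q_quad_sq)
  also have "\<dots> \<le> inner2 d A A / 2 + \<epsilon>\<^sup>2 / 2" using sum_lost eta_div by simp
  finally show ?thesis using q b by (subst sum_p_split) linarith
qed

lemma rate: "0 < filter_rate d \<epsilon>" "0 < learn_rate d \<epsilon>" "filter_rate d \<epsilon> = \<epsilon>\<^sup>2 * learn_rate d \<epsilon>"
  "(filter_rate d \<epsilon>)\<^sup>2 * (real d)\<^sup>2 \<le> filter_rate d \<epsilon> * \<epsilon>\<^sup>2"
  "(learn_rate d \<epsilon>)\<^sup>2 * real d \<le> learn_rate d \<epsilon> * \<epsilon>\<^sup>2"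
proof -
  show "0 < filter_rate d \<epsilon>" "0 < learn_rate d \<epsilon>"
    using d_pos eps by (auto simp: filter_rate_def learn_rate_def)
  show "filter_rate d \<epsilon> = \<epsilon>\<^sup>2 * learn_rate d \<epsilon>"
    by (simp add: filter_rate_def learn_rate_def flip: power_add)
  have d: "1 \<le> real d" "1 \<le> (real d)\<^sup>2" using d_pos by auto
  have "filter_rate d \<epsilon> * (real d)\<^sup>2 = \<epsilon> ^ 4" using d_pos by (simp add: filter_rate_def)
  hence "(filter_rate d \<epsilon>)\<^sup>2 * (real d)\<^sup>2 = filter_rate d \<epsilon> * \<epsilon> ^ 4" by (simp add: power2_eq_square)
  thus "(filter_rate d \<epsilon>)\<^sup>2 * (real d)\<^sup>2 \<le> filter_rate d \<epsilon> * \<epsilon>\<^sup>2"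
    using eps_powers \<open>0 < filter_rate d \<epsilon>\<close> by simp
  have "learn_rate d \<epsilon> * real d \<le> learn_rate d \<epsilon> * (real d)\<^sup>2"
    using d \<open>0 < learn_rate d \<epsilon>\<close> by (simp add: power2_eq_square)
  also have "\<dots> = \<epsilon>\<^sup>2" using d_pos by (simp add: learn_rate_def)
  finally show "(learn_rate d \<epsilon>)\<^sup>2 * real d \<le> learn_rate d \<epsilon> * \<epsilon>\<^sup>2"
    using \<open>0 < learn_rate d \<epsilon>\<close> by (simp add: power2_eq_square)
qed

lemma filter_step:
  "(\<Sum>z\<in>\<Omega>. p z * inner2 d (next_A d \<epsilon> A z) (next_A d \<epsilon> A z)) \<le>
     (1 + filter_rate d \<epsilon>) * inner2 d A A + 4 * filter_rate d \<epsilon> * \<epsilon>\<^sup>2"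
proof -
  let ?k = "filter_rate d \<epsilon>" and ?a = "inner2 d A A"
  have "(\<Sum>z\<in>\<Omega>. p z * inner2 d (next_A d \<epsilon> A z) (next_A d \<epsilon> A z)) \<le>
      (\<Sum>z\<in>\<Omega>. p z * (?a + of_bool (acc A z) * (2 * ?k * quad d A (fst z)) + ?k\<^sup>2 * (real d)\<^sup>2))"
    by (intro sum_mono mult_left_mono p_nonneg inner2_next_A_self) auto
  also have "\<dots> = (\<Sum>z\<in>\<Omega>. p z * (?a + ?k\<^sup>2 * (real d)\<^sup>2)
      + 2 * ?k * (p z * (of_bool (acc A z) * quad d A (fst z))))"
    by (intro sum.cong refl) (simp add: algebra_simps)
  also have "\<dots> = ?a + ?k\<^sup>2 * (real d)\<^sup>2 + 2 * ?k * (\<Sum>z\<in>\<Omega>. p z * (of_bool (acc A z) * quad d A (fst z)))"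
    using sum_p by (simp add: sum.distrib flip: sum_distrib_left sum_distrib_right)
  also have "\<dots> \<le> ?a + ?k * \<epsilon>\<^sup>2 + 2 * ?k * (?a / 2 + 3 / 2 * \<epsilon>\<^sup>2)"
    using rate by (intro add_mono mult_left_mono filter_drift) auto
  finally show ?thesis by (simp add: algebra_simps)
qed

text \<open>Times \<open>filter_rate\<close>, this is the expected increase of <A, V> in one step.
  It is not bounded at a single step but carried along until it telescopes.\<close>

definition "drift A = (\<Sum>z\<in>\<Omega>. p z * (of_bool (acc A z) * quad d V (fst z)))"

lemma corr_step: "(\<Sum>z\<in>\<Omega>. p z * inner2 d (next_A d \<epsilon> A z) V) = inner2 d A V + filter_rate d \<epsilon> * drift A"
proof -
  have "(\<Sum>z\<in>\<Omega>. p z * inner2 d (next_A d \<epsilon> A z) V) = 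
     (\<Sum>z\<in>\<Omega>. p z * inner2 d A V + filter_rate d \<epsilon> * (p z * (of_bool (acc A z) * quad d V (fst z))))"
    by (intro sum.cong refl) (simp add: inner2_next_A algebra_simps)
  thus ?thesis using sum_p by (simp add: drift_def sum.distrib flip: sum_distrib_left sum_distrib_right)
qed

lemma inner2_V: "inner2 d V V \<le> 2"
  using inner2_outer[of d v] v_unit by simp

text \<open>On the cube (v.x)^2 = 1 + \<open>quad d V x\<close>. In \<open>drift\<close>, the clean
  part has total mean 0, so the contribution of \<open>bad\<close> is \<open>drift\<close> up to
  rejected and lost clean mass, each controlled by Young with weight eps and |V|^2 <= 2.\<close>

lemma bad_second_moment:
  "(\<Sum>z\<in>\<Omega>. bad z * (of_bool (acc A z) * (dotp d v (fst z))\<^sup>2)) \<le> drift A + \<epsilon> * inner2 d A A / 2 + 7 / 2 * \<epsilon>"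
proof -
  have "(\<Sum>z\<in>\<Omega>. bad z * (of_bool (acc A z) * (dotp d v (fst z))\<^sup>2)) \<le>
      (\<Sum>z\<in>\<Omega>. bad z + bad z * (of_bool (acc A z) * quad d V (fst z)))"
    using bad by (intro sum_mono) (auto simp: dotp_sq v_unit algebra_simps)
  also have "\<dots> = (\<Sum>z\<in>\<Omega>. bad z) + drift A - (\<Sum>z\<in>\<Omega>. q z * (of_bool (acc A z) * quad d V (fst z)))
      + (\<Sum>z\<in>\<Omega>. lost z * (of_bool (acc A z) * quad d V (fst z)))"
    unfolding drift_def sum_p_split by (simp add: sum.distrib)
  also have "(\<Sum>z\<in>\<Omega>. q z * (of_bool (acc A z) * quad d V (fst z))) =
      (\<Sum>z\<in>\<Omega>. q z * quad d V (fst z)) - (\<Sum>z\<in>\<Omega>. rej A z * quad d V (fst z))"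
    unfolding rej_def sum_subtractf[symmetric] by (intro sum.cong refl) auto
  also have "\<dots> = - (\<Sum>z\<in>\<Omega>. rej A z * quad d V (fst z))" by (simp add: sum_q_quad)
  finally have *: "(\<Sum>z\<in>\<Omega>. bad z * (of_bool (acc A z) * (dotp d v (fst z))\<^sup>2)) \<le>
      (\<Sum>z\<in>\<Omega>. bad z) + drift A + (\<Sum>z\<in>\<Omega>. rej A z * quad d V (fst z))
      + (\<Sum>z\<in>\<Omega>. lost z * (of_bool (acc A z) * quad d V (fst z)))" by simp
  have "(\<Sum>z\<in>\<Omega>. rej A z * quad d V (fst z)) \<le> (\<Sum>z\<in>\<Omega>. rej A z * \<bar>quad d V (fst z)\<bar>)"
    using rej by (intro sum_mono mult_left_mono) auto
  also have "\<dots> \<le> \<epsilon> / 2 * inner2 d V V + (\<Sum>z\<in>\<Omega>. rej A z) / (2 * \<epsilon>)"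
    using sum_sub_young[of "rej A" \<epsilon> "\<lambda>z. quad d V (fst z)"] rej eps by (simp add: sum_q_quad_sq)
  also have "\<dots> \<le> \<epsilon> / 2 * 2 + (\<epsilon>\<^sup>2 * inner2 d A A) / (2 * \<epsilon>)"
    using eps by (intro add_mono mult_left_mono divide_right_mono rej_mass inner2_V) auto
  also have "\<dots> = \<epsilon> + \<epsilon> * inner2 d A A / 2" using eps by (simp add: power2_eq_square)
  finally have 1: "(\<Sum>z\<in>\<Omega>. rej A z * quad d V (fst z)) \<le> \<epsilon> + \<epsilon> * inner2 d A A / 2" .
  have "(\<Sum>z\<in>\<Omega>. lost z * (of_bool (acc A z) * quad d V (fst z))) \<le> (\<Sum>z\<in>\<Omega>. lost z * \<bar>quad d V (fst z)\<bar>)"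
    using lost by (intro sum_mono mult_left_mono) auto
  also have "\<dots> \<le> \<epsilon> / 2 * inner2 d V V + (\<Sum>z\<in>\<Omega>. lost z) / (2 * \<epsilon>)"
    using sum_sub_young[of lost \<epsilon> "\<lambda>z. quad d V (fst z)"] lost eps by (simp add: sum_q_quad_sq)
  also have "\<dots> \<le> \<epsilon> / 2 * 2 + \<eta> / (2 * \<epsilon>)"
    using eps by (intro add_mono mult_left_mono divide_right_mono sum_lost inner2_V) auto
  also have "\<dots> \<le> \<epsilon> + \<epsilon> / 2" using eta_div eps_powers by simp
  finally show ?thesis using * 1 sum_bad eta_div by linarith
qed

section \<open>Expected change of |w - v|^2 in one step\<close>

lemma clean_loss: "(\<Sum>z\<in>\<Omega>. q z * loss v z) \<le> 15 * \<epsilon>\<^sup>2"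
proof -
  let ?f = "\<lambda>x. \<epsilon> * of_bool (\<bar>dotp d vh x + dotp d v x + \<tau>\<bar> \<le> \<epsilon>)"
  have "(\<Sum>z\<in>\<Omega>. q z * loss v z) \<le> (\<Sum>z\<in>\<Omega>. q z * ?f (fst z))"
  proof (rule sum_mono)
    fix z :: labelled assume z: "z \<in> \<Omega>"
    show "q z * loss v z \<le> q z * ?f (fst z)"
    proof (cases "q z = 0")
      case False
      have "snd z * (base d \<tau> vh (fst z) + dotp d v (fst z)) = \<bar>dotp d vh (fst z) + dotp d v (fst z) + \<tau>\<bar>"
        using clean[OF z False] by (auto simp: sign_pm_def base_def)
      hence "loss v z \<le> ?f (fst z)" using eps by (auto simp: hinge_def)
      thus ?thesis by (intro mult_left_mono q_nonneg)
    qed simp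
  qed
  also have "\<dots> = \<epsilon> * ((\<Sum>x\<in>cube d. of_bool (\<bar>dotp d vh x + dotp d v x + \<tau>\<bar> \<le> \<epsilon>)) / 2 ^ d)"
    using q_fst[of ?f] by (simp only: sum_distrib_left[symmetric] times_divide_eq_right)
  also have "\<dots> \<le> \<epsilon> * (15 * \<epsilon>)" using eps anti by (intro mult_left_mono) auto
  finally show ?thesis by (simp add: power2_eq_square)
qed

lemma young_eps: "2 / \<epsilon> + \<bar>t\<bar> \<le> 5 / (2 * \<epsilon>) + \<epsilon> / 2 * t\<^sup>2"
proof -
  have "5 / (2 * \<epsilon>) = 2 / \<epsilon> + 1 / (2 * \<epsilon>)" using eps by (simp add: field_simps)
  thus ?thesis using abs_le_young[OF eps(1), of t] by simp
qed

text \<open>Corrupted points can cost v about 1/eps + |v.x|. Young replaces |v.x| by eps/2 *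
  (v.x)^2, the quantity that \<open>bad_second_moment\<close> trades for \<open>drift\<close>. The
  multiples of eps^2 are 15 + 5/2 + 7/4 <= 20.\<close>

lemma comparator_loss:
  "(\<Sum>z\<in>\<Omega>. p z * (of_bool (acc A z) * loss v z)) \<le> 20 * \<epsilon>\<^sup>2 + \<epsilon>\<^sup>2 * inner2 d A A + \<epsilon> / 2 * drift A"
proof -
  have "(\<Sum>z\<in>\<Omega>. p z * (of_bool (acc A z) * loss v z)) \<le>
      (\<Sum>z\<in>\<Omega>. q z * loss v z + bad z * (of_bool (acc A z) * loss v z))"
  proof (rule sum_mono)
    fix z :: labelled
    have "p z * (of_bool (acc A z) * loss v z) \<le> (q z + bad z) * (of_bool (acc A z) * loss v z)"
      using p_split[of z] lost[of z] by (intro mult_right_mono) (auto simp: hinge_nonneg)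
    also have "\<dots> \<le> q z * loss v z + bad z * (of_bool (acc A z) * loss v z)"
      using q_nonneg[of z] by (auto simp: algebra_simps hinge_nonneg)
    finally show "p z * (of_bool (acc A z) * loss v z) \<le> \<dots>" .
  qed
  also have "\<dots> = (\<Sum>z\<in>\<Omega>. q z * loss v z) + (\<Sum>z\<in>\<Omega>. bad z * (of_bool (acc A z) * loss v z))"
    by (simp add: sum.distrib)
  also have "(\<Sum>z\<in>\<Omega>. bad z * (of_bool (acc A z) * loss v z)) \<le>
      (\<Sum>z\<in>\<Omega>. bad z * (5 / (2 * \<epsilon>)) + \<epsilon> / 2 * (bad z * (of_bool (acc A z) * (dotp d v (fst z))\<^sup>2)))"
  proof (rule sum_mono)
    fix z :: labelled assume z: "z \<in> \<Omega>"
    have "loss v z \<le> 2 / \<epsilon> + \<bar>dotp d v (fst z)\<bar>" using z by (intro hinge_le eps) auto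
    also have "\<dots> \<le> 5 / (2 * \<epsilon>) + \<epsilon> / 2 * (dotp d v (fst z))\<^sup>2"
      by (rule young_eps)
    finally have "of_bool (acc A z) * loss v z \<le> 5 / (2 * \<epsilon>) + \<epsilon> / 2 * (of_bool (acc A z) * (dotp d v (fst z))\<^sup>2)"
      using eps by auto
    from mult_left_mono[OF this bad(1)[of z]]
    show "bad z * (of_bool (acc A z) * loss v z) \<le> 
      bad z * (5 / (2 * \<epsilon>)) + \<epsilon> / 2 * (bad z * (of_bool (acc A z) * (dotp d v (fst z))\<^sup>2))"
      by (simp add: algebra_simps)
  qed
  also have "\<dots> = (\<Sum>z\<in>\<Omega>. bad z) * (5 / (2 * \<epsilon>)) +
      \<epsilon> / 2 * (\<Sum>z\<in>\<Omega>. bad z * (of_bool (acc A z) * (dotp d v (fst z))\<^sup>2))"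
    by (simp only: sum.distrib sum_distrib_left sum_distrib_right)
  also have "\<dots> \<le> \<eta> * (5 / (2 * \<epsilon>)) + \<epsilon> / 2 * (drift A + \<epsilon> * inner2 d A A / 2 + 7 / 2 * \<epsilon>)"
    using eps by (intro add_mono mult_left_mono mult_right_mono sum_bad bad_second_moment) auto
  also have "\<eta> * (5 / (2 * \<epsilon>)) = 5 / 2 * (\<eta> / \<epsilon>)" by simp
  also have "\<dots> \<le> 5 / 2 * \<epsilon>\<^sup>2" using eta_div by simp
  also have "\<epsilon> / 2 * (drift A + \<epsilon> * inner2 d A A / 2 + 7 / 2 * \<epsilon>) =
      \<epsilon> / 2 * drift A + \<epsilon>\<^sup>2 * inner2 d A A / 4 + 7 / 4 * \<epsilon>\<^sup>2" by (simp add: algebra_simps power2_eq_square)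
  finally have "(\<Sum>z\<in>\<Omega>. p z * (of_bool (acc A z) * loss v z)) \<le>
      15 * \<epsilon>\<^sup>2 + (5 / 2 * \<epsilon>\<^sup>2 + (\<epsilon> / 2 * drift A + \<epsilon>\<^sup>2 * inner2 d A A / 4 + 7 / 4 * \<epsilon>\<^sup>2))"
    using clean_loss by linarith
  moreover have "0 \<le> \<epsilon>\<^sup>2 * inner2 d A A" "0 \<le> \<epsilon>\<^sup>2" using inner2_self_nonneg by auto
  ultimately show ?thesis by linarith
qed

definition "accepted_loss w A = (\<Sum>z\<in>\<Omega>. p z * (of_bool (acc A z) * loss w z))"

abbreviation "dist2 w \<equiv> dotp d (\<lambda>i. w i - v i) (\<lambda>i. w i - v i)"

lemma learn_step:
  "(\<Sum>z\<in>\<Omega>. p z * dist2 (next_w d \<epsilon> \<tau> vh w A z)) \<le> dist2 w - 2 * learn_rate d \<epsilon> * accepted_loss w A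
     + learn_rate d \<epsilon> * (41 * \<epsilon>\<^sup>2 + 2 * \<epsilon>\<^sup>2 * inner2 d A A + \<epsilon> * drift A)"
proof -
  let ?r = "learn_rate d \<epsilon>"
  have "(\<Sum>z\<in>\<Omega>. p z * dist2 (next_w d \<epsilon> \<tau> vh w A z)) \<le>
     (\<Sum>z\<in>\<Omega>. p z * (dist2 w + of_bool (acc A z) * (2 * ?r * (loss v z - loss w z)) + ?r\<^sup>2 * real d))"
    by (intro sum_mono mult_left_mono p_nonneg next_w_dist) auto
  also have "\<dots> = (\<Sum>z\<in>\<Omega>. p z * (dist2 w + ?r\<^sup>2 * real d) + 2 * ?r * (p z * (of_bool (acc A z) * loss v z))
      - 2 * ?r * (p z * (of_bool (acc A z) * loss w z)))"
    by (intro sum.cong refl) (simp add: algebra_simps)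
  also have "\<dots> = dist2 w + ?r\<^sup>2 * real d + 2 * ?r * (\<Sum>z\<in>\<Omega>. p z * (of_bool (acc A z) * loss v z))
      - 2 * ?r * accepted_loss w A"
    using sum_p by (simp add: sum.distrib sum_subtractf accepted_loss_def flip: sum_distrib_left sum_distrib_right)
  also have "\<dots> \<le> dist2 w + ?r * \<epsilon>\<^sup>2 + 2 * ?r * (20 * \<epsilon>\<^sup>2 + \<epsilon>\<^sup>2 * inner2 d A A + \<epsilon> / 2 * drift A)
      - 2 * ?r * accepted_loss w A"
    using rate by (intro diff_right_mono add_mono mult_left_mono comparator_loss) auto
  finally show ?thesis by (simp add: algebra_simps)
qed

text \<open>Lost mass is at most eps^3 and lies below \<open>q\<close>, so (w.x)^2 = |w|^2 +
  \<open>quad d (outer w) x\<close> has a small integral over it. The Young weight eps / |w|^2 keeps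
  the bound homogeneous in w, hence the separate case of a zero norm.\<close>

lemma lost_second_moment: "(\<Sum>z\<in>\<Omega>. lost z * (dotp d w (fst z))\<^sup>2) \<le> 3 * \<epsilon> * dotp d w w"
proof (cases "dotp d w w = 0")
  case True
  hence "(\<Sum>z\<in>\<Omega>. q z * (dotp d w (fst z))\<^sup>2) = 0" by (simp add: sum_q_dotp_sq)
  moreover have "(\<Sum>z\<in>\<Omega>. lost z * (dotp d w (fst z))\<^sup>2) \<le> (\<Sum>z\<in>\<Omega>. q z * (dotp d w (fst z))\<^sup>2)"
    using lost by (intro sum_mono mult_right_mono) auto
  ultimately show ?thesis using True by simp
next
  case False
  define W where "W = dotp d w w"
  have W: "W > 0" using False dotp_self_nonneg[of d w] by (simp add: W_def)
  have "(\<Sum>z\<in>\<Omega>. lost z * (dotp d w (fst z))\<^sup>2) \<le> (\<Sum>z\<in>\<Omega>. lost z * W + lost z * \<bar>quad d (outer w) (fst z)\<bar>)"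
    unfolding distrib_left[symmetric] using lost
    by (intro sum_mono mult_left_mono) (auto simp: dotp_sq W_def)
  also have "\<dots> = (\<Sum>z\<in>\<Omega>. lost z) * W + (\<Sum>z\<in>\<Omega>. lost z * \<bar>quad d (outer w) (fst z)\<bar>)"
    by (simp add: sum.distrib sum_distrib_right)
  also have "(\<Sum>z\<in>\<Omega>. lost z * \<bar>quad d (outer w) (fst z)\<bar>) \<le>
      (\<epsilon> / W) / 2 * inner2 d (outer w) (outer w) + (\<Sum>z\<in>\<Omega>. lost z) / (2 * (\<epsilon> / W))"
    using sum_sub_young[of lost "\<epsilon> / W" "\<lambda>z. quad d (outer w) (fst z)"] lost eps W by (simp add: sum_q_quad_sq)
  also have "\<dots> \<le> (\<epsilon> / W) / 2 * (2 * W\<^sup>2) + \<eta> / (2 * (\<epsilon> / W))"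
    using eps W by (intro add_mono mult_left_mono divide_right_mono sum_lost) (auto simp: inner2_outer W_def)
  also have "\<dots> = \<epsilon> * W + (\<eta> / \<epsilon>) / 2 * W" using W eps by (simp add: power2_eq_square)
  also have "(\<eta> / \<epsilon>) / 2 * W \<le> \<epsilon> / 2 * W" using W eta_div eps_powers by (intro mult_right_mono) auto
  also have "(\<Sum>z\<in>\<Omega>. lost z) * W \<le> \<epsilon> * W" using W sum_lost eta_div by (intro mult_right_mono) auto
  finally show ?thesis using mult_pos_pos[OF eps(1) W] by (simp add: W_def[symmetric] mult_ac)
qed

text \<open>Descent controls only the loss on accepted observed points. Clean mass missing there is
  either lost or rejected, and both kinds are bounded by clean second moments.\<close>

lemma clean_loss_le:
  "(\<Sum>z\<in>\<Omega>. q z * loss w z) \<le> accepted_loss w A + 3 * \<epsilon>\<^sup>2 * (1 + dotp d w w) + 3 * inner2 d A A"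
proof -
  let ?a = "inner2 d A A" and ?W = "dotp d w w"
  have "(\<Sum>z\<in>\<Omega>. q z * loss w z) \<le> (\<Sum>z\<in>\<Omega>. p z * (of_bool (acc A z) * loss w z) + lost z * loss w z + rej A z * loss w z)"
  proof (rule sum_mono)
    fix z :: labelled
    have "q z * loss w z = q z * (of_bool (acc A z) * loss w z) + rej A z * loss w z"
      by (simp add: rej_def)
    also have "q z * (of_bool (acc A z) * loss w z) \<le> (p z + lost z) * (of_bool (acc A z) * loss w z)"
      using p_split[of z] bad[of z] by (intro mult_right_mono) (auto simp: hinge_nonneg)
    also have "\<dots> \<le> p z * (of_bool (acc A z) * loss w z) + lost z * loss w z"
      using lost[of z] by (auto simp: algebra_simps hinge_nonneg)
    finally show "q z * loss w z \<le> p z * (of_bool (acc A z) * loss w z) + lost z * loss w z + rej A z * loss w z" by simp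
  qed
  also have "\<dots> = accepted_loss w A + (\<Sum>z\<in>\<Omega>. lost z * loss w z) + (\<Sum>z\<in>\<Omega>. rej A z * loss w z)"
    by (simp add: accepted_loss_def sum.distrib)
  also have "(\<Sum>z\<in>\<Omega>. lost z * loss w z) \<le> 5 / 2 * \<epsilon>\<^sup>2 + 3 / 2 * \<epsilon>\<^sup>2 * ?W"
  proof -
    have "(\<Sum>z\<in>\<Omega>. lost z * loss w z) \<le> (\<Sum>z\<in>\<Omega>. lost z * (5 / (2 * \<epsilon>)) + \<epsilon> / 2 * (lost z * (dotp d w (fst z))\<^sup>2))"
    proof (rule sum_mono)
      fix z :: labelled assume z: "z \<in> \<Omega>"
      have "loss w z \<le> 2 / \<epsilon> + \<bar>dotp d w (fst z)\<bar>" using z by (intro hinge_le eps) auto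
      also have "\<dots> \<le> 5 / (2 * \<epsilon>) + \<epsilon> / 2 * (dotp d w (fst z))\<^sup>2"
        by (rule young_eps)
      finally have "lost z * loss w z \<le> lost z * (5 / (2 * \<epsilon>) + \<epsilon> / 2 * (dotp d w (fst z))\<^sup>2)"
        by (intro mult_left_mono lost)
      thus "lost z * loss w z \<le> lost z * (5 / (2 * \<epsilon>)) + \<epsilon> / 2 * (lost z * (dotp d w (fst z))\<^sup>2)"
        by (simp add: algebra_simps)
    qed
    also have "\<dots> = (\<Sum>z\<in>\<Omega>. lost z) * (5 / (2 * \<epsilon>)) + \<epsilon> / 2 * (\<Sum>z\<in>\<Omega>. lost z * (dotp d w (fst z))\<^sup>2)"
      by (simp only: sum.distrib sum_distrib_left sum_distrib_right)
    also have "\<dots> \<le> \<eta> * (5 / (2 * \<epsilon>)) + \<epsilon> / 2 * (3 * \<epsilon> * ?W)"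
      using eps by (intro add_mono mult_left_mono mult_right_mono sum_lost lost_second_moment) auto
    also have "\<dots> = 5 / 2 * (\<eta> / \<epsilon>) + 3 / 2 * \<epsilon>\<^sup>2 * ?W" by (simp add: power2_eq_square)
    finally show ?thesis using eta_div by linarith
  qed
  also have "(\<Sum>z\<in>\<Omega>. rej A z * loss w z) \<le> 9 / 4 * ?a + \<epsilon>\<^sup>2 * ?W"
  proof -
    have "(\<Sum>z\<in>\<Omega>. rej A z * loss w z) \<le> (\<Sum>z\<in>\<Omega>. rej A z * (2 / \<epsilon>) + rej A z * \<bar>dotp d w (fst z)\<bar>)"
      unfolding distrib_left[symmetric] using rej by (intro sum_mono mult_left_mono hinge_le eps) auto
    also have "\<dots> = (\<Sum>z\<in>\<Omega>. rej A z) * (2 / \<epsilon>) + (\<Sum>z\<in>\<Omega>. rej A z * \<bar>dotp d w (fst z)\<bar>)"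
      by (simp only: sum.distrib sum_distrib_right)
    \<comment> \<open>The weight 2 eps^2 matches the rejected mass eps^2 |A|^2: what remains is
      |A|^2 / 4 without a power of eps.\<close>
    also have "(\<Sum>z\<in>\<Omega>. rej A z * \<bar>dotp d w (fst z)\<bar>) \<le> 2 * \<epsilon>\<^sup>2 / 2 * ?W + (\<Sum>z\<in>\<Omega>. rej A z) / (2 * (2 * \<epsilon>\<^sup>2))"
      using sum_sub_young[of "rej A" "2 * \<epsilon>\<^sup>2" "\<lambda>z. dotp d w (fst z)"] rej eps by (simp add: sum_q_dotp_sq)
    also have "(\<Sum>z\<in>\<Omega>. rej A z) / (2 * (2 * \<epsilon>\<^sup>2)) \<le> (\<epsilon>\<^sup>2 * ?a) / (2 * (2 * \<epsilon>\<^sup>2))"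
      by (intro divide_right_mono rej_mass) auto
    also have "(\<Sum>z\<in>\<Omega>. rej A z) * (2 / \<epsilon>) \<le> (\<epsilon>\<^sup>2 * ?a) * (2 / \<epsilon>)"
      using eps by (intro mult_right_mono rej_mass) auto
    also have "(\<epsilon>\<^sup>2 * ?a) * (2 / \<epsilon>) = 2 * (\<epsilon> * ?a)" using eps by (simp add: power2_eq_square)
    also have "\<dots> \<le> 2 * (1 * ?a)" using eps inner2_self_nonneg by (intro mult_left_mono mult_right_mono) auto
    also have "(\<epsilon>\<^sup>2 * ?a) / (2 * (2 * \<epsilon>\<^sup>2)) = ?a / 4" using eps by simp
    finally show ?thesis by simp
  qed
  finally have "(\<Sum>z\<in>\<Omega>. q z * loss w z) \<le>
      accepted_loss w A + (5 / 2 * \<epsilon>\<^sup>2 + 3 / 2 * \<epsilon>\<^sup>2 * ?W) + (9 / 4 * ?a + \<epsilon>\<^sup>2 * ?W)" by simp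
  moreover have "0 \<le> \<epsilon>\<^sup>2 * ?W" "0 \<le> ?a" "0 \<le> \<epsilon>\<^sup>2"
    using inner2_self_nonneg dotp_self_nonneg by auto
  moreover have "3 * \<epsilon>\<^sup>2 * (1 + ?W) = 3 * \<epsilon>\<^sup>2 + 3 * (\<epsilon>\<^sup>2 * ?W)" by (simp add: algebra_simps)
  ultimately show ?thesis by linarith
qed

text \<open>An upper bound for the error of \<open>vh + S / n\<close>, multiplied by \<open>n\<close>.\<close>

definition "risk n S = (\<Sum>z\<in>\<Omega>. q z * (hinge d \<epsilon> \<tau> vh n S z / \<epsilon> + \<epsilon> * \<bar>dotp d S (fst z)\<bar>))"

text \<open>This takes the place of Jensen's inequality for the averaged iterate: sums can be
  accumulated and divided by their number only once.\<close>

lemma risk_subadditive: "risk (m + n) (\<lambda>i. f i + g i) \<le> risk m f + risk n g"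
proof -
  have "risk (m + n) (\<lambda>i. f i + g i) \<le> (\<Sum>z\<in>\<Omega>. q z * ((hinge d \<epsilon> \<tau> vh m f z + hinge d \<epsilon> \<tau> vh n g z) / \<epsilon>
      + \<epsilon> * (\<bar>dotp d f (fst z)\<bar> + \<bar>dotp d g (fst z)\<bar>)))"
    unfolding risk_def dotp_add using eps
    by (intro sum_mono mult_left_mono add_mono divide_right_mono hinge_subadditive abs_triangle_ineq q_nonneg) auto
  also have "\<dots> = risk m f + risk n g"
    unfolding risk_def sum.distrib[symmetric] by (intro sum.cong refl) (simp add: algebra_simps add_divide_distrib)
  finally show ?thesis .
qed

lemma sum_q_abs_dotp: "(\<Sum>z\<in>\<Omega>. q z * \<bar>dotp d w (fst z)\<bar>) \<le> (1 + dotp d w w) / 2"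
  using sum_sub_young[of q 1 "\<lambda>z. dotp d w (fst z)"] q_nonneg by (simp add: sum_q_dotp_sq sum_q)

lemma risk_le:
  "risk 1 w \<le> (accepted_loss w A + 3 * inner2 d A A) / \<epsilon> + 4 * \<epsilon> * (1 + dotp d w w)"
proof -
  have "risk 1 w = (\<Sum>z\<in>\<Omega>. q z * loss w z) / \<epsilon> + \<epsilon> * (\<Sum>z\<in>\<Omega>. q z * \<bar>dotp d w (fst z)\<bar>)"
    unfolding risk_def sum_distrib_left sum_divide_distrib sum.distrib[symmetric]
    by (intro sum.cong refl) (simp add: field_simps)
  also have "\<dots> \<le> (accepted_loss w A + 3 * \<epsilon>\<^sup>2 * (1 + dotp d w w) + 3 * inner2 d A A) / \<epsilon> + \<epsilon> * ((1 + dotp d w w) / 2)"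
    using eps by (intro add_mono divide_right_mono mult_left_mono clean_loss_le sum_q_abs_dotp) auto
  also have "\<dots> \<le> (accepted_loss w A + 3 * inner2 d A A) / \<epsilon> + 4 * \<epsilon> * (1 + dotp d w w)"
    using eps dotp_self_nonneg[of d w] by (simp add: field_simps power2_eq_square)
  finally show ?thesis .
qed

text \<open>Inside the window a wrong sign forces the homogenized hinge up to n eps. Outside, a
  Markov bound on |S.x| / n and |v.x| suffices. The final 2 eps pays for E |v.x| <= 1 and for the
  corrupted mass.\<close>

lemma error_le_risk:
  assumes n: "n > 0"
  shows "(\<Sum>z\<in>\<Omega>. p z * of_bool (sign_pm (dotp d (\<lambda>i. vh i + S i / n) (fst z) + \<tau>) \<noteq> snd z)) \<le> risk n S / n + 2 * \<epsilon>"
proof -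
  define e :: "labelled \<Rightarrow> real" where
    "e z = of_bool (sign_pm (dotp d (\<lambda>i. vh i + S i / n) (fst z) + \<tau>) \<noteq> snd z)" for z
  have e01: "e z = 0 \<or> e z = 1" for z by (simp add: e_def)
  have score: "dotp d (\<lambda>i. vh i + S i / n) x + \<tau> = base d \<tau> vh x + dotp d S x / n" for x
    by (simp add: base_def dotp_def algebra_simps sum.distrib sum_divide_distrib)
  have "(\<Sum>z\<in>\<Omega>. p z * e z) \<le> (\<Sum>z\<in>\<Omega>. q z * e z + bad z)"
  proof (rule sum_mono)
    fix z :: labelled show "p z * e z \<le> q z * e z + bad z"
      using p_split[of z] lost[of z] bad[of z] e01[of z] by auto
  qed
  also have "\<dots> = (\<Sum>z\<in>\<Omega>. q z * e z) + (\<Sum>z\<in>\<Omega>. bad z)" by (simp add: sum.distrib)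
  also have "(\<Sum>z\<in>\<Omega>. q z * e z) \<le>
     (\<Sum>z\<in>\<Omega>. q z * (hinge d \<epsilon> \<tau> vh n S z / \<epsilon> + \<epsilon> * \<bar>dotp d S (fst z)\<bar>) / n + \<epsilon> * (q z * \<bar>dotp d v (fst z)\<bar>))"
  proof (rule sum_mono)
    fix z :: labelled assume z: "z \<in> \<Omega>"
    show "q z * e z \<le> q z * (hinge d \<epsilon> \<tau> vh n S z / \<epsilon> + \<epsilon> * \<bar>dotp d S (fst z)\<bar>) / n + \<epsilon> * (q z * \<bar>dotp d v (fst z)\<bar>)"
    proof (cases "q z = 0 \<or> e z = 0")
      case True
      have "0 \<le> q z * (hinge d \<epsilon> \<tau> vh n S z / \<epsilon> + \<epsilon> * \<bar>dotp d S (fst z)\<bar>) / n + \<epsilon> * (q z * \<bar>dotp d v (fst z)\<bar>)"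
        using eps n by (intro add_nonneg_nonneg mult_nonneg_nonneg divide_nonneg_nonneg hinge_nonneg q_nonneg) auto
      thus ?thesis using True by auto
    next
      case False
      let ?x = "fst z" and ?u = "base d \<tau> vh (fst z)"
      have y: "snd z = sign_pm (?u + dotp d v ?x)" using clean[OF z] False by (simp add: base_def algebra_simps)
      have wrong: "sign_pm (?u + dotp d S ?x / n) \<noteq> snd z" using False by (auto simp: e_def score)
      have "1 \<le> (hinge d \<epsilon> \<tau> vh n S z / \<epsilon> + \<epsilon> * \<bar>dotp d S ?x\<bar>) / n + \<epsilon> * \<bar>dotp d v ?x\<bar>"
      proof (cases "\<bar>?u\<bar> \<le> 1 / \<epsilon>")
        case True
        have "snd z * (?u + dotp d S ?x / n) \<le> 0"
          using wrong y by (auto simp: sign_pm_def split: if_splits)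
        hence "n * (snd z * (?u + dotp d S ?x / n)) \<le> 0"
          using n by (simp add: mult_le_0_iff)
        moreover have "n * (snd z * (?u + dotp d S ?x / n)) = snd z * (n * ?u + dotp d S ?x)"
          using n by (simp add: field_simps)
        ultimately have "n * \<epsilon> \<le> hinge d \<epsilon> \<tau> vh n S z" using True by (simp add: hinge_def)
        hence "1 \<le> hinge d \<epsilon> \<tau> vh n S z / \<epsilon> / n" using eps n by (simp add: field_simps)
        thus ?thesis using eps n by (simp add: add_divide_distrib add_increasing2)
      next
        case False
        \<comment> \<open>If both corrections were smaller than |u|, both scores would have the sign
          of u, and prediction and label would agree.\<close>
        have "1 / \<epsilon> \<le> \<bar>dotp d S ?x / n\<bar> \<or> 1 / \<epsilon> \<le> \<bar>dotp d v ?x\<bar>"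
          using wrong y False by (auto simp: sign_pm_def simp del: abs_divide split: if_splits)
        hence "1 \<le> \<epsilon> * \<bar>dotp d S ?x\<bar> / n \<or> 1 \<le> \<epsilon> * \<bar>dotp d v ?x\<bar>"
          using eps n by (auto simp: field_simps)
        moreover have "0 \<le> hinge d \<epsilon> \<tau> vh n S z / \<epsilon> / n" using eps n by (simp add: hinge_nonneg)
        moreover have "0 \<le> \<epsilon> * \<bar>dotp d S ?x\<bar> / n" "0 \<le> \<epsilon> * \<bar>dotp d v ?x\<bar>" using eps n by auto
        ultimately show ?thesis by (simp only: add_divide_distrib) linarith
      qed
      from mult_left_mono[OF this q_nonneg[of z]] False e01[of z] show ?thesis
        by (simp add: algebra_simps)
    qed
  qed
  also have "\<dots> = risk n S / n + \<epsilon> * (\<Sum>z\<in>\<Omega>. q z * \<bar>dotp d v (fst z)\<bar>)"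
    by (simp add: risk_def sum.distrib sum_divide_distrib sum_distrib_left)
  also have "\<dots> \<le> risk n S / n + \<epsilon> * 1"
    using eps sum_q_abs_dotp[of v] v_unit by (intro add_left_mono mult_left_mono) auto
  finally show ?thesis using sum_bad eta_div by (simp add: e_def)
qed

end

section \<open>Convergence\<close>

type_synonym learner = "(nat \<Rightarrow> real) \<times> (nat \<Rightarrow> nat \<Rightarrow> real) \<times> (nat \<Rightarrow> real)"

text \<open>w is the offset from \<open>vh\<close>. S receives w before its update, so after n steps
  it is the sum of the iterates 0, ..., n - 1, exactly those whose losses the telescoped bound
  covers.\<close>

definition next_state :: "nat \<Rightarrow> real \<Rightarrow> real \<Rightarrow> (nat \<Rightarrow> real) \<Rightarrow> learner \<Rightarrow> labelled \<Rightarrow> learner" where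
  "next_state d \<epsilon> \<tau> vh s z = (case s of (w, A, S) \<Rightarrow>
     (next_w d \<epsilon> \<tau> vh w A z, next_A d \<epsilon> A z, \<lambda>i. if i < d then S i + w i else S i))"

primrec chain :: "nat \<Rightarrow> real \<Rightarrow> real \<Rightarrow> (nat \<Rightarrow> real) \<Rightarrow> labelled pmf \<Rightarrow> nat \<Rightarrow> learner pmf" where
  "chain d \<epsilon> \<tau> vh D 0 = return_pmf (\<lambda>_. 0, \<lambda>_ _. 0, \<lambda>_. 0)"
| "chain d \<epsilon> \<tau> vh D (Suc n) =
     bind_pmf (chain d \<epsilon> \<tau> vh D n) (\<lambda>s. map_pmf (next_state d \<epsilon> \<tau> vh s) D)"

section \<open>Expectations over finitely supported laws, and elementary inequalities\<close>

lemma expectation_finite_bind: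
  fixes f :: "'b \<Rightarrow> real"
  assumes "finite (set_pmf M)" "finite \<Omega>" "set_pmf D \<subseteq> \<Omega>"
  shows "measure_pmf.expectation (bind_pmf M (\<lambda>s. map_pmf (h s) D)) f =
     measure_pmf.expectation M (\<lambda>s. \<Sum>z\<in>\<Omega>. pmf D z * f (h s z))"
proof -
  have fin: "finite (set_pmf D)" using assms(2,3) finite_subset by blast
  have "measure_pmf.expectation (map_pmf (h s) D) f = (\<Sum>z\<in>\<Omega>. pmf D z * f (h s z))" for s
    using assms(2,3) by (subst integral_map_pmf, subst integral_measure_pmf[of \<Omega>]) auto
  thus ?thesis
    using assms(1) fin
    by (subst pmf_expectation_bind[of "set_pmf M"]) (auto simp: integral_measure_pmf[of "set_pmf M"])
qed

lemma prob_finite: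
  assumes "finite \<Omega>" "set_pmf D \<subseteq> \<Omega>"
  shows "measure_pmf.prob D A = (\<Sum>z\<in>\<Omega>. pmf D z * of_bool (z \<in> A))"
proof -
  have "measure_pmf.prob D A = measure_pmf.expectation D (indicator A)" by simp
  also have "\<dots> = (\<Sum>z\<in>\<Omega>. pmf D z *\<^sub>R indicator A z)"
    using assms by (intro integral_measure_pmf) auto
  finally show ?thesis by (simp add: indicator_def)
qed

lemma one_plus_power_le:
  fixes k :: real
  assumes "0 \<le> k" "k * real n \<le> 2"
  shows "(1 + k) ^ n \<le> 9"
proof -
  have "(1 + k) ^ n \<le> (exp k) ^ n"
    using assms exp_ge_add_one_self[of k] by (intro power_mono) auto
  also have "\<dots> = exp (k * real n)" by (simp add: exp_of_nat_mult[symmetric] mult.commute)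
  also have "\<dots> \<le> exp (1 + 1)" using assms by simp
  also have "\<dots> = exp 1 * exp 1" by (rule exp_add)
  also have "\<dots> \<le> 3 * (3 :: real)" using exp_le by (intro mult_mono) auto
  finally show ?thesis by simp
qed

lemma inner2_young:
  assumes "\<epsilon> > 0"
  shows "inner2 d A B \<le> inner2 d A A / (2 * \<epsilon>) + \<epsilon> / 2 * inner2 d B B"
proof -
  have *: "a * b \<le> a * a / (2 * \<epsilon>) + \<epsilon> / 2 * (b * b)" for a b :: real
  proof -
    have "0 \<le> (a - \<epsilon> * b)\<^sup>2 / (2 * \<epsilon>)" using assms by simp
    also have "\<dots> = a * a / (2 * \<epsilon>) + \<epsilon> / 2 * (b * b) - a * b"
      using assms by (simp add: power2_eq_square field_simps)
    finally show ?thesis by simp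
  qed
  have "inner2 d A B \<le> (\<Sum>i<d. \<Sum>j<i. A i j * A i j / (2 * \<epsilon>) + \<epsilon> / 2 * (B i j * B i j))"
    unfolding inner2_def by (intro sum_mono *)
  also have "\<dots> = inner2 d A A / (2 * \<epsilon>) + \<epsilon> / 2 * inner2 d B B"
    by (simp only: inner2_def sum.distrib sum_distrib_left sum_divide_distrib)
  finally show ?thesis .
qed

lemma dotp_self_le_dist: "dotp d w w \<le> 2 * dotp d (\<lambda>i. w i - v i) (\<lambda>i. w i - v i) + 2 * dotp d v v"
proof -
  have "w i * w i \<le> 2 * ((w i - v i) * (w i - v i)) + 2 * (v i * v i)" for i
    using zero_le_power2[of "w i - 2 * v i"] by (simp add: power2_eq_square algebra_simps)
  hence "dotp d w w \<le> (\<Sum>i<d. 2 * ((w i - v i) * (w i - v i)) + 2 * (v i * v i))"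
    unfolding dotp_def by (intro sum_mono)
  thus ?thesis by (simp only: dotp_def sum.distrib sum_distrib_left)
qed

locale contaminated_sampling = contamination d \<epsilon> \<eta> \<tau> vh v "pmf D" q
  for d :: nat and \<epsilon> \<eta> \<tau> :: real and vh v :: "nat \<Rightarrow> real" and D :: "labelled pmf" and q :: "labelled \<Rightarrow> real" +
  assumes supp: "set_pmf D \<subseteq> cube d \<times> {-1, 1}"
begin

abbreviation "chn \<equiv> chain d \<epsilon> \<tau> vh D"
abbreviation "E n f \<equiv> measure_pmf.expectation (chn n) f"

lemma finite_chain: "finite (set_pmf (chn n))"
proof (induction n)
  case (Suc n)
  have "finite (set_pmf D)" using supp by (rule finite_subset) auto
  thus ?case using Suc by simp
qed simp

lemma integrable_chain [simp, intro]: "integrable (chn n) f" for f :: "learner \<Rightarrow> real"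
  by (intro integrable_measure_pmf_finite finite_chain)

lemma E_mono: "(\<And>w A S. f (w, A, S) \<le> g (w, A, S)) \<Longrightarrow> E n f \<le> E n g" for f g :: "learner \<Rightarrow> real"
  by (intro integral_mono) auto

text \<open>Conditioning on the past: the new sample is independent of the state, so the one-step
  estimates become recursions for expectations.\<close>

lemma E_Suc: "E (Suc n) f = E n (\<lambda>s. \<Sum>z\<in>\<Omega>. pmf D z * f (next_state d \<epsilon> \<tau> vh s z))" for f :: "learner \<Rightarrow> real"
  using supp by (simp only: chain.simps) (intro expectation_finite_bind finite_chain; simp)

section \<open>Recursions for the expected quantities\<close>

definition "filter_sq n = E n (\<lambda>(w, A, S). inner2 d A A)"
definition "corr n = E n (\<lambda>(w, A, S). inner2 d A V)"
definition "mean_drift n = E n (\<lambda>(w, A, S). drift A)"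
definition "dist_sq n = E n (\<lambda>(w, _). dist2 w)"
definition "mean_loss n = E n (\<lambda>(w, A, S). accepted_loss w A)"

lemma filter_sq_Suc: "filter_sq (Suc n) \<le> (1 + filter_rate d \<epsilon>) * filter_sq n + 4 * filter_rate d \<epsilon> * \<epsilon>\<^sup>2"
proof -
  have "filter_sq (Suc n) \<le> E n (\<lambda>s. (1 + filter_rate d \<epsilon>) * (case s of (w, A, S) \<Rightarrow> inner2 d A A)
      + 4 * filter_rate d \<epsilon> * \<epsilon>\<^sup>2)"
    unfolding filter_sq_def E_Suc
    by (intro E_mono) (simp add: next_state_def filter_step)
  thus ?thesis by (simp add: filter_sq_def)
qed

lemma corr_Suc: "corr (Suc n) = corr n + filter_rate d \<epsilon> * mean_drift n"
proof -
  have "corr (Suc n) = E n (\<lambda>s. (case s of (w, A, S) \<Rightarrow> inner2 d A V) + filter_rate d \<epsilon> * (case s of (w, A, S) \<Rightarrow> drift A))"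
    unfolding corr_def E_Suc
    by (intro Bochner_Integration.integral_cong) (auto simp: next_state_def corr_step)
  thus ?thesis by (simp add: corr_def mean_drift_def)
qed

lemma dist_sq_Suc: "dist_sq (Suc n) \<le> dist_sq n - 2 * learn_rate d \<epsilon> * mean_loss n
     + learn_rate d \<epsilon> * (41 * \<epsilon>\<^sup>2 + 2 * \<epsilon>\<^sup>2 * filter_sq n + \<epsilon> * mean_drift n)"
proof -
  have "dist_sq (Suc n) \<le> E n (\<lambda>s. (case s of (w, _) \<Rightarrow> dist2 w)
     - 2 * learn_rate d \<epsilon> * (case s of (w, A, S) \<Rightarrow> accepted_loss w A)
     + learn_rate d \<epsilon> * (41 * \<epsilon>\<^sup>2 + 2 * \<epsilon>\<^sup>2 * (case s of (w, A, S) \<Rightarrow> inner2 d A A) + \<epsilon> * (case s of (w, A, S) \<Rightarrow> drift A)))"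
    unfolding dist_sq_def E_Suc
    by (intro E_mono) (simp add: next_state_def learn_step)
  thus ?thesis by (simp add: dist_sq_def mean_loss_def filter_sq_def mean_drift_def)
qed

text \<open>The sequence \<open>filter_sq n\<close> + 4 eps^2 grows by a factor of at most 1 + k and
  starts at 4 eps^2; over the horizon this factor accumulates to at most e^2 <= 9.\<close>

lemma filter_sq_le:
  assumes "filter_rate d \<epsilon> * real n \<le> 2"
  shows "filter_sq n \<le> 32 * \<epsilon>\<^sup>2"
proof -
  let ?k = "filter_rate d \<epsilon>"
  have "filter_sq n \<le> 4 * \<epsilon>\<^sup>2 * ((1 + ?k) ^ n - 1)" for n
  proof (induction n)
    case 0
    show ?case by (simp add: filter_sq_def inner2_def)
  next
    case (Suc n)
    have "filter_sq (Suc n) \<le> (1 + ?k) * filter_sq n + 4 * ?k * \<epsilon>\<^sup>2" by (rule filter_sq_Suc)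
    also have "\<dots> \<le> (1 + ?k) * (4 * \<epsilon>\<^sup>2 * ((1 + ?k) ^ n - 1)) + 4 * ?k * \<epsilon>\<^sup>2"
      using rate by (intro add_right_mono mult_left_mono Suc) auto
    also have "\<dots> = 4 * \<epsilon>\<^sup>2 * ((1 + ?k) ^ Suc n - 1)" by (simp add: algebra_simps)
    finally show ?case .
  qed
  also have "4 * \<epsilon>\<^sup>2 * ((1 + ?k) ^ n - 1) \<le> 4 * \<epsilon>\<^sup>2 * (9 - 1)"
    using rate assms by (intro mult_left_mono diff_right_mono one_plus_power_le) auto
  finally show ?thesis by simp
qed

text \<open>Young with weight eps for <A, V>: 32 eps^2 / (2 eps) + eps = 17 eps.\<close>

lemma corr_le:
  assumes "filter_rate d \<epsilon> * real n \<le> 2"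
  shows "corr n \<le> 17 * \<epsilon>"
proof -
  have "corr n \<le> E n (\<lambda>s. (case s of (w, A, S) \<Rightarrow> inner2 d A A) / (2 * \<epsilon>) + \<epsilon>)"
    unfolding corr_def
  proof (rule E_mono)
    fix w :: "nat \<Rightarrow> real" and A and S :: "nat \<Rightarrow> real"
    have "\<epsilon> / 2 * inner2 d V V \<le> \<epsilon> / 2 * 2" using eps inner2_V by (intro mult_left_mono) auto
    thus "(case (w, A, S) of (w, A, S) \<Rightarrow> inner2 d A V) \<le>
      (case (w, A, S) of (w, A, S) \<Rightarrow> inner2 d A A) / (2 * \<epsilon>) + \<epsilon>"
      using inner2_young[OF eps(1), of d A V] by simp
  qed
  also have "\<dots> = filter_sq n / (2 * \<epsilon>) + \<epsilon>" by (simp add: filter_sq_def)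
  also have "\<dots> \<le> (32 * \<epsilon>\<^sup>2) / (2 * \<epsilon>) + \<epsilon>"
    using eps assms by (intro add_right_mono divide_right_mono filter_sq_le) auto
  also have "\<dots> = 17 * \<epsilon>" using eps by (simp add: power2_eq_square)
  finally show ?thesis .
qed

lemma mean_loss_nonneg: "0 \<le> mean_loss n"
  unfolding mean_loss_def accepted_loss_def
  by (intro Bochner_Integration.integral_nonneg) (auto intro!: sum_nonneg mult_nonneg_nonneg hinge_nonneg)

lemma dist_sq_nonneg: "0 \<le> dist_sq n"
  unfolding dist_sq_def by (intro Bochner_Integration.integral_nonneg) (auto simp: dotp_self_nonneg)

lemma potential:
  assumes "filter_rate d \<epsilon> * real n \<le> 2"
  shows "dist_sq n + 2 * learn_rate d \<epsilon> * (\<Sum>m<n. mean_loss m) \<le>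
    1 + 105 * (filter_rate d \<epsilon> * real n) + corr n / \<epsilon>"
  using assms
proof (induction n)
  case 0
  have "dist_sq 0 = 1" using v_unit by (simp add: dist_sq_def dotp_def)
  moreover have "corr 0 = 0" by (simp add: corr_def inner2_def)
  ultimately show ?case by simp
next
  case (Suc n)
  let ?k = "filter_rate d \<epsilon>" and ?r = "learn_rate d \<epsilon>"
  have n: "?k * real n \<le> 2" using Suc.prems rate by (simp add: algebra_simps)
  have "2 * \<epsilon>\<^sup>2 * filter_sq n \<le> 2 * \<epsilon>\<^sup>2 * 32"
  proof (intro mult_left_mono)
    have "\<epsilon>\<^sup>2 \<le> 1" using eps by (simp add: power_le_one)
    thus "filter_sq n \<le> 32" using filter_sq_le[OF n] by simp
  qed auto
  hence "?r * (41 * \<epsilon>\<^sup>2 + 2 * \<epsilon>\<^sup>2 * filter_sq n + \<epsilon> * mean_drift n) \<le> ?r * (105 * \<epsilon>\<^sup>2 + \<epsilon> * mean_drift n)"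
    using rate by (intro mult_left_mono) auto
  \<comment> \<open>The exchange of rates: r eps^2 = k, hence r eps = k / eps. The constant is 105 =
    41 + 2 * 32.\<close>
  also have "\<dots> = 105 * ?k + (?k * mean_drift n) / \<epsilon>"
    using eps rate(3) by (simp add: field_simps power2_eq_square)
  also have "?k * mean_drift n = corr (Suc n) - corr n" by (simp add: corr_Suc)
  finally have "dist_sq (Suc n) \<le> dist_sq n - 2 * ?r * mean_loss n + (105 * ?k + (corr (Suc n) - corr n) / \<epsilon>)"
    using dist_sq_Suc[of n] by linarith
  thus ?case using Suc.IH[OF n] by (simp add: algebra_simps diff_divide_distrib)
qed

text \<open>The budget is 228 = 1 + 105 * 2 + 17: the initial distance |v|^2, the accumulated error,
  and the final correlation over eps. The loss sum receives half of it times 1/r = eps^2 /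
  k.\<close>

lemma mean_loss_sum_le:
  assumes "filter_rate d \<epsilon> * real n \<le> 2"
  shows "dist_sq n \<le> 228" "(\<Sum>m<n. mean_loss m) \<le> 114 * \<epsilon>\<^sup>2 / filter_rate d \<epsilon>"
proof -
  have "corr n / \<epsilon> \<le> 17" using corr_le[OF assms] eps by (simp add: field_simps)
  hence *: "dist_sq n + 2 * learn_rate d \<epsilon> * (\<Sum>m<n. mean_loss m) \<le> 228"
    using potential[OF assms] assms by linarith
  have "0 \<le> learn_rate d \<epsilon> * (\<Sum>m<n. mean_loss m)"
    using rate by (intro mult_nonneg_nonneg sum_nonneg mean_loss_nonneg) auto
  thus "dist_sq n \<le> 228" using * by linarith
  have "learn_rate d \<epsilon> * (\<Sum>m<n. mean_loss m) \<le> 114" using * dist_sq_nonneg[of n] by linarith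
  hence "\<epsilon>\<^sup>2 * (learn_rate d \<epsilon> * (\<Sum>m<n. mean_loss m)) \<le> \<epsilon>\<^sup>2 * 114" by (intro mult_left_mono) auto
  hence "filter_rate d \<epsilon> * (\<Sum>m<n. mean_loss m) \<le> \<epsilon>\<^sup>2 * 114" unfolding rate(3) by (simp add: mult_ac)
  thus "(\<Sum>m<n. mean_loss m) \<le> 114 * \<epsilon>\<^sup>2 / filter_rate d \<epsilon>"
    using rate(1) by (simp add: field_simps)
qed

section \<open>From the accepted loss to the error of the averaged iterate\<close>

definition "mean_risk n = E n (\<lambda>(w, _). risk 1 w)"

lemma mean_risk_le:
  assumes "filter_rate d \<epsilon> * real n \<le> 2"
  shows "mean_risk n \<le> mean_loss n / \<epsilon> + 1932 * \<epsilon>"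
proof -
  have "mean_risk n \<le> E n (\<lambda>s. ((case s of (w, A, S) \<Rightarrow> accepted_loss w A)
      + 3 * (case s of (w, A, S) \<Rightarrow> inner2 d A A)) / \<epsilon> + 4 * \<epsilon> * (3 + 2 * (case s of (w, _) \<Rightarrow> dist2 w)))"
    unfolding mean_risk_def
  proof (rule E_mono)
    fix w :: "nat \<Rightarrow> real" and A and S :: "nat \<Rightarrow> real"
    have "4 * \<epsilon> * (1 + dotp d w w) \<le> 4 * \<epsilon> * (3 + 2 * dist2 w)"
      using eps dotp_self_le_dist[of d w v] v_unit by (intro mult_left_mono) auto
    thus "(case (w, A, S) of (w, _) \<Rightarrow> risk 1 w) \<le> ((case (w, A, S) of (w, A, S) \<Rightarrow> accepted_loss w A)
      + 3 * (case (w, A, S) of (w, A, S) \<Rightarrow> inner2 d A A)) / \<epsilon> + 4 * \<epsilon> * (3 + 2 * (case (w, A, S) of (w, _) \<Rightarrow> dist2 w))"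
      using risk_le[of w A] by simp
  qed
  also have "\<dots> = (mean_loss n + 3 * filter_sq n) / \<epsilon> + 4 * \<epsilon> * (3 + 2 * dist_sq n)"
    by (simp add: mean_loss_def filter_sq_def dist_sq_def)
  \<comment> \<open>In multiples of eps: 3 * 32 = 96 from the filter and 4 * (3 + 2 * 228) = 1836
    from the norm of w, together 1932.\<close>
  also have "\<dots> \<le> (mean_loss n + 3 * (32 * \<epsilon>\<^sup>2)) / \<epsilon> + 4 * \<epsilon> * (3 + 2 * 228)"
    using eps assms
    by (intro add_mono divide_right_mono mult_left_mono filter_sq_le mean_loss_sum_le order_refl) auto
  also have "\<dots> = mean_loss n / \<epsilon> + 1932 * \<epsilon>" using eps by (simp add: field_simps power2_eq_square)
  finally show ?thesis .
qed

lemma risk_cong: "(\<And>i. i < d \<Longrightarrow> f i = g i) \<Longrightarrow> risk n f = risk n g"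
proof -
  assume "\<And>i. i < d \<Longrightarrow> f i = g i"
  hence "dotp d f = dotp d g" by (auto simp: dotp_def fun_eq_iff intro!: sum.cong)
  thus ?thesis by (simp add: risk_def hinge_def cong: if_cong)
qed

lemma total_risk_le: "E n (\<lambda>(w, A, S). risk (real n) S) \<le> (\<Sum>m<n. mean_risk m)"
proof (induction n)
  case 0
  show ?case by (simp add: risk_def hinge_def dotp_def cong: if_cong)
next
  case (Suc n)
  have "E (Suc n) (\<lambda>(w, A, S). risk (real (Suc n)) S) \<le>
      E n (\<lambda>s. (case s of (w, A, S) \<Rightarrow> risk (real n) S) + (case s of (w, _) \<Rightarrow> risk 1 w))"
    unfolding E_Suc
  proof (rule E_mono)
    fix w :: "nat \<Rightarrow> real" and A and S :: "nat \<Rightarrow> real"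
    have "risk (real (Suc n)) (\<lambda>i. if i < d then S i + w i else S i) = risk (real n + 1) (\<lambda>i. S i + w i)"
      by (subst risk_cong[where g = "\<lambda>i. S i + w i"]) (auto simp: add.commute)
    also have "\<dots> \<le> risk (real n) S + risk 1 w" by (rule risk_subadditive)
    finally show "(\<Sum>z\<in>\<Omega>. pmf D z * (case next_state d \<epsilon> \<tau> vh (w, A, S) z of (w, A, S) \<Rightarrow> risk (real (Suc n)) S)) \<le>
      (case (w, A, S) of (w, A, S) \<Rightarrow> risk (real n) S) + (case (w, A, S) of (w, _) \<Rightarrow> risk 1 w)"
      by (simp add: next_state_def sum_p flip: sum_distrib_right)
  qed
  also have "\<dots> = E n (\<lambda>(w, A, S). risk (real n) S) + mean_risk n" by (simp add: mean_risk_def)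
  finally show ?case using Suc by simp
qed

lemma risk_nonneg: "0 \<le> risk n S"
  unfolding risk_def using eps q_nonneg
  by (intro sum_nonneg mult_nonneg_nonneg add_nonneg_nonneg divide_nonneg_nonneg hinge_nonneg) auto

text \<open>The upper bound on k n keeps the filter tame; the lower bound turns the loss total 114
  eps / k into at most 114 eps per step. Then 2046 = 114 + 1932.\<close>

lemma expected_risk_le:
  assumes "1 \<le> filter_rate d \<epsilon> * real n" "filter_rate d \<epsilon> * real n \<le> 2"
  shows "E n (\<lambda>(w, A, S). risk (real n) S) \<le> 2046 * \<epsilon> * real n"
proof -
  have m: "filter_rate d \<epsilon> * real m \<le> 2" if "m < n" for m
  proof -
    have "filter_rate d \<epsilon> * real m \<le> filter_rate d \<epsilon> * real n" using that rate by (intro mult_left_mono) auto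
    thus ?thesis using assms(2) by linarith
  qed
  have "(\<Sum>m<n. mean_risk m) \<le> (\<Sum>m<n. mean_loss m / \<epsilon> + 1932 * \<epsilon>)"
    by (intro sum_mono mean_risk_le m) auto
  also have "\<dots> = (\<Sum>m<n. mean_loss m) / \<epsilon> + 1932 * \<epsilon> * real n"
    by (simp add: sum.distrib sum_divide_distrib)
  also have "(\<Sum>m<n. mean_loss m) / \<epsilon> \<le> (114 * \<epsilon>\<^sup>2 / filter_rate d \<epsilon>) / \<epsilon>"
    using eps assms by (intro divide_right_mono mean_loss_sum_le) auto
  also have "\<dots> = 114 * \<epsilon> * (1 / filter_rate d \<epsilon>)" using eps by (simp add: power2_eq_square)
  also have "\<dots> \<le> 114 * \<epsilon> * real n"
    using eps rate(1) assms(1) by (intro mult_left_mono) (auto simp: field_simps)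
  finally show ?thesis using total_risk_le[of n] by (simp add: algebra_simps)
qed

lemma error_eq: "error d D u \<tau> = (\<Sum>z\<in>\<Omega>. pmf D z * of_bool (sign_pm (dotp d u (fst z) + \<tau>) \<noteq> snd z))"
  unfolding error_def using supp by (subst prob_finite[where \<Omega> = \<Omega>]) (auto simp: case_prod_beta)

lemma chain_success:
  assumes "1 \<le> filter_rate d \<epsilon> * real n" "filter_rate d \<epsilon> * real n \<le> 2"
  shows "measure_pmf.prob (chn n) {(w, A, S). error d D (\<lambda>i. vh i + S i / real n) \<tau> \<le> 410000 * \<epsilon>} \<ge> 0.995"
proof -
  have n: "real n > 0" using assms(1) by (cases n) auto
  \<comment> \<open>The Markov threshold is 200 * 2046, so failure has probability at most 1/200.
    The 2 eps of \<open>error_le_risk\<close> fit below 410000.\<close>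
  let ?u = "\<lambda>(w, A, S). risk (real n) S" and ?c = "409200 * \<epsilon> * real n"
  have "measure_pmf.prob (chn n) {s \<in> space (chn n). ?u s \<ge> ?c} \<le> E n ?u / ?c"
    using eps n by (intro integral_Markov_inequality_measure[where A = "{}"]) (auto simp: risk_nonneg)
  also have "\<dots> \<le> (2046 * \<epsilon> * real n) / ?c"
    using eps n by (intro divide_right_mono expected_risk_le assms) auto
  also have "\<dots> = 0.005" using eps n by simp
  finally have "measure_pmf.prob (chn n) (UNIV - {s. ?u s \<ge> ?c}) \<ge> 0.995"
    using measure_pmf.prob_compl[of "{s. ?u s \<ge> ?c}" "chn n"] by simp
  also have "measure_pmf.prob (chn n) (UNIV - {s. ?u s \<ge> ?c}) \<le>
      measure_pmf.prob (chn n) {(w, A, S). error d D (\<lambda>i. vh i + S i / real n) \<tau> \<le> 410000 * \<epsilon>}"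
  proof (intro measure_pmf.finite_measure_mono subsetI)
    fix s assume s: "s \<in> UNIV - {s. ?u s \<ge> ?c}"
    obtain w A S where [simp]: "s = (w, A, S)" by (cases s)
    have "risk (real n) S < ?c" using s by simp
    hence "risk (real n) S / real n \<le> 409200 * \<epsilon>" using n by (simp add: field_simps)
    hence "error d D (\<lambda>i. vh i + S i / real n) \<tau> \<le> 409202 * \<epsilon>"
      unfolding error_eq using error_le_risk[OF n, of S] by linarith
    thus "s \<in> {(w, A, S). error d D (\<lambda>i. vh i + S i / real n) \<tau> \<le> 410000 * \<epsilon>}"
      using eps by simp
  qed simp
  finally show ?thesis .
qed

end

section \<open>Total variation, and the hypotheses as an instance of the locale\<close>

lemma abs_prob_diff_le_dist_TV: "\<bar>measure_pmf.prob P A - measure_pmf.prob Q A\<bar> \<le> dist_TV P Q"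
  unfolding dist_TV_def
proof (rule cSUP_upper)
  show "bdd_above (range (\<lambda>A. \<bar>measure_pmf.prob P A - measure_pmf.prob Q A\<bar>))"
  proof (rule bdd_aboveI2)
    fix A show "\<bar>measure_pmf.prob P A - measure_pmf.prob Q A\<bar> \<le> 1"
      using measure_pmf.prob_le_1[of P A] measure_pmf.prob_le_1[of Q A]
        measure_nonneg[of P A] measure_nonneg[of Q A] by linarith
  qed
qed simp

lemma dist_TV_nonneg: "0 \<le> dist_TV P Q"
  using abs_prob_diff_le_dist_TV[of P "{}" Q] by simp

text \<open>The event where one law dominates is a competitor in the supremum; on it the difference
  of probabilities is the sum of the positive parts.\<close>

lemma dist_TV_excess:
  assumes "finite \<Omega>" "set_pmf P \<subseteq> \<Omega>" "set_pmf Q \<subseteq> \<Omega>"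
  shows "(\<Sum>z\<in>\<Omega>. max 0 (pmf P z - pmf Q z)) \<le> dist_TV P Q"
    and "(\<Sum>z\<in>\<Omega>. max 0 (pmf Q z - pmf P z)) \<le> dist_TV P Q"
proof -
  have diff: "measure_pmf.prob P A - measure_pmf.prob Q A = (\<Sum>z\<in>\<Omega>. (pmf P z - pmf Q z) * of_bool (z \<in> A))" for A
    unfolding prob_finite[OF assms(1,2)] prob_finite[OF assms(1,3)]
    by (simp only: left_diff_distrib sum_subtractf)
  have "(\<Sum>z\<in>\<Omega>. max 0 (pmf P z - pmf Q z)) = (\<Sum>z\<in>\<Omega>. (pmf P z - pmf Q z) * of_bool (z \<in> {z. pmf Q z \<le> pmf P z}))"
    by (intro sum.cong refl) auto
  thus "(\<Sum>z\<in>\<Omega>. max 0 (pmf P z - pmf Q z)) \<le> dist_TV P Q"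
    unfolding diff[symmetric] using abs_prob_diff_le_dist_TV[of P "{z. pmf Q z \<le> pmf P z}" Q] by linarith
  have "(\<Sum>z\<in>\<Omega>. max 0 (pmf Q z - pmf P z)) = (\<Sum>z\<in>\<Omega>. - ((pmf P z - pmf Q z) * of_bool (z \<in> {z. pmf P z \<le> pmf Q z})))"
    by (intro sum.cong refl) auto
  thus "(\<Sum>z\<in>\<Omega>. max 0 (pmf Q z - pmf P z)) \<le> dist_TV P Q"
    unfolding sum_negf diff[symmetric] using abs_prob_diff_le_dist_TV[of P "{z. pmf P z \<le> pmf Q z}" Q] by linarith
qed

lemma contaminated_samplingI:
  assumes eps: "0 < \<epsilon>" "\<epsilon> < 1" and d: "0 < d" and H: "\<forall>i<d. i \<notin> H \<longrightarrow> vh i = 0"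
    and D: "set_pmf D \<subseteq> cube d \<times> {-1, 1}" and TV: "dist_TV D Dc \<le> \<eta>" and small: "\<eta> \<le> \<epsilon> ^ 3"
    and marg: "map_pmf fst Dc = pmf_of_set (cube d)"
    and lab: "\<forall>(x, y) \<in> set_pmf Dc. y = sign_pm (dotp d vh x + dotp d v x + \<tau>)"
    and norm: "pnorm 2 d v = 1" "(pnorm 4 d v)\<^sup>2 \<le> \<epsilon>" and tail: "\<forall>i\<in>H. v i = 0"
  shows "contaminated_sampling d \<epsilon> \<eta> \<tau> vh v D (pmf Dc)"
proof -
  let ?O = "cube d \<times> {-1, 1 :: real}"
  have Dc: "set_pmf Dc \<subseteq> ?O"
  proof
    fix z assume z: "z \<in> set_pmf Dc"
    have "fst z \<in> set_pmf (map_pmf fst Dc)" using z by simp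
    hence "fst z \<in> cube d" unfolding marg by simp
    moreover have "snd z = sign_pm (dotp d vh (fst z) + dotp d v (fst z) + \<tau>)" using lab z by auto
    hence "snd z \<in> {-1, 1}" by (simp add: sign_pm_def)
    ultimately show "z \<in> ?O" by (cases z) auto
  qed
  show ?thesis
  proof
    show "(\<Sum>z\<in>?O. pmf D z) = 1" using D by (intro sum_pmf_eq_1) auto
    show "(\<Sum>z\<in>?O. pmf Dc z * f (fst z)) = (\<Sum>x\<in>cube d. f x) / 2 ^ d" for f
    proof -
      have "(\<Sum>z\<in>?O. pmf Dc z * f (fst z)) = measure_pmf.expectation Dc (\<lambda>z. f (fst z))"
        using Dc by (subst integral_measure_pmf[of ?O]) auto
      also have "\<dots> = measure_pmf.expectation (map_pmf fst Dc) f" by simp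
      also have "\<dots> = (\<Sum>x\<in>cube d. f x) / 2 ^ d"
        unfolding marg by (simp add: integral_pmf_of_set card_cube)
      finally show ?thesis .
    qed
    show "(\<Sum>z\<in>?O. max 0 (pmf D z - pmf Dc z)) \<le> \<eta>" "(\<Sum>z\<in>?O. max 0 (pmf Dc z - pmf D z)) \<le> \<eta>"
      using dist_TV_excess[OF _ D Dc] TV by fastforce+
    show "snd z = sign_pm (dotp d vh (fst z) + dotp d v (fst z) + \<tau>)" if "pmf Dc z \<noteq> 0" for z
      using lab that by (cases z) (auto simp: set_pmf_iff)
    show "dotp d v v = 1" using pnorm_conditions(1)[OF norm] by (simp add: dotp_def power2_eq_square)
    \<comment> \<open>The supports of \<open>vh\<close> and \<open>v\<close> are disjoint, so their
      sum equals \<open>v i\<close> wherever \<open>v i\<close> is nonzero, as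
      \<open>small_ball\<close> requires.\<close>
    have "(\<Sum>x\<in>cube d. of_bool (\<bar>dotp d (\<lambda>i. vh i + v i) x + \<tau>\<bar> \<le> \<epsilon>)) / 2 ^ d \<le> 15 * \<epsilon>"
      using H tail by (intro small_ball[where v = v] eps pnorm_conditions[OF norm]) auto
    thus "(\<Sum>x\<in>cube d. of_bool (\<bar>dotp d vh x + dotp d v x + \<tau>\<bar> \<le> \<epsilon>)) / 2 ^ d \<le> 15 * \<epsilon>"
      unfolding dotp_add .
    show "0 \<le> \<eta>" using dist_TV_nonneg TV by (rule order_trans)
  qed (use assms in auto)
qed

section \<open>Timed program logic\<close>

text \<open>As halting is absorbing, this says that every random branch halts within
  \<open>t\<close> steps and that the final state has law \<open>M\<close>.\<close>

definition exec :: "nat \<Rightarrow> labelled pmf \<Rightarrow> nat \<Rightarrow> com \<Rightarrow> state \<Rightarrow> state pmf \<Rightarrow> bool" where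
  "exec d D t c s M \<longleftrightarrow> run d D t (c, s) = map_pmf (Pair Skip) M"

lemma run_Skip: "run d D t (Skip, s) = return_pmf (Skip, s)"
  by (induction t) (simp_all add: bind_return_pmf)

lemma run_add: "run d D (m + n) cfg = bind_pmf (run d D m cfg) (run d D n)"
proof (induction m arbitrary: cfg)
  case (Suc m)
  hence "run d D (m + n) = (\<lambda>cfg. bind_pmf (run d D m cfg) (run d D n))" by (rule ext)
  thus ?case by (simp add: bind_assoc_pmf)
qed (simp add: bind_return_pmf)

lemma exec_mono:
  assumes "exec d D t c s M" "t \<le> t'"
  shows "exec d D t' c s M"
proof -
  have "run d D t' (c, s) = bind_pmf (map_pmf (Pair Skip) M) (run d D (t' - t))"
    using assms run_add[of d D t "t' - t"] by (simp add: exec_def)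
  also have "\<dots> = map_pmf (Pair Skip) M"
    by (simp add: map_pmf_def bind_assoc_pmf bind_return_pmf run_Skip)
  finally show ?thesis by (simp add: exec_def)
qed

lemma exec_Skip: "exec d D t Skip s M \<longleftrightarrow> M = return_pmf s"
proof
  assume "exec d D t Skip s M"
  hence "map_pmf snd (return_pmf (Skip, s)) = map_pmf snd (map_pmf (Pair Skip) M)"
    by (simp only: exec_def run_Skip)
  thus "M = return_pmf s" by (simp add: pmf.map_comp o_def)
qed (simp add: exec_def run_Skip)

text \<open>Induction on the steps of the first command, with its state and result law general
  because every step branches. The extra step discards the finished \<open>Skip\<close>.\<close>

lemma exec_Seq:
  assumes "exec d D t1 c1 s M1" and "\<And>s'. s' \<in> set_pmf M1 \<Longrightarrow> exec d D t2 c2 s' (M2 s')"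
  shows "exec d D (Suc (t1 + t2)) (Seq c1 c2) s (bind_pmf M1 M2)"
  using assms
proof (induction t1 arbitrary: c1 s M1)
  case (0 c1 s M1)
  hence r: "return_pmf (c1, s) = map_pmf (Pair Skip) M1" by (simp add: exec_def)
  have "(c1, s) \<in> set_pmf (map_pmf (Pair Skip) M1)" unfolding r[symmetric] by simp
  hence [simp]: "c1 = Skip" by auto
  have [simp]: "M1 = return_pmf s" using 0(1) by (simp add: exec_Skip)
  show ?case using 0(2)[of s] by (simp add: exec_def bind_return_pmf)
next
  case (Suc t1 c1 s M1)
  show ?case
  proof (cases "c1 = Skip")
    case True
    have [simp]: "M1 = return_pmf s" using Suc.prems(1) True by (simp add: exec_Skip)
    have "exec d D (Suc t1 + t2) c2 s (M2 s)"
      using Suc.prems(2)[of s] by (rule exec_mono) auto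
    thus ?thesis using True by (simp add: exec_def bind_return_pmf)
  next
    case False
    let ?st = "step d D c1 s"
    \<comment> \<open>The law of the final state given the configuration after the first step;
      \<open>M1\<close> is its mixture over that step, which lets the induction hypothesis be
      applied branch by branch.\<close>
    define N where "N cfg = map_pmf snd (run d D t1 cfg)" for cfg
    have run1: "bind_pmf ?st (run d D t1) = map_pmf (Pair Skip) M1"
      using Suc.prems(1) by (simp add: exec_def)
    have M1: "M1 = bind_pmf ?st N"
    proof -
      have "M1 = map_pmf snd (map_pmf (Pair Skip) M1)" by (simp add: pmf.map_comp o_def)
      thus ?thesis unfolding run1[symmetric] by (simp add: N_def[abs_def] map_bind_pmf)
    qed
    have ex: "exec d D (Suc (t1 + t2)) (Seq c' c2) s' (bind_pmf (N (c', s')) M2)"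
      if cfg: "(c', s') \<in> set_pmf ?st" for c' s'
    proof (rule Suc.IH)
      show "exec d D t1 c' s' (N (c', s'))"
      proof -
        have "fst x = Skip" if "x \<in> set_pmf (run d D t1 (c', s'))" for x
        proof -
          have "x \<in> set_pmf (bind_pmf ?st (run d D t1))" using cfg that by auto
          thus ?thesis unfolding run1 by auto
        qed
        hence "map_pmf (Pair Skip) (N (c', s')) = map_pmf (\<lambda>x. x) (run d D t1 (c', s'))"
          unfolding N_def pmf.map_comp by (intro map_pmf_cong) (auto simp: prod_eq_iff)
        thus ?thesis by (simp add: exec_def)
      qed
      show "exec d D t2 c2 s'' (M2 s'')" if "s'' \<in> set_pmf (N (c', s'))" for s''
        using that cfg by (intro Suc.prems(2)) (auto simp: M1)
    qed
    have "run d D (Suc (Suc t1 + t2)) (Seq c1 c2, s) =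
        bind_pmf ?st (\<lambda>cfg. run d D (Suc (t1 + t2)) (Seq (fst cfg) c2, snd cfg))"
      using False by (subst run.simps(2)) (simp add: bind_map_pmf case_prod_beta del: run.simps)
    also have "\<dots> = bind_pmf ?st (\<lambda>cfg. map_pmf (Pair Skip) (bind_pmf (N cfg) M2))"
    proof (intro bind_pmf_cong refl)
      fix cfg assume "cfg \<in> set_pmf ?st"
      thus "run d D (Suc (t1 + t2)) (Seq (fst cfg) c2, snd cfg) = map_pmf (Pair Skip) (bind_pmf (N cfg) M2)"
        using ex[of "fst cfg" "snd cfg"] by (simp only: exec_def prod.collapse)
    qed
    also have "\<dots> = map_pmf (Pair Skip) (bind_pmf M1 M2)"
      by (simp add: M1 map_bind_pmf bind_assoc_pmf)
    finally show ?thesis by (simp only: exec_def)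
  qed
qed

lemma exec_step:
  assumes "step d D c s = return_pmf (c', s')" "exec d D t c' s' M"
  shows "exec d D (Suc t) c s M"
  using assms by (simp add: exec_def bind_return_pmf)

text \<open>For commands that use no randomness: total correctness, a step bound and a unique final
  state. Sampling is handled with \<open>exec\<close> directly.\<close>

definition triple :: "nat \<Rightarrow> labelled pmf \<Rightarrow> nat \<Rightarrow> (state \<Rightarrow> bool) \<Rightarrow> com \<Rightarrow> (state \<Rightarrow> bool) \<Rightarrow> bool" where
  "triple d D t P c Q \<longleftrightarrow> (\<forall>s. P s \<longrightarrow> (\<exists>s'. Q s' \<and> exec d D t c s (return_pmf s')))"

lemma tripleI: "(\<And>s. P s \<Longrightarrow> \<exists>s'. Q s' \<and> exec d D t c s (return_pmf s')) \<Longrightarrow> triple d D t P c Q"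
  by (simp add: triple_def)

lemma triple_conseq:
  assumes "triple d D t P c Q" "\<And>s. P' s \<Longrightarrow> P s" "\<And>s. Q s \<Longrightarrow> Q' s" "t \<le> t'"
  shows "triple d D t' P' c Q'"
  using assms exec_mono unfolding triple_def by metis

lemma triple_Skip: "triple d D 0 P Skip P"
  by (rule tripleI) (auto simp: exec_def)

lemma triple_NAssign: "triple d D 1 (\<lambda>s. Q (set_nvar x (nval e s) s)) (NAssign x e) Q"
  by (rule tripleI) (auto simp: exec_def bind_return_pmf)

lemma triple_RAssign:
  "triple d D 1 (\<lambda>s. Q (set_cell a (nval i s) (nval j s) (rval e s) s)) (RAssign a i j e) Q"
  by (rule tripleI) (auto simp: exec_def bind_return_pmf)

lemma triple_Seq:
  assumes "triple d D t2 R c2 Q" "triple d D t1 P c1 R"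
  shows "triple d D (Suc (t1 + t2)) P (Seq c1 c2) Q"
proof (rule tripleI)
  fix s assume "P s"
  then obtain s1 where 1: "R s1" "exec d D t1 c1 s (return_pmf s1)" using assms(2) by (auto simp: triple_def)
  then obtain s2 where 2: "Q s2" "exec d D t2 c2 s1 (return_pmf s2)" using assms(1) by (auto simp: triple_def)
  have "exec d D (Suc (t1 + t2)) (Seq c1 c2) s (bind_pmf (return_pmf s1) (\<lambda>_. return_pmf s2))"
    using 1 2 by (intro exec_Seq) auto
  thus "\<exists>s'. Q s' \<and> exec d D (Suc (t1 + t2)) (Seq c1 c2) s (return_pmf s')"
    using 2(1) by (auto simp: bind_return_pmf)
qed

lemma triple_Cond:
  assumes "triple d D t P1 c1 Q" "triple d D t P2 c2 Q"
  shows "triple d D (Suc t) (\<lambda>s. if bval b s then P1 s else P2 s) (Cond b c1 c2) Q"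
proof (rule tripleI)
  fix s assume s: "if bval b s then P1 s else P2 s"
  then obtain s' where "Q s'" "exec d D t (if bval b s then c1 else c2) s (return_pmf s')"
    using assms by (auto simp: triple_def split: if_splits)
  thus "\<exists>s'. Q s' \<and> exec d D (Suc t) (Cond b c1 c2) s (return_pmf s')"
    by (auto intro!: exec_step)
qed

definition For :: "vname \<Rightarrow> nexp \<Rightarrow> com \<Rightarrow> com" where
  "For i e c = Seq (NAssign i (NConst 0))
     (While (NLess (NVar i) e) (Seq c (NAssign i (NAdd (NVar i) (NConst 1)))))"

text \<open>An iteration costs the body and four steps: test, increment and leaving two
  \<open>Seq\<close>. The other three are the initialization, its \<open>Seq\<close> and the last
  test. Stability forces the invariant to ignore the loop counter.\<close>

lemma triple_For:
  assumes body: "\<And>k. k < n \<Longrightarrow> triple d D t (\<lambda>s. I k s \<and> nvar s i = k) c (\<lambda>s. I (Suc k) s \<and> nvar s i = k)"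
    and stable: "\<And>k m s. I k s \<Longrightarrow> I k (set_nvar i m s)"
    and bound: "\<And>k s. I k s \<Longrightarrow> nval e s = n"
  shows "triple d D (n * (t + 4) + 3) (I 0) (For i e c) (I n)"
proof -
  let ?c = "Seq c (NAssign i (NAdd (NVar i) (NConst 1)))"
  let ?W = "While (NLess (NVar i) e) ?c"
  have W: "triple d D (m * (t + 4) + 1) (\<lambda>s. I k s \<and> nvar s i = k) ?W (I n)" if "k + m = n" for k m
    using that
  proof (induction m arbitrary: k)
    case 0
    show ?case
    proof (rule tripleI)
      fix s assume s: "I k s \<and> nvar s i = k"
      hence "exec d D (Suc 0) ?W s (return_pmf s)"
        using 0 bound[of k s] by (intro exec_step[where c' = Skip]) (auto simp: exec_Skip)
      thus "\<exists>s'. I n s' \<and> exec d D (0 * (t + 4) + 1) ?W s (return_pmf s')" using s 0 by auto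
    qed
  next
    case (Suc m)
    have c: "triple d D (Suc (t + 1)) (\<lambda>s. I k s \<and> nvar s i = k) ?c (\<lambda>s. I (Suc k) s \<and> nvar s i = Suc k)"
      by (rule triple_Seq[OF triple_NAssign], rule triple_conseq[OF body[of k]])
         (use Suc.prems stable in \<open>auto simp: set_nvar_def\<close>)
    have "triple d D (Suc (Suc (t + 1) + (m * (t + 4) + 1))) (\<lambda>s. I k s \<and> nvar s i = k) (Seq ?c ?W) (I n)"
      using Suc.prems by (intro triple_Seq[OF Suc.IH c]) auto
    note * = this
    show ?case
    proof (rule tripleI)
      fix s assume s: "I k s \<and> nvar s i = k"
      then obtain s' where s': "I n s'" "exec d D (Suc (Suc (t + 1) + (m * (t + 4) + 1))) (Seq ?c ?W) s (return_pmf s')"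
        using * unfolding triple_def by blast
      have "step d D ?W s = return_pmf (Seq ?c ?W, s)" using s bound[of k s] Suc.prems by simp
      from exec_step[OF this s'(2)] have "exec d D (Suc m * (t + 4) + 1) ?W s (return_pmf s')"
        by (rule exec_mono) simp
      thus "\<exists>s'. I n s' \<and> exec d D (Suc m * (t + 4) + 1) ?W s (return_pmf s')" using s'(1) by blast
    qed
  qed
  have "triple d D (Suc (1 + (n * (t + 4) + 1))) (I 0) (For i e c) (I n)"
    unfolding For_def
    by (rule triple_Seq[OF W[of 0 n]], simp, rule triple_conseq[OF triple_NAssign])
       (use stable in \<open>auto simp: set_nvar_def\<close>)
  thus ?thesis by (rule triple_conseq) auto
qed

section \<open>The program\<close>

abbreviation scalar :: "vname \<Rightarrow> rexp" where "scalar a \<equiv> Cell a (NConst 0) (NConst 0)"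
abbreviation entry :: "vname \<Rightarrow> vname \<Rightarrow> rexp" where "entry a i \<equiv> Cell a (NConst 0) (NVar i)"
abbreviation set_scalar :: "vname \<Rightarrow> rexp \<Rightarrow> com" where "set_scalar a \<equiv> RAssign a (NConst 0) (NConst 0)"
abbreviation set_entry :: "vname \<Rightarrow> vname \<Rightarrow> rexp \<Rightarrow> com" where "set_entry a i \<equiv> RAssign a (NConst 0) (NVar i)"
abbreviation real_const :: "nat \<Rightarrow> rexp" where "real_const n \<equiv> OfNat (NConst n)"
abbreviation inv_eps :: rexp where "inv_eps \<equiv> RDiv (real_const 1) (scalar ''eps'')"
abbreviation dim_sq :: rexp where "dim_sq \<equiv> RMul (OfNat (NVar ''d'')) (OfNat (NVar ''d''))"
abbreviation eps_sq :: rexp where "eps_sq \<equiv> RMul (scalar ''eps'') (scalar ''eps'')"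

definition scan_row :: com where
  "scan_row = For ''j'' (NVar ''i'') (set_scalar ''q'' (RAdd (scalar ''q'')
     (RMul (RMul (Cell ''A'' (NVar ''i'') (NVar ''j'')) (entry ''x'' ''i'')) (entry ''x'' ''j''))))"

text \<open>A single pass leaves the base score in \<open>u\<close>, w.x in \<open>m\<close> and the
  filter statistic in \<open>q\<close>. It also adds w to S while w is still the old
  iterate.\<close>

definition scan :: com where
  "scan = Seq (set_scalar ''u'' (scalar ''tau'')) (Seq (set_scalar ''m'' (real_const 0)) (Seq (set_scalar ''q'' (real_const 0))
     (For ''i'' (NVar ''d'')
       (Seq (set_scalar ''u'' (RAdd (scalar ''u'') (RMul (entry ''vhead'' ''i'') (entry ''x'' ''i''))))
       (Seq (set_scalar ''m'' (RAdd (scalar ''m'') (RMul (entry ''w'' ''i'') (entry ''x'' ''i''))))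
       (Seq (set_entry ''S'' ''i'' (RAdd (entry ''S'' ''i'') (entry ''w'' ''i'')))
         scan_row))))))"

text \<open>\<open>k\<close> and \<open>r\<close> receive the effective step sizes, 0 if the point
  is rejected or inactive, so that \<open>update\<close> can be unconditional. The label is read
  from column \<open>d\<close> of the sample.\<close>

definition decide :: com where
  "decide = Seq (set_scalar ''k'' (real_const 0)) (Seq (set_scalar ''r'' (real_const 0))
     (Cond (BNot (RLess inv_eps (scalar ''q'')))
       (Seq (set_scalar ''k'' (RDiv (RMul eps_sq eps_sq) dim_sq))
         (Cond (BAnd (BAnd (BNot (RLess inv_eps (scalar ''u''))) (BNot (RLess (scalar ''u'') (RSub (real_const 0) inv_eps))))
             (RLess (RMul (Cell ''x'' (NConst 0) (NVar ''d'')) (RAdd (scalar ''u'') (scalar ''m''))) (scalar ''eps'')))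
           (set_scalar ''r'' (RMul (Cell ''x'' (NConst 0) (NVar ''d'')) (RDiv eps_sq dim_sq)))
           Skip))
       Skip))"

definition update_row :: com where
  "update_row = For ''j'' (NVar ''i'') (RAssign ''A'' (NVar ''i'') (NVar ''j'')
     (RAdd (Cell ''A'' (NVar ''i'') (NVar ''j'')) (RMul (RMul (scalar ''k'') (entry ''x'' ''i'')) (entry ''x'' ''j''))))"

definition update :: com where
  "update = For ''i'' (NVar ''d'')
     (Seq (set_entry ''w'' ''i'' (RAdd (entry ''w'' ''i'') (RMul (scalar ''r'') (entry ''x'' ''i'')))) update_row)"

definition process :: com where
  "process = Seq scan (Seq decide (Seq update (NAssign ''n'' (NAdd (NVar ''n'') (NConst 1)))))"

text \<open>The model has no conversion from reals to naturals, so the iteration count d^2 / eps^4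
  is never computed: the counter is compared with it as a real number.\<close>

definition learn :: com where
  "learn = While (RLess (OfNat (NVar ''n'')) (RDiv dim_sq (RMul eps_sq eps_sq))) (Seq (Sample ''x'' (NConst 0)) process)"

definition write_output :: com where
  "write_output = For ''i'' (NVar ''d'')
     (set_entry ''out'' ''i'' (RAdd (entry ''vhead'' ''i'') (RDiv (entry ''S'' ''i'') (OfNat (NVar ''n'')))))"

definition find_regular_contaminated :: com where
  "find_regular_contaminated = Seq learn write_output"

text \<open>The last conjunct equates whole rows, beyond the entries below \<open>d\<close>, so a
  memory determines the learner state.\<close>

definition memory :: "nat \<Rightarrow> real \<Rightarrow> real \<Rightarrow> (nat \<Rightarrow> real) \<Rightarrow> nat \<Rightarrow> learner \<Rightarrow> state \<Rightarrow> bool" where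
  "memory d \<epsilon> \<tau> vh n l s \<longleftrightarrow> nvar s ''d'' = d \<and> nvar s ''n'' = n \<and> cell s ''eps'' 0 0 = \<epsilon> \<and>
     cell s ''tau'' 0 0 = \<tau> \<and> (\<forall>i<d. cell s ''vhead'' 0 i = vh i) \<and>
     (cell s ''w'' 0, cell s ''A'', cell s ''S'' 0) = l"

definition registers :: "(nat \<Rightarrow> real) \<Rightarrow> real \<Rightarrow> real \<Rightarrow> real \<Rightarrow> state \<Rightarrow> bool" where
  "registers x u m q s \<longleftrightarrow> cell s ''x'' 0 = x \<and> cell s ''u'' 0 0 = u \<and> cell s ''m'' 0 0 = m \<and> cell s ''q'' 0 0 = q"

lemmas state_simps = memory_def registers_def set_nvar_def set_cell_def set_row_def

section \<open>Correctness and cost of processing one sample\<close>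

lemma scan_row_triple:
  "triple d D (k * 5 + 3)
    (\<lambda>s. memory d \<epsilon> \<tau> vh n (w, A, S) s \<and> registers x u m q s \<and> nvar s ''i'' = k)
    scan_row
    (\<lambda>s. memory d \<epsilon> \<tau> vh n (w, A, S) s \<and> registers x u m (q + (\<Sum>j<k. A k j * x k * x j)) s \<and> nvar s ''i'' = k)"
proof -
  let ?I = "\<lambda>l s. memory d \<epsilon> \<tau> vh n (w, A, S) s \<and> registers x u m (q + (\<Sum>j<l. A k j * x k * x j)) s \<and> nvar s ''i'' = k"
  have "triple d D (k * (1 + 4) + 3) (?I 0) scan_row (?I k)"
    unfolding scan_row_def
  proof (rule triple_For)
    fix l
    show "triple d D 1 (\<lambda>s. ?I l s \<and> nvar s ''j'' = l) (set_scalar ''q'' (RAdd (scalar ''q'')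
     (RMul (RMul (Cell ''A'' (NVar ''i'') (NVar ''j'')) (entry ''x'' ''i'')) (entry ''x'' ''j'')))) (\<lambda>s. ?I (Suc l) s \<and> nvar s ''j'' = l)"
      by (rule triple_conseq[OF triple_RAssign]) (auto simp: state_simps)
  qed (auto simp: state_simps)
  thus ?thesis by (rule triple_conseq) auto
qed

lemma scan_triple:
  "triple d D (d * (5 * d + 13) + 9)
    (\<lambda>s. memory d \<epsilon> \<tau> vh n (w, A, S) s \<and> cell s ''x'' 0 = x)
    scan
    (\<lambda>s. memory d \<epsilon> \<tau> vh n (w, A, \<lambda>i. if i < d then S i + w i else S i) s \<and>
       registers x (base d \<tau> vh x) (dotp d w x) (quad d A x) s)"
proof -
  let ?I = "\<lambda>k s. memory d \<epsilon> \<tau> vh n (w, A, \<lambda>i. if i < k then S i + w i else S i) s \<and>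
    registers x (\<tau> + (\<Sum>i<k. vh i * x i)) (\<Sum>i<k. w i * x i) (\<Sum>i<k. \<Sum>j<i. A i j * x i * x j) s"
  let ?b = "Seq (set_scalar ''u'' (RAdd (scalar ''u'') (RMul (entry ''vhead'' ''i'') (entry ''x'' ''i''))))
       (Seq (set_scalar ''m'' (RAdd (scalar ''m'') (RMul (entry ''w'' ''i'') (entry ''x'' ''i''))))
       (Seq (set_entry ''S'' ''i'' (RAdd (entry ''S'' ''i'') (entry ''w'' ''i'')))
         scan_row))"
  have loop: "triple d D (d * ((5 * d + 9) + 4) + 3) (?I 0) (For ''i'' (NVar ''d'') ?b) (?I d)"
  proof (rule triple_For)
    fix k assume k: "k < d"
    have row: "triple d D (k * 5 + 3)
      (\<lambda>s. memory d \<epsilon> \<tau> vh n (w, A, \<lambda>i. if i < Suc k then S i + w i else S i) s \<and>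
        registers x (\<tau> + (\<Sum>i<Suc k. vh i * x i)) (\<Sum>i<Suc k. w i * x i) (\<Sum>i<k. \<Sum>j<i. A i j * x i * x j) s \<and> nvar s ''i'' = k)
      scan_row (\<lambda>s. ?I (Suc k) s \<and> nvar s ''i'' = k)"
      by (rule triple_conseq[OF scan_row_triple]) auto
    show "triple d D (5 * d + 9) (\<lambda>s. ?I k s \<and> nvar s ''i'' = k) ?b (\<lambda>s. ?I (Suc k) s \<and> nvar s ''i'' = k)"
      by (rule triple_conseq[OF triple_Seq[OF triple_Seq[OF triple_Seq[OF row triple_RAssign] triple_RAssign] triple_RAssign]])
         (use k in \<open>auto simp: state_simps fun_eq_iff less_Suc_eq\<close>)
  qed (auto simp: state_simps)
  have post: "?I d s \<Longrightarrow> memory d \<epsilon> \<tau> vh n (w, A, \<lambda>i. if i < d then S i + w i else S i) s \<and>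
       registers x (base d \<tau> vh x) (dotp d w x) (quad d A x) s" for s
    by (simp add: base_def dotp_def quad_def)
  show ?thesis unfolding scan_def
    by (rule triple_conseq[OF triple_Seq[OF triple_Seq[OF triple_Seq[OF loop triple_RAssign] triple_RAssign] triple_RAssign] _ post])
       (auto simp: state_simps)
qed

lemma decide_triple:
  "triple d D 20
    (\<lambda>s. memory d \<epsilon> \<tau> vh n l s \<and> registers x u m q s)
    decide
    (\<lambda>s. memory d \<epsilon> \<tau> vh n l s \<and> cell s ''x'' 0 = x \<and>
       cell s ''k'' 0 0 = (if q \<le> 1 / \<epsilon> then filter_rate d \<epsilon> else 0) \<and>
       cell s ''r'' 0 0 = (if q \<le> 1 / \<epsilon> \<and> \<bar>u\<bar> \<le> 1 / \<epsilon> \<and> x d * (u + m) < \<epsilon> then x d * learn_rate d \<epsilon> else 0))"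
proof -
  have ab: "\<bar>u\<bar> \<le> 1 / \<epsilon> \<longleftrightarrow> \<not> 1 / \<epsilon> < u \<and> \<not> u < 0 - 1 / \<epsilon>" for u by auto
  have rates: "filter_rate d \<epsilon> = \<epsilon> * \<epsilon> * (\<epsilon> * \<epsilon>) / (real d * real d)" "learn_rate d \<epsilon> = \<epsilon> * \<epsilon> / (real d * real d)"
    by (simp_all add: filter_rate_def learn_rate_def power4_eq_xxxx power2_eq_square mult.assoc)
  \<comment> \<open>\<open>triple_Cond\<close> wants one time bound for both branches, so each
    \<open>Skip\<close> is padded to the cost of its sibling.\<close>
  have skip: "triple d D 1 Q Skip Q" for Q by (rule triple_conseq[OF triple_Skip]) auto
  have skip': "triple d D (Suc (1 + Suc 1)) Q Skip Q" for Q by (rule triple_conseq[OF triple_Skip]) auto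
  show ?thesis unfolding decide_def
    by (rule triple_conseq[OF triple_Seq[OF triple_Seq[OF triple_Cond[OF
          triple_Seq[OF triple_Cond[OF triple_RAssign skip] triple_RAssign] skip'] triple_RAssign] triple_RAssign]])
       (auto simp: state_simps ab rates)
qed

lemma update_row_triple:
  assumes "k < d"
  shows "triple d D (k * 5 + 3)
    (\<lambda>s. memory d \<epsilon> \<tau> vh n (w, A, S) s \<and> cell s ''x'' 0 = x \<and> cell s ''k'' 0 0 = a \<and> cell s ''r'' 0 0 = r \<and> nvar s ''i'' = k)
    update_row
    (\<lambda>s. memory d \<epsilon> \<tau> vh n (w, \<lambda>i j. if i = k \<and> j < k then A i j + a * x i * x j else A i j, S) s \<and>
      cell s ''x'' 0 = x \<and> cell s ''k'' 0 0 = a \<and> cell s ''r'' 0 0 = r \<and> nvar s ''i'' = k)"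
proof -
  let ?I = "\<lambda>l s. memory d \<epsilon> \<tau> vh n (w, \<lambda>i j. if i = k \<and> j < l then A i j + a * x i * x j else A i j, S) s \<and>
    cell s ''x'' 0 = x \<and> cell s ''k'' 0 0 = a \<and> cell s ''r'' 0 0 = r \<and> nvar s ''i'' = k"
  have "triple d D (k * (1 + 4) + 3) (?I 0) update_row (?I k)"
    unfolding update_row_def
  proof (rule triple_For)
    fix l
    show "triple d D 1 (\<lambda>s. ?I l s \<and> nvar s ''j'' = l) (RAssign ''A'' (NVar ''i'') (NVar ''j'')
     (RAdd (Cell ''A'' (NVar ''i'') (NVar ''j'')) (RMul (RMul (scalar ''k'') (entry ''x'' ''i'')) (entry ''x'' ''j''))))
      (\<lambda>s. ?I (Suc l) s \<and> nvar s ''j'' = l)"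
      by (rule triple_conseq[OF triple_RAssign]) (auto simp: state_simps fun_eq_iff less_Suc_eq)
  qed (auto simp: state_simps)
  thus ?thesis by (rule triple_conseq) auto
qed

lemma update_triple:
  "triple d D (d * (5 * d + 9) + 3)
    (\<lambda>s. memory d \<epsilon> \<tau> vh n (w, A, S) s \<and> cell s ''x'' 0 = x \<and> cell s ''k'' 0 0 = a \<and> cell s ''r'' 0 0 = r)
    update
    (\<lambda>s. memory d \<epsilon> \<tau> vh n (\<lambda>i. if i < d then w i + r * x i else w i,
       \<lambda>i j. if i < d \<and> j < i then A i j + a * x i * x j else A i j, S) s)"
proof -
  let ?A = "\<lambda>k i j. if i < k \<and> j < i then A i j + a * x i * x j else A i j"
  let ?I = "\<lambda>k s. memory d \<epsilon> \<tau> vh n (\<lambda>i. if i < k then w i + r * x i else w i, ?A k, S) s \<and>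
    cell s ''x'' 0 = x \<and> cell s ''k'' 0 0 = a \<and> cell s ''r'' 0 0 = r"
  have "triple d D (d * ((5 * d + 5) + 4) + 3) (?I 0) update (?I d)"
    unfolding update_def
  proof (rule triple_For)
    fix k assume k: "k < d"
    have A: "(\<lambda>i j. if i = k \<and> j < k then ?A k i j + a * x i * x j else ?A k i j) = ?A (Suc k)"
      by (auto simp: fun_eq_iff less_Suc_eq)
    have row: "triple d D (k * 5 + 3)
      (\<lambda>s. memory d \<epsilon> \<tau> vh n (\<lambda>i. if i < Suc k then w i + r * x i else w i, ?A k, S) s \<and>
        cell s ''x'' 0 = x \<and> cell s ''k'' 0 0 = a \<and> cell s ''r'' 0 0 = r \<and> nvar s ''i'' = k)
      update_row (\<lambda>s. ?I (Suc k) s \<and> nvar s ''i'' = k)"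
      unfolding A[symmetric] by (rule triple_conseq[OF update_row_triple[OF k]]) auto
    show "triple d D (5 * d + 5) (\<lambda>s. ?I k s \<and> nvar s ''i'' = k)
      (Seq (set_entry ''w'' ''i'' (RAdd (entry ''w'' ''i'') (RMul (scalar ''r'') (entry ''x'' ''i'')))) update_row)
      (\<lambda>s. ?I (Suc k) s \<and> nvar s ''i'' = k)"
      by (rule triple_conseq[OF triple_Seq[OF row triple_RAssign]])
         (use k in \<open>auto simp: state_simps fun_eq_iff less_Suc_eq\<close>)
  qed (auto simp: state_simps)
  thus ?thesis by (rule triple_conseq) (auto simp: fun_eq_iff memory_def)
qed

lemma dotp_sample_row: "dotp d v (sample_row d z) = dotp d v (fst z)"
  unfolding dotp_def by (intro sum.cong refl) (simp add: sample_row_def)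

lemma quad_sample_row: "quad d A (sample_row d z) = quad d A (fst z)"
  unfolding quad_def by (intro sum.cong refl) (auto simp: sample_row_def)

lemma next_state_sample_row:
  fixes d :: nat and \<epsilon> \<tau> :: real and vh w :: "nat \<Rightarrow> real" and A :: "nat \<Rightarrow> nat \<Rightarrow> real" and z :: labelled
  defines "x \<equiv> sample_row d z"
  defines "a \<equiv> (if quad d A x \<le> 1 / \<epsilon> then filter_rate d \<epsilon> else 0)"
    and "r \<equiv> (if quad d A x \<le> 1 / \<epsilon> \<and> \<bar>base d \<tau> vh x\<bar> \<le> 1 / \<epsilon> \<and> x d * (base d \<tau> vh x + dotp d w x) < \<epsilon>
      then x d * learn_rate d \<epsilon> else 0)"
  shows "(\<lambda>i. if i < d then w i + r * x i else w i, \<lambda>i j. if i < d \<and> j < i then A i j + a * x i * x j else A i j,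
    \<lambda>i. if i < d then S i + w i else S i) = next_state d \<epsilon> \<tau> vh (w, A, S) z"
proof -
  have x: "x d = snd z" "\<And>i. i < d \<Longrightarrow> x i = fst z i" by (simp_all add: x_def sample_row_def)
  have a: "a = (if accept d \<epsilon> A (fst z) then filter_rate d \<epsilon> else 0)"
    by (simp add: a_def accept_def x_def quad_sample_row)
  have r: "r = (if accept d \<epsilon> A (fst z) \<and> active d \<epsilon> \<tau> vh w z then snd z * learn_rate d \<epsilon> else 0)"
    unfolding r_def x(1) by (simp add: accept_def active_def x_def quad_sample_row base_def dotp_sample_row)
  show ?thesis
    unfolding next_state_def next_w_def next_A_def a[symmetric] r[symmetric] prod.case
    using x(2) by (auto simp: fun_eq_iff)
qed

lemma process_triple:
  assumes "0 < d"
  shows "triple d D (80 * d\<^sup>2)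
    (\<lambda>s. memory d \<epsilon> \<tau> vh n l s \<and> cell s ''x'' 0 = sample_row d z)
    process
    (memory d \<epsilon> \<tau> vh (Suc n) (next_state d \<epsilon> \<tau> vh l z))"
proof -
  obtain w A S where l: "l = (w, A, S)" by (cases l)
  let ?x = "sample_row d z"
  have time: "Suc (d * (5 * d + 13) + 9 + Suc (20 + Suc (d * (5 * d + 9) + 3 + 1))) \<le> 80 * d\<^sup>2"
  proof -
    have "d \<le> d\<^sup>2" "1 \<le> d\<^sup>2" using assms by (auto simp: power2_eq_square)
    moreover have "Suc (d * (5 * d + 13) + 9 + Suc (20 + Suc (d * (5 * d + 9) + 3 + 1))) = 10 * d\<^sup>2 + 22 * d + 36"
      by (simp add: algebra_simps power2_eq_square)
    ultimately show ?thesis by linarith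
  qed
  have inc: "triple d D 1 (memory d \<epsilon> \<tau> vh n l')
      (NAssign ''n'' (NAdd (NVar ''n'') (NConst 1))) (memory d \<epsilon> \<tau> vh (Suc n) l')" for l'
    by (rule triple_conseq[OF triple_NAssign]) (auto simp: state_simps)
  show ?thesis
    unfolding process_def l
    by (rule triple_conseq[OF triple_Seq[OF triple_Seq[OF triple_Seq[OF inc update_triple] decide_triple] scan_triple] _ _ time])
       (auto simp: next_state_sample_row)
qed

text \<open>Once the sample is drawn, \<open>process\<close> is deterministic, so the final state is
  a function of the draw and its law is an image of D.\<close>

lemma body_exec:
  assumes "0 < d" "memory d \<epsilon> \<tau> vh n l s"
  shows "\<exists>f. exec d D (80 * d\<^sup>2 + 2) (Seq (Sample ''x'' (NConst 0)) process) s (map_pmf f D) \<and>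
    (\<forall>z. memory d \<epsilon> \<tau> vh (Suc n) (next_state d \<epsilon> \<tau> vh l z) (f z))"
proof -
  let ?g = "\<lambda>z. set_row ''x'' 0 (sample_row d z) s"
  have "\<exists>s'. memory d \<epsilon> \<tau> vh (Suc n) (next_state d \<epsilon> \<tau> vh l z) s' \<and> exec d D (80 * d\<^sup>2) process (?g z) (return_pmf s')" for z
    using process_triple[OF assms(1), of D \<epsilon> \<tau> vh n l z] assms(2) unfolding triple_def
    by (auto simp: state_simps)
  then obtain f where f: "\<And>z. memory d \<epsilon> \<tau> vh (Suc n) (next_state d \<epsilon> \<tau> vh l z) (f z)"
      "\<And>z. exec d D (80 * d\<^sup>2) process (?g z) (return_pmf (f z))" by metis
  have inj: "f z = f z'" if "?g z = ?g z'" for z z'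
  proof -
    have "map_pmf (Pair Skip) (return_pmf (f z)) = map_pmf (Pair Skip) (return_pmf (f z'))"
      using f(2)[of z] f(2)[of z'] that by (simp only: exec_def)
    thus ?thesis by simp
  qed
  \<comment> \<open>\<open>exec_Seq\<close> needs a continuation that depends on the state, while
    \<open>f\<close> depends on the draw. Draws with the same row lead to the same final state, so
    any preimage serves.\<close>
  define h where "h s' = f (SOME z. s' = ?g z)" for s'
  have h: "h (?g z) = f z" for z
    unfolding h_def using someI[of "\<lambda>z'. ?g z = ?g z'" z] by (intro inj) simp
  have "exec d D 1 (Sample ''x'' (NConst 0)) s (map_pmf ?g D)"
    by (simp add: exec_def bind_return_pmf bind_assoc_pmf map_pmf_def)
  hence "exec d D (Suc (1 + 80 * d\<^sup>2)) (Seq (Sample ''x'' (NConst 0)) process) s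
      (bind_pmf (map_pmf ?g D) (\<lambda>s'. return_pmf (h s')))"
    by (rule exec_Seq) (use f(2) h in auto)
  moreover have "bind_pmf (map_pmf ?g D) (\<lambda>s'. return_pmf (h s')) = map_pmf f D"
    by (simp only: bind_map_pmf h) (simp add: map_pmf_def)
  ultimately show ?thesis using f(1) by (auto intro!: exI[of _ f])
qed

section \<open>The sampling loop as a whole\<close>

primrec chain_from :: "nat \<Rightarrow> real \<Rightarrow> real \<Rightarrow> (nat \<Rightarrow> real) \<Rightarrow> labelled pmf \<Rightarrow> nat \<Rightarrow> learner \<Rightarrow> learner pmf" where
  "chain_from d \<epsilon> \<tau> vh D 0 l = return_pmf l"
| "chain_from d \<epsilon> \<tau> vh D (Suc m) l = bind_pmf D (\<lambda>z. chain_from d \<epsilon> \<tau> vh D m (next_state d \<epsilon> \<tau> vh l z))"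

lemma chain_from_Suc_right:
  "chain_from d \<epsilon> \<tau> vh D (Suc m) l = bind_pmf (chain_from d \<epsilon> \<tau> vh D m l) (\<lambda>l. map_pmf (next_state d \<epsilon> \<tau> vh l) D)"
proof (induction m arbitrary: l)
  case 0
  show ?case by (simp add: bind_return_pmf map_pmf_def)
next
  case (Suc m)
  show ?case
    by (subst chain_from.simps(2), subst Suc.IH) (simp add: bind_assoc_pmf)
qed

text \<open>The loop unfolds from its first sample, the recursions for expectations from the last
  one; associativity of bind reconciles the two views.\<close>

lemma chain_eq_chain_from: "chain d \<epsilon> \<tau> vh D n = chain_from d \<epsilon> \<tau> vh D n (\<lambda>_. 0, \<lambda>_ _. 0, \<lambda>_. 0)"
  by (induction n) (simp_all only: chain.simps chain_from.simps(1) chain_from_Suc_right)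

definition contents :: "state \<Rightarrow> learner" where
  "contents s = (cell s ''w'' 0, cell s ''A'', cell s ''S'' 0)"

lemma memory_contents: "memory d \<epsilon> \<tau> vh n l s \<Longrightarrow> contents s = l"
  by (simp add: memory_def contents_def)

text \<open>Induction on the \<open>m\<close> iterations left. Scratch registers and loop counters
  also vary, so only the image of the final law under \<open>contents\<close> is identified with the
  abstract chain.\<close>

lemma learn_exec:
  assumes d: "0 < d" and e: "0 < \<epsilon>" and N: "N = nat \<lceil>(real d)\<^sup>2 / \<epsilon> ^ 4\<rceil>"
    and "memory d \<epsilon> \<tau> vh n l s" "n + m = N"
  shows "\<exists>M. exec d D (m * (80 * d\<^sup>2 + 4) + 1) learn s M \<and> map_pmf contents M = chain_from d \<epsilon> \<tau> vh D m l \<and>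
    (\<forall>s'\<in>set_pmf M. \<exists>l'. memory d \<epsilon> \<tau> vh N l' s')"
  using assms(4-)
proof (induction m arbitrary: n l s)
  case (0 n l s)
  let ?c = "RLess (OfNat (NVar ''n'')) (RDiv dim_sq (RMul eps_sq eps_sq))"
  have "\<not> bval ?c s" using 0 N
    by (auto simp: memory_def power2_eq_square power4_eq_xxxx mult.assoc) linarith
  hence "exec d D (Suc 0) learn s (return_pmf s)"
    unfolding learn_def by (intro exec_step[where c' = Skip and s' = s]) (auto simp: exec_Skip)
  thus ?case using 0 memory_contents[OF 0(1)] by (intro exI[of _ "return_pmf s"] conjI ballI exI[of _ l]) auto
next
  case (Suc m n l s)
  let ?c = "RLess (OfNat (NVar ''n'')) (RDiv dim_sq (RMul eps_sq eps_sq))"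
  let ?b = "Seq (Sample ''x'' (NConst 0)) process"
  let ?T = "m * (80 * d\<^sup>2 + 4) + 1"
  have "int n < \<lceil>(real d)\<^sup>2 / \<epsilon> ^ 4\<rceil>" using Suc.prems(2) N by linarith
  hence "real n < (real d)\<^sup>2 / \<epsilon> ^ 4" by (simp add: less_ceiling_iff)
  hence c: "bval ?c s" using Suc.prems(1)
    by (simp add: memory_def power2_eq_square power4_eq_xxxx mult.assoc)
  obtain f where f: "exec d D (80 * d\<^sup>2 + 2) ?b s (map_pmf f D)"
      "\<And>z. memory d \<epsilon> \<tau> vh (Suc n) (next_state d \<epsilon> \<tau> vh l z) (f z)"
    using body_exec[OF d Suc.prems(1)] by blast
  have ex: "\<exists>M. exec d D ?T learn s' M \<and> map_pmf contents M = chain_from d \<epsilon> \<tau> vh D m (contents s') \<and>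
    (\<forall>s''\<in>set_pmf M. \<exists>l'. memory d \<epsilon> \<tau> vh N l' s'')" if "s' \<in> range f" for s'
  proof -
    from that obtain z where [simp]: "s' = f z" by auto
    show ?thesis
      using Suc.IH[OF f(2)[of z]] Suc.prems(2) memory_contents[OF f(2)[of z]] by simp
  qed
  then obtain K where K: "\<And>s'. s' \<in> range f \<Longrightarrow> exec d D ?T learn s' (K s')"
      "\<And>s'. s' \<in> range f \<Longrightarrow> map_pmf contents (K s') = chain_from d \<epsilon> \<tau> vh D m (contents s')"
      "\<And>s' s''. s' \<in> range f \<Longrightarrow> s'' \<in> set_pmf (K s') \<Longrightarrow> \<exists>l'. memory d \<epsilon> \<tau> vh N l' s''"
    by metis
  let ?M = "bind_pmf (map_pmf f D) K"
  have E: "exec d D (Suc (80 * d\<^sup>2 + 2 + ?T)) (Seq ?b learn) s ?M"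
    by (rule exec_Seq[OF f(1)], rule K(1)) auto
  have "step d D learn s = return_pmf (Seq ?b learn, s)"
    using c by (simp add: learn_def)
  hence "exec d D (Suc m * (80 * d\<^sup>2 + 4) + 1) learn s ?M"
    by (rule exec_mono[OF exec_step[OF _ E]]) simp
  moreover have "map_pmf contents ?M = chain_from d \<epsilon> \<tau> vh D (Suc m) l"
    by (simp add: map_bind_pmf bind_map_pmf K(2) memory_contents[OF f(2)])
  moreover have "\<forall>s'\<in>set_pmf ?M. \<exists>l'. memory d \<epsilon> \<tau> vh N l' s'"
    using K(3) by (simp only: set_bind_pmf set_map_pmf) blast
  ultimately show ?case by blast
qed

lemma write_output_triple:
  "triple d D (d * 5 + 3) (memory d \<epsilon> \<tau> vh n (w, A, S)) write_output
    (\<lambda>s. \<forall>i<d. output_vec s i = vh i + S i / real n)"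
proof -
  let ?I = "\<lambda>k s. memory d \<epsilon> \<tau> vh n (w, A, S) s \<and> (\<forall>i<k. output_vec s i = vh i + S i / real n)"
  have "triple d D (d * (1 + 4) + 3) (?I 0) write_output (?I d)"
    unfolding write_output_def
  proof (rule triple_For)
    fix k assume "k < d"
    thus "triple d D 1 (\<lambda>s. ?I k s \<and> nvar s ''i'' = k)
      (set_entry ''out'' ''i'' (RAdd (entry ''vhead'' ''i'') (RDiv (entry ''S'' ''i'') (OfNat (NVar ''n'')))))
      (\<lambda>s. ?I (Suc k) s \<and> nvar s ''i'' = k)"
      by (intro triple_conseq[OF triple_RAssign]) (auto simp: state_simps output_vec_def less_Suc_eq)
  qed (auto simp: state_simps output_vec_def)
  thus ?thesis by (rule triple_conseq) auto
qed

lemma program_exec: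
  assumes d: "0 < d" and e: "0 < \<epsilon>" and N: "N = nat \<lceil>(real d)\<^sup>2 / \<epsilon> ^ 4\<rceil>"
  shows "\<exists>M f. exec d D (N * (80 * d\<^sup>2 + 4) + 5 * d + 5) find_regular_contaminated (init_state \<epsilon> d H vh \<tau>) (map_pmf f M) \<and>
    map_pmf contents M = chain d \<epsilon> \<tau> vh D N \<and>
    (\<forall>s\<in>set_pmf M. \<forall>i<d. output_vec (f s) i = vh i + (case contents s of (w, A, S) \<Rightarrow> S i / real N))"
proof -
  have init: "memory d \<epsilon> \<tau> vh 0 (\<lambda>_. 0, \<lambda>_ _. 0, \<lambda>_. 0) (init_state \<epsilon> d H vh \<tau>)"
    by (simp add: memory_def init_state_def)
  from learn_exec[OF d e N this, of N D] obtain M where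
      M: "exec d D (N * (80 * d\<^sup>2 + 4) + 1) learn (init_state \<epsilon> d H vh \<tau>) M"
        "map_pmf contents M = chain d \<epsilon> \<tau> vh D N"
        "\<And>s. s \<in> set_pmf M \<Longrightarrow> \<exists>l. memory d \<epsilon> \<tau> vh N l s"
    unfolding chain_eq_chain_from by auto
  have "\<exists>s'. (\<forall>i<d. output_vec s' i = vh i + (case contents s of (w, A, S) \<Rightarrow> S i / real N)) \<and>
      exec d D (d * 5 + 3) write_output s (return_pmf s')" if s: "s \<in> set_pmf M" for s
  proof -
    obtain w A S where m: "memory d \<epsilon> \<tau> vh N (w, A, S) s" using M(3)[OF s] by auto
    thus ?thesis using write_output_triple[of d D \<epsilon> \<tau> vh N w A S] memory_contents[OF m]
      unfolding triple_def by auto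
  qed
  then obtain f where f: "\<And>s. s \<in> set_pmf M \<Longrightarrow> \<forall>i<d. output_vec (f s) i = vh i + (case contents s of (w, A, S) \<Rightarrow> S i / real N)"
      "\<And>s. s \<in> set_pmf M \<Longrightarrow> exec d D (d * 5 + 3) write_output s (return_pmf (f s))" by metis
  have "exec d D (Suc (N * (80 * d\<^sup>2 + 4) + 1 + (d * 5 + 3))) find_regular_contaminated (init_state \<epsilon> d H vh \<tau>)
      (bind_pmf M (\<lambda>s. return_pmf (f s)))"
    unfolding find_regular_contaminated_def by (rule exec_Seq[OF M(1) f(2)])
  hence "exec d D (N * (80 * d\<^sup>2 + 4) + 5 * d + 5) find_regular_contaminated (init_state \<epsilon> d H vh \<tau>) (map_pmf f M)"
    by (simp add: map_pmf_def[symmetric] algebra_simps)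
  thus ?thesis using M(2) f(1) by blast
qed

section \<open>Iteration count, time bound and conclusion\<close>

lemma error_cong:
  assumes "\<And>i. i < d \<Longrightarrow> f i = g i"
  shows "error d D f \<tau> = error d D g \<tau>"
proof -
  have "dotp d f = dotp d g" using assms by (auto simp: dotp_def fun_eq_iff intro!: sum.cong)
  thus ?thesis by (simp add: error_def)
qed

text \<open>Since d^2 / eps^4 = 1/k is at least 1, rounding it up at most doubles it. With N <= 2
  d^2 / eps^4 and at most 94 N d^2 steps, the total is at most 188 (d / eps)^4.\<close>

lemma iteration_bounds:
  assumes d: "0 < d" and e: "0 < \<epsilon>" "\<epsilon> < 1" and N: "N = nat \<lceil>(real d)\<^sup>2 / \<epsilon> ^ 4\<rceil>"
  shows "1 \<le> filter_rate d \<epsilon> * real N" "filter_rate d \<epsilon> * real N \<le> 2"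
    "real (N * (80 * d\<^sup>2 + 4) + 5 * d + 5) \<le> 188 * (real d / \<epsilon>) ^ 4"
proof -
  let ?R = "(real d)\<^sup>2 / \<epsilon> ^ 4"
  have d1: "1 \<le> real d" using d by simp
  moreover have "real d \<le> (real d)\<^sup>2"
    using mult_left_mono[OF d1, of "real d"] by (simp add: power2_eq_square)
  ultimately have d1: "1 \<le> real d" "1 \<le> (real d)\<^sup>2" "real d \<le> (real d)\<^sup>2" by linarith+
  have e4: "0 < \<epsilon> ^ 4" "\<epsilon> ^ 4 \<le> 1" using e by (auto simp: power_le_one)
  have "\<epsilon> ^ 4 \<le> (real d)\<^sup>2" using e4 d1 by linarith
  hence R: "1 \<le> ?R" using e4 by simp
  have N1: "?R \<le> real N" "real N \<le> ?R + 1" using R unfolding N by linarith+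
  have k: "filter_rate d \<epsilon> * ?R = 1" "0 < filter_rate d \<epsilon>" using d e by (auto simp: filter_rate_def)
  show "1 \<le> filter_rate d \<epsilon> * real N" using mult_left_mono[OF N1(1) less_imp_le[OF k(2)]] unfolding k(1) .
  have N2: "real N \<le> 2 * ?R" "1 \<le> real N" using N1 R by linarith+
  show "filter_rate d \<epsilon> * real N \<le> 2" using mult_left_mono[OF N2(1) less_imp_le[OF k(2)]] unfolding mult.left_commute[of _ 2] k(1) by simp
  have "real (N * (80 * d\<^sup>2 + 4) + 5 * d + 5) = real N * (80 * (real d)\<^sup>2 + 4) + (5 * real d + 5)" by simp
  also have "\<dots> \<le> real N * (84 * (real d)\<^sup>2) + real N * (10 * (real d)\<^sup>2)"
  proof (intro add_mono mult_left_mono)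
    have "5 * real d + 5 \<le> 1 * (10 * (real d)\<^sup>2)" using d1 by linarith
    also have "\<dots> \<le> real N * (10 * (real d)\<^sup>2)" using N2 by (intro mult_right_mono) auto
    finally show "5 * real d + 5 \<le> real N * (10 * (real d)\<^sup>2)" .
  qed (use d1 in auto)
  also have "\<dots> = real N * (94 * (real d)\<^sup>2)" by (simp add: algebra_simps)
  also have "\<dots> \<le> (2 * ?R) * (94 * (real d)\<^sup>2)" using N2 by (intro mult_right_mono) auto
  also have "\<dots> = 188 * (real d / \<epsilon>) ^ 4" by (simp add: power_divide power4_eq_xxxx power2_eq_square)
  finally show "real (N * (80 * d\<^sup>2 + 4) + 5 * d + 5) \<le> 188 * (real d / \<epsilon>) ^ 4" .
qed

theorem theorem8p4:
  shows "\<exists>(FindRegularContaminated :: com) (p :: real poly) (C :: real).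
    \<forall>(\<epsilon> :: real) (d :: nat) (H :: nat set) (v_head :: nat \<Rightarrow> real) (\<tau> :: real)
      (D :: labelled pmf) (D_clean :: labelled pmf) (v_tail :: nat \<Rightarrow> real) (\<eta> :: real).
      0 < \<epsilon> \<and> \<epsilon> < 1 \<and> 0 < d \<and> H \<subseteq> {..<d} \<and> (\<forall>i<d. i \<notin> H \<longrightarrow> v_head i = 0) \<and>
      set_pmf D \<subseteq> cube d \<times> {-1, 1} \<and>
      dist_TV D D_clean \<le> \<eta> \<and>
      map_pmf fst D_clean = pmf_of_set (cube d) \<and>
      (\<forall>(x, y) \<in> set_pmf D_clean. y = sign_pm (dotp d v_head x + dotp d v_tail x + \<tau>)) \<and>
      pnorm 2 d v_tail = 1 \<and> (\<forall>i\<in>H. v_tail i = 0) \<and> (pnorm 4 d v_tail)\<^sup>2 \<le> \<epsilon> \<longrightarrow>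
      (\<exists>t :: nat. real t \<le> poly p (real d / \<epsilon>) \<and>
         (let R = run d D t (FindRegularContaminated, init_state \<epsilon> d H v_head \<tau>) in
           (\<forall>(c, s) \<in> set_pmf R. c = Skip) \<and>
           measure_pmf.prob R {(c, s). error d D (output_vec s) \<tau> \<le> C * (\<eta> / \<epsilon>^3 + \<epsilon>)} \<ge> 0.995))"
proof (rule exI[of _ find_regular_contaminated], rule exI[of _ "monom 188 4"], rule exI[of _ 410000],
    intro allI impI, elim conjE)
  fix \<epsilon> :: real and d :: nat and H :: "nat set" and vh :: "nat \<Rightarrow> real" and \<tau> :: real
    and D Dc :: "labelled pmf" and v :: "nat \<Rightarrow> real" and \<eta> :: real
  assume eps: "0 < \<epsilon>" "\<epsilon> < 1" and d: "0 < d" and head: "\<forall>i<d. i \<notin> H \<longrightarrow> vh i = 0"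
    and D: "set_pmf D \<subseteq> cube d \<times> {-1, 1}" and TV: "dist_TV D Dc \<le> \<eta>"
    and marg: "map_pmf fst Dc = pmf_of_set (cube d)"
    and lab: "\<forall>(x, y) \<in> set_pmf Dc. y = sign_pm (dotp d vh x + dotp d v x + \<tau>)"
    and norm: "pnorm 2 d v = 1" "(pnorm 4 d v)\<^sup>2 \<le> \<epsilon>" and tail: "\<forall>i\<in>H. v i = 0"
  define N where "N = nat \<lceil>(real d)\<^sup>2 / \<epsilon> ^ 4\<rceil>"
  define t where "t = N * (80 * d\<^sup>2 + 4) + 5 * d + 5"
  let ?s = "init_state \<epsilon> d H vh \<tau>" and ?bound = "410000 * (\<eta> / \<epsilon> ^ 3 + \<epsilon>)"
  note it = iteration_bounds[OF d eps N_def]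
  obtain M f where M: "exec d D t find_regular_contaminated ?s (map_pmf f M)"
      "map_pmf contents M = chain d \<epsilon> \<tau> vh D N"
      "\<And>s i. s \<in> set_pmf M \<Longrightarrow> i < d \<Longrightarrow>
        output_vec (f s) i = vh i + (case contents s of (w, A, S) \<Rightarrow> S i / real N)"
    using program_exec[OF d eps(1) N_def, of D H vh \<tau>] unfolding t_def by blast
  have R: "run d D t (find_regular_contaminated, ?s) = map_pmf (Pair Skip) (map_pmf f M)"
    using M(1) by (simp add: exec_def)
  have eta: "0 \<le> \<eta>" using dist_TV_nonneg TV by (rule order_trans)
  have "0.995 \<le> measure_pmf.prob M {s. error d D (output_vec (f s)) \<tau> \<le> ?bound}"
  proof (cases "\<eta> \<le> \<epsilon> ^ 3")
    case True
    interpret contaminated_sampling d \<epsilon> \<eta> \<tau> vh v D "pmf Dc"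
      by (rule contaminated_samplingI[OF eps d head D TV True marg lab norm tail])
    let ?G = "{(w, A, S). error d D (\<lambda>i. vh i + S i / real N) \<tau> \<le> 410000 * \<epsilon>}"
    have "0.995 \<le> measure_pmf.prob (map_pmf contents M) ?G"
      unfolding M(2) by (rule chain_success[OF it(1,2)])
    also have "\<dots> = measure_pmf.prob M (contents -` ?G)" by simp
    also have "\<dots> \<le> measure_pmf.prob M {s. error d D (output_vec (f s)) \<tau> \<le> ?bound}"
    proof (rule measure_pmf.finite_measure_mono_AE)
      have "error d D (output_vec (f s)) \<tau> \<le> ?bound" if "s \<in> set_pmf M" "contents s \<in> ?G" for s
      proof -
        obtain w A S where s: "contents s = (w, A, S)" by (cases "contents s")
        have "error d D (output_vec (f s)) \<tau> = error d D (\<lambda>i. vh i + S i / real N) \<tau>"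
          using M(3)[OF that(1)] s by (intro error_cong) auto
        also have "\<dots> \<le> 410000 * \<epsilon>" using that(2) s by auto
        also have "\<dots> \<le> ?bound" using eta eps by simp
        finally show ?thesis .
      qed
      \<comment> \<open>The final state \<open>f s\<close> is specified only for s in the support of
        M, hence an inclusion that holds almost everywhere.\<close>
      thus "AE s in measure_pmf M. s \<in> contents -` ?G \<longrightarrow> s \<in> {s. error d D (output_vec (f s)) \<tau> \<le> ?bound}"
        by (auto simp: AE_measure_pmf_iff)
    qed simp
    finally show ?thesis .
  next
    case False
    hence "1 \<le> \<eta> / \<epsilon> ^ 3" using eps by simp
    hence "1 \<le> \<eta> / \<epsilon> ^ 3 + \<epsilon>" using eps by linarith
    hence "1 * 1 \<le> ?bound" by (intro mult_mono) auto
    moreover have "error d D u \<tau> \<le> 1 * 1" for u unfolding error_def by simp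
    ultimately have "{s. error d D (output_vec (f s)) \<tau> \<le> ?bound} = UNIV"
      using order_trans by blast
    thus ?thesis by simp
  qed
  moreover have "measure_pmf.prob (map_pmf (Pair Skip) (map_pmf f M)) {(c, s). error d D (output_vec s) \<tau> \<le> ?bound} =
      measure_pmf.prob M {s. error d D (output_vec (f s)) \<tau> \<le> ?bound}"
    by (simp add: vimage_def)
  moreover have "real t \<le> poly (monom 188 4) (real d / \<epsilon>)"
    using it(3) by (simp add: t_def poly_monom)
  ultimately show "\<exists>t. real t \<le> poly (monom 188 4) (real d / \<epsilon>) \<and>
      (let R = run d D t (find_regular_contaminated, ?s) in
        (\<forall>(c, s) \<in> set_pmf R. c = Skip) \<and>
        0.995 \<le> measure_pmf.prob R {(c, s). error d D (output_vec s) \<tau> \<le> ?bound})"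
    unfolding Let_def by (intro exI[of _ t]) (auto simp: R)
qed

end
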